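(* Let $\theta\subset\mathbb R^N$ be a non-empty open set with compact closure satisfying $(A_\theta)$, let $H:\mathbb R^N\times\mathbb R^N\times\mathcal S^N\to\mathbb R$ be a uniformly continuous function satisfying $(A_H)$, and suppose that hypothesis (H) holds with some $M_0>0$ (large enough and independent of $\lambda$). Suppose in addition that $H$ satisfies the radial monotonicity condition $$H(x,lp,lA)\ge H(x,p,A)\quad\text{for all real } l\ge 1,\ (x,p,A)\in\overline\theta\times\mathbb R^N\times\mathcal S^N.$$ For every $\lambda>0$ let $V_\lambda$ be the unique constrained viscosity solution of $$\lambda V(x)+H(x,DV(x),D^2V(x))=0,\quad x\in\overline\theta,$$ such that $\lambda V_\lambda\in \mathrm{Lip}_{M_0}(\overline\theta)$. Let $$\overline H(x,p,A):=\min\Big\{M_0,\ \sup_{l>0}H(x,lp,lA)\Big\}.$$ Then $w_0(x):=\lim_{\lambda\to0^+}\lambda V_\lambda(x)$, $x\in\overline\theta$, is the maximal viscosity subsolution of $W(x)+\overline H(x,DW(x),D^2W(x))=0$, $x\in\theta$, in the sense that for all $x\in\overline\theta$ $$w_0(x)=\sup\{w(x):\ w\in\mathrm{Lip}_{M_0}(\overline\theta),\ w+\overline H(x,Dw,D^2w)\le0\ \text{on }\theta\text{ in viscosity sense}\},$$ and $w_0$ itself belongs to the set over which the supremum is taken.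
   Context: $\mathcal S^N$ is the set of symmetric $N\times N$ real matrices with its usual order. $B(x,s)$ is the open ball of $\mathbb R^N$ with center $x$ and radius $s$. $(A_\theta)$: there exist a bounded, uniformly continuous function $m:\overline\theta\to\mathbb R^N$ with $|m|\le1$ and a constant $r>0$ such that $B(x+s\,m(x),rs)\subset\theta$ for all $x\in\overline\theta$, $s\in(0,r]$. $(A_H)$: (i) $H(x,p,A)\le H(x,p,B)$ for all $(x,p)\in\mathbb R^N\times\mathbb R^N$ and $A,B\in\mathcal S^N$ with $B\le A$. (ii) There is a modulus of continuity $\rho:\mathbb R_+\to\mathbb R_+$, $\rho(0+)=0$, such that $|H(x,p,A)-H(x,q,B)|\le\rho(|p-q|+|A-B|)$ for all $x,p,q\in\mathbb R^N$, $A,B\in\mathcal S^N$, and $$H(y,p,B)-H(x,p,A)\le\rho\big(\tfrac1\varepsilon|x-y|^2+|x-y|(|p|+1)\big)$$ for all $x,y,p\in\mathbb R^N$, $\varepsilon>0$ and $A,B\in\mathcal S^N$ such that $$-\frac3\varepsilon\begin{pmatrix}I&0\\0&I\end{pmatrix}\le\begin{pmatrix}A&0\\0&-B\end{pmatrix}\le\frac3\varepsilon\begin{pmatrix}I&-I\\-I&I\end{pmatrix}.$$ For a bounded measurable $V:\overline\theta\to\mathbb R$, put $V^*(x)=\limsup_{y\to x}V(y)$, $V_*(x)=\liminf_{y\to x}V(y)$, $x\in\overline\theta$. $V$ is a viscosity subsolution of $\lambda V+H(x,DV,D^2V)=0$ on $\theta$ if for all $x\in\theta$ and $\varphi\in C^2(\mathbb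 R^N)$ such that $V^*-\varphi$ has a local maximum on $\theta$ at $x$, $\lambda V^*(x)+H(x,D\varphi(x),D^2\varphi(x))\le0$. It is a viscosity supersolution on $\overline\theta$ if for all $x\in\overline\theta$ and $\varphi\in C^2(\mathbb R^N)$ such that $V_*-\varphi$ has a local minimum on $\overline\theta$ at $x$, $\lambda V_*(x)+H(x,D\varphi(x),D^2\varphi(x))\ge0$. $V$ is a constrained viscosity solution if it is a viscosity subsolution on $\theta$ and a viscosity supersolution on $\overline\theta$. For $M_0>0$, $\mathrm{Lip}_{M_0}(\overline\theta)$ is the set of functions $u:\overline\theta\to\mathbb R$ with $|u(x)|\le M_0$ and $|u(x)-u(y)|\le M_0|x-y|$ for all $x,y\in\overline\theta$. Hypothesis (H): for every $\lambda>0$ the PDE $\lambda V+H(x,DV,D^2V)=0$ on $\overline\theta$ has a constrained viscosity solution $V_\lambda$ with $\lambda V_\lambda\in\mathrm{Lip}_{M_0}(\overline\theta)$. Under the assumptions made, this solution is unique and $\lim_{\lambda\to0^+}\lambda V_\lambda$ exists uniformly on $\overline\theta$. An upper semicontinuous $W$ on $\overline\theta$ satisfies $W+\overline H(x,DW,D^2W)\le0$ on $\theta$ in viscosity sense if for all $x\in\theta$ and $\varphi\in C^2(\mathbb R^N)$ such that $W-\varphi\le W(x)-\varphi(x)$ on $\theta$, one has $W(x)+\overline H(x,D\varphi(x),D^2\varphi(x))\le0$. *)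

theory Defs
  imports "HOL-Analysis.Analysis"
begin

text \<open>Functions on \<open>closure \<theta>\<close>, and functions of a symmetric matrix, are total functions here;
  their values outside \<open>closure \<theta>\<close> resp. outside the symmetric matrices are never constrained.\<close>

definition sym_mats :: "(real^'n^'n) set" where
  "sym_mats = {A. transpose A = A}"

definition mat_le :: "real^'k^'k \<Rightarrow> real^'k^'k \<Rightarrow> bool" (infix "\<preceq>" 50) where
  "A \<preceq> B \<longleftrightarrow> (\<forall>v. v \<bullet> (A *v v) \<le> v \<bullet> (B *v v))"

definition block_mat ::
  "real^'n^'n \<Rightarrow> real^'n^'n \<Rightarrow> real^'n^'n \<Rightarrow> real^'n^'n \<Rightarrow> real^('n + 'n)^('n + 'n)" where
  "block_mat A B C D = (\<chi> i j. case i of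
      Inl i' \<Rightarrow> (case j of Inl j' \<Rightarrow> A $ i' $ j' | Inr j' \<Rightarrow> B $ i' $ j')
    | Inr i' \<Rightarrow> (case j of Inl j' \<Rightarrow> C $ i' $ j' | Inr j' \<Rightarrow> D $ i' $ j'))"

definition domain_cond :: "(real^'n) set \<Rightarrow> bool" where
  "domain_cond \<theta> \<longleftrightarrow> (\<exists>m r.
      bounded (m ` closure \<theta>) \<and> uniformly_continuous_on (closure \<theta>) m \<and>
      (\<forall>x\<in>closure \<theta>. norm (m x) \<le> 1) \<and> 0 < r \<and>
      (\<forall>x\<in>closure \<theta>. \<forall>s. 0 < s \<and> s \<le> r \<longrightarrow> ball (x + s *\<^sub>R m x) (r * s) \<subseteq> \<theta>))"

text \<open>A modulus need not be monotone.\<close>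

definition modulus :: "(real \<Rightarrow> real) \<Rightarrow> bool" where
  "modulus \<rho> \<longleftrightarrow> (\<forall>t\<ge>0. 0 \<le> \<rho> t) \<and> (\<rho> \<longlongrightarrow> 0) (at_right 0)"

text \<open>The norm of a matrix is the Euclidean (Frobenius) one.\<close>

definition hamiltonian_cond :: "(real^'n \<Rightarrow> real^'n \<Rightarrow> real^'n^'n \<Rightarrow> real) \<Rightarrow> bool" where
  "hamiltonian_cond H \<longleftrightarrow>
     (\<forall>x p. \<forall>A\<in>sym_mats. \<forall>B\<in>sym_mats. B \<preceq> A \<longrightarrow> H x p A \<le> H x p B) \<and>
     (\<exists>\<rho>. modulus \<rho> \<and>
       (\<forall>x p q. \<forall>A\<in>sym_mats. \<forall>B\<in>sym_mats.
          \<bar>H x p A - H x q B\<bar> \<le> \<rho> (norm (p - q) + norm (A - B))) \<and>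
       (\<forall>x y p. \<forall>\<epsilon>>0. \<forall>A\<in>sym_mats. \<forall>B\<in>sym_mats.
          - (3 / \<epsilon>) *\<^sub>R block_mat (mat 1) 0 0 (mat 1) \<preceq> block_mat A 0 0 (- B) \<and>
          block_mat A 0 0 (- B) \<preceq> (3 / \<epsilon>) *\<^sub>R block_mat (mat 1) (- mat 1) (- mat 1) (mat 1) \<longrightarrow>
          H y p B - H x p A \<le> \<rho> (1 / \<epsilon> * (norm (x - y))\<^sup>2 + norm (x - y) * (norm p + 1))))"

definition grad :: "(real^'n \<Rightarrow> real) \<Rightarrow> real^'n \<Rightarrow> real^'n" where
  "grad \<phi> x = (\<chi> i. frechet_derivative \<phi> (at x) (axis i 1))"

definition hess :: "(real^'n \<Rightarrow> real) \<Rightarrow> real^'n \<Rightarrow> real^'n^'n" where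
  "hess \<phi> x = matrix (frechet_derivative (grad \<phi>) (at x))"

definition C2 :: "(real^'n \<Rightarrow> real) \<Rightarrow> bool" where
  "C2 \<phi> \<longleftrightarrow> (\<forall>x. \<phi> differentiable (at x)) \<and> (\<forall>x. grad \<phi> differentiable (at x)) \<and>
     continuous_on UNIV (hess \<phi>)"

text \<open>Semicontinuous envelopes relative to \<open>S\<close>. The point \<open>x\<close> itself is included in
  the upper and lower limits, as usual for envelopes. They are used for bounded \<open>V\<close> only,
  where the extended-real limits are finite.\<close>

definition usc_env :: "(real^'n) set \<Rightarrow> (real^'n \<Rightarrow> real) \<Rightarrow> real^'n \<Rightarrow> real" where
  "usc_env S V x = real_of_ereal (Limsup (inf (nhds x) (principal S)) (\<lambda>y. ereal (V y)))"

definition lsc_env :: "(real^'n) set \<Rightarrow> (real^'n \<Rightarrow> real) \<Rightarrow> real^'n \<Rightarrow> real" where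
  "lsc_env S V x = real_of_ereal (Liminf (inf (nhds x) (principal S)) (\<lambda>y. ereal (V y)))"

definition visc_subsol ::
  "(real^'n) set \<Rightarrow> (real^'n \<Rightarrow> real^'n \<Rightarrow> real^'n^'n \<Rightarrow> real) \<Rightarrow> real \<Rightarrow> (real^'n \<Rightarrow> real) \<Rightarrow> bool" where
  "visc_subsol \<theta> H lam V \<longleftrightarrow> (\<forall>x\<in>\<theta>. \<forall>\<phi>. C2 \<phi> \<and>
      (\<forall>\<^sub>F y in at x within \<theta>. usc_env (closure \<theta>) V y - \<phi> y \<le> usc_env (closure \<theta>) V x - \<phi> x) \<longrightarrow>
      lam * usc_env (closure \<theta>) V x + H x (grad \<phi> x) (hess \<phi> x) \<le> 0)"

definition visc_supersol ::
  "(real^'n) set \<Rightarrow> (real^'n \<Rightarrow> real^'n \<Rightarrow> real^'n^'n \<Rightarrow> real) \<Rightarrow> real \<Rightarrow> (real^'n \<Rightarrow> real) \<Rightarrow> bool" where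
  "visc_supersol \<theta> H lam V \<longleftrightarrow> (\<forall>x\<in>closure \<theta>. \<forall>\<phi>. C2 \<phi> \<and>
      (\<forall>\<^sub>F y in at x within closure \<theta>.
         lsc_env (closure \<theta>) V y - \<phi> y \<ge> lsc_env (closure \<theta>) V x - \<phi> x) \<longrightarrow>
      lam * lsc_env (closure \<theta>) V x + H x (grad \<phi> x) (hess \<phi> x) \<ge> 0)"

definition constrained_visc_sol ::
  "(real^'n) set \<Rightarrow> (real^'n \<Rightarrow> real^'n \<Rightarrow> real^'n^'n \<Rightarrow> real) \<Rightarrow> real \<Rightarrow> (real^'n \<Rightarrow> real) \<Rightarrow> bool" where
  "constrained_visc_sol \<theta> H lam V \<longleftrightarrow>
     bounded (V ` closure \<theta>) \<and> V \<in> borel_measurable (restrict_space borel (closure \<theta>)) \<and>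
     visc_subsol \<theta> H lam V \<and> visc_supersol \<theta> H lam V"

definition Lip :: "real \<Rightarrow> (real^'n) set \<Rightarrow> (real^'n \<Rightarrow> real) set" where
  "Lip M S = {u. (\<forall>x\<in>S. \<bar>u x\<bar> \<le> M) \<and> (\<forall>x\<in>S. \<forall>y\<in>S. \<bar>u x - u y\<bar> \<le> M * norm (x - y))}"

text \<open>The supremum may be infinite, so it is taken in the extended reals; the minimum with
  \<open>M\<close> is always a real number.\<close>

definition Hbar ::
  "real \<Rightarrow> (real^'n \<Rightarrow> real^'n \<Rightarrow> real^'n^'n \<Rightarrow> real) \<Rightarrow> real^'n \<Rightarrow> real^'n \<Rightarrow> real^'n^'n \<Rightarrow> real" where
  "Hbar M H x p A =
     real_of_ereal (min (ereal M) (SUP l\<in>{0<..}. ereal (H x (l *\<^sub>R p) (l *\<^sub>R A))))"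

definition usc_on :: "(real^'n) set \<Rightarrow> (real^'n \<Rightarrow> real) \<Rightarrow> bool" where
  "usc_on S W \<longleftrightarrow> (\<forall>x\<in>S. \<forall>c>W x. \<forall>\<^sub>F y in at x within S. W y < c)"

definition visc_le_zero ::
  "(real^'n) set \<Rightarrow> (real^'n \<Rightarrow> real^'n \<Rightarrow> real^'n^'n \<Rightarrow> real) \<Rightarrow> (real^'n \<Rightarrow> real) \<Rightarrow> bool" where
  "visc_le_zero \<theta> G W \<longleftrightarrow> usc_on (closure \<theta>) W \<and>
     (\<forall>x\<in>\<theta>. \<forall>\<phi>. C2 \<phi> \<and> (\<forall>y\<in>\<theta>. W y - \<phi> y \<le> W x - \<phi> x) \<longrightarrow>
        W x + G x (grad \<phi> x) (hess \<phi> x) \<le> 0)"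

definition subsols ::
  "real \<Rightarrow> (real^'n) set \<Rightarrow> (real^'n \<Rightarrow> real^'n \<Rightarrow> real^'n^'n \<Rightarrow> real) \<Rightarrow> (real^'n \<Rightarrow> real) set" where
  "subsols M \<theta> H = {w \<in> Lip M (closure \<theta>). visc_le_zero \<theta> (Hbar M H) w}"

end

theory Submission
  imports Defs
begin

text \<open>Everything rests on a comparison principle for the discounted equations. With
  \<open>w\<^sub>\<lambda> = \<lambda> V\<^sub>\<lambda>\<close>, the function \<open>w\<^sub>\<lambda>\<close> solves \<open>w + H (x, Dw / \<lambda>, D\<^sup>2w / \<lambda>) = 0\<close>. By radial
  monotonicity, for \<open>\<mu> < \<lambda>\<close> the function \<open>w\<^sub>\<mu>\<close> is a subsolution of the equation of \<open>w\<^sub>\<lambda>\<close>, hence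
  \<open>w\<^sub>\<mu> \<le> w\<^sub>\<lambda>\<close>, and the equi-Lipschitz monotone family converges uniformly. A subsolution \<open>w\<close> of the
  limit equation is a subsolution of every discounted equation wherever \<open>w > - M\<^sub>0\<close>, so \<open>w \<le> w\<^sub>\<lambda>\<close>
  for all \<open>\<lambda>\<close>; that the limit is itself a subsolution is a stability argument.

  The comparison principle is proved by doubling variables, with the shift \<open>s m(z)\<close> of Soner that
  moves the maximum point of the subsolution into the interior. A third variable \<open>y\<close> placed between
  \<open>x\<close> and \<open>y'\<close> turns both functions into regularisations \<open>a\<close> (semiconvex) and \<open>b\<close> (semiconcave)
  touching at a maximum of \<open>a - b - p \<bullet> y\<close>. Between \<open>a\<close> and all the functions \<open>b + p \<bullet> y + const\<close>
  one can insert a single \<open>C\<^sup>1\<^sup>,\<^sup>1\<close> function \<open>\<psi>\<close>. It has a second-order expansion almost everywhere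
  by Rademacher's theorem, and the contact points for small \<open>p\<close> do not form a null set, since \<open>p\<close> is
  a Lipschitz function of the contact point. This replaces the theorems of Aleksandrov and Jensen.\<close>

section \<open>Differentiability of Lipschitz functions almost everywhere\<close>

text \<open>The tilted contact gives both regularisations one and the same second-order form
  \<open>W\<close>. With \<open>W\<close> on both sides the block inequality of
  \<open>hamiltonian_cond\<close> can fail: \<open>x \<bullet> W x - y \<bullet> W y = (x - y)
  \<bullet> W (x + y)\<close> need not be bounded by a multiple of the squared norm of
  \<open>x - y\<close>. What repairs it is the gain in passing from a regularisation back to the
  original function: the form becomes \<open>W - W^2 / (2 \<alpha>)\<close> for the subsolution and
  \<open>W + W^2 / (2 \<alpha>)\<close> for the supersolution, and these corrections absorb the
  cross term.

  The points \<open>x\<close> and \<open>y'\<close> range over the compact closure only, whereas the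
  middle variable ranges over the whole space. Hence the contact analysis never meets the boundary.
  A boundary point \<open>y'\<close> is harmless because the supersolution may be tested there; only
  \<open>x\<close> has to be interior.\<close>

lemma lipschitz_real_right_deriv:
  fixes F :: "real \<Rightarrow> real"
  assumes "L-lipschitz_on UNIV F"
  shows "\<exists>N. negligible N \<and> (\<forall>x. x \<notin> N \<longrightarrow> (\<exists>l. ((\<lambda>h. (F (x + h) - F x) / h) \<longlongrightarrow> l) (at_right 0)))"
proof -
  have L: "\<bar>F y - F x\<bar> \<le> L * \<bar>y - x\<bar>" for x y
    using lipschitz_onD[OF assms, of y x] by (simp add: dist_real_def)
  txt \<open>The inverse \<open>J\<close> of \<open>F1\<close> is Lipschitz and \<open>F1\<close> preserves null sets, so the image of Lebesgue
    measure under \<open>J\<close> has a density; Lebesgue's differentiation theorem identifies it with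
    \<open>F' + L + 1\<close>.\<close>
  define F1 where "F1 = (\<lambda>x. F x + (L + 1) * x)"
  \<comment> \<open>The summand \<open>(L + 1) x\<close> is chosen for this unit lower rate: it
    makes the inverse 1-Lipschitz.\<close>
  have F1_ge: "F1 y - F1 x \<ge> y - x" if "x \<le> y" for x y
    using L[of y x] that by (simp add: F1_def algebra_simps abs_le_iff)
  have F1_lip: "\<bar>F1 y - F1 x\<bar> \<le> (2 * L + 1) * \<bar>y - x\<bar>" for x y
  proof -
    have "\<bar>F1 y - F1 x\<bar> \<le> \<bar>F y - F x\<bar> + \<bar>(L + 1) * (y - x)\<bar>"
      by (simp add: F1_def algebra_simps)
    also have "\<bar>(L + 1) * (y - x)\<bar> = (L + 1) * \<bar>y - x\<bar>"
      using lipschitz_on_nonneg[OF assms] by (simp add: abs_mult)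
    finally show ?thesis using L[of y x] by (simp add: algebra_simps)
  qed
  have cont: "continuous_on S F1" for S
    using lipschitz_on_continuous_on[OF assms] continuous_on_subset unfolding F1_def
    by (intro continuous_intros) auto
  have mono: "strict_mono F1"
  proof (rule strict_monoI)
    fix x y :: real assume "x < y"
    then show "F1 x < F1 y" using F1_ge[of x y] by linarith
  qed
  have inj: "inj F1" using mono by (rule strict_mono_imp_inj_on)
  have img: "F1 ` {a..b} = {F1 a..F1 b}" if "a \<le> b" for a b
  proof
    show "F1 ` {a..b} \<subseteq> {F1 a..F1 b}"
      using strict_mono_less_eq[OF mono] by auto
    show "{F1 a..F1 b} \<subseteq> F1 ` {a..b}"
    proof
      fix z assume "z \<in> {F1 a..F1 b}"
      then have "\<exists>x. a \<le> x \<and> x \<le> b \<and> F1 x = z"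
        using that cont by (intro IVT') auto
      then show "z \<in> F1 ` {a..b}" by auto
    qed
  qed
  have surj: "surj F1"
  proof -
    have "z \<in> range F1" for z
    proof -
      define d where "d = \<bar>z - F1 0\<bar>"
      have "F1 d \<ge> z" "F1 (-d) \<le> z"
        using F1_ge[of 0 d] F1_ge[of "-d" 0] by (auto simp: d_def)
      then have "z \<in> F1 ` {-d..d}" using img[of "-d" d] by (auto simp: d_def)
      then show ?thesis by auto
    qed
    then show ?thesis by auto
  qed
  define J where "J = inv F1"
  have JF: "J (F1 x) = x" and FJ: "F1 (J z) = z" for x z
    using inj surj by (auto simp: J_def surj_f_inv_f)
  have J_lip: "\<bar>J y - J x\<bar> \<le> \<bar>y - x\<bar>" for x y
    using F1_ge[of "J x" "J y"] F1_ge[of "J y" "J x"] by (cases "J x \<le> J y") (auto simp: FJ)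
  have "1-lipschitz_on UNIV J"
    using J_lip by (intro lipschitz_onI) (auto simp: dist_real_def)
  then have Jm [measurable]: "J \<in> borel_measurable borel"
    by (intro borel_measurable_continuous_onI lipschitz_on_continuous_on)
  define N where "N = distr lborel borel J"
  have vim: "J -` A = F1 ` A" for A
    using JF FJ by (auto simp: image_iff) metis
  have emN: "emeasure N A = emeasure lborel (F1 ` A)" if "A \<in> sets borel" for A
    using that by (simp add: N_def emeasure_distr vim)
  have sets: "sets N = sets lborel" by (simp add: N_def)
  have ac: "absolutely_continuous lborel N"
    unfolding absolutely_continuous_def
  proof
    fix A assume A: "A \<in> null_sets (lborel :: real measure)"
    then have Ab: "A \<in> sets borel" by auto
    have "negligible A" using A by (simp add: negligible_iff_null_sets null_sets_completionI)
    then have "negligible (F1 ` A)"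
      using F1_lip
      by (intro negligible_locally_Lipschitz_image[where f=F1]) (auto intro!: exI[of _ UNIV] exI[of _ "2*L+1"])
    then have "F1 ` A \<in> null_sets lebesgue" by (simp add: negligible_iff_null_sets)
    moreover have "F1 ` A \<in> sets borel"
      using measurable_sets[OF Jm Ab] by (simp add: vim)
    ultimately have "emeasure lborel (F1 ` A) = 0" by (simp add: null_sets_def)
    then show "A \<in> null_sets N" using Ab by (auto simp: null_sets_def emN sets)
  qed
  obtain f where f [measurable]: "f \<in> borel_measurable lborel" and dens: "density lborel f = N"
    using sigma_finite_measure.Radon_Nikodym[OF lborel.sigma_finite_measure_axioms ac sets] by auto
  have int_f: "(\<integral>\<^sup>+x. f x * indicator {a..b} x \<partial>lborel) = ennreal (F1 b - F1 a)" if "a \<le> b" for a b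
  proof -
    have "emeasure N {a..b} = ennreal (F1 b - F1 a)"
      using that img[OF that] strict_mono_less_eq[OF mono] by (simp add: emN)
    then show ?thesis using dens[symmetric] by (simp add: emeasure_density)
  qed
  have "AE x in lborel. f x * indicator {- real n..real n} x \<noteq> \<infinity>" for n :: nat
    using int_f[of "- real n" "real n"] by (intro nn_integral_PInf_AE) auto
  then have "AE x in lborel. \<forall>n::nat. f x * indicator {- real n..real n} x \<noteq> \<infinity>"
    by (simp add: AE_all_countable)
  then have fin: "AE x in lborel. f x \<noteq> \<infinity>"
  proof eventually_elim
    case (elim x)
    obtain n :: nat where "\<bar>x\<bar> \<le> real n" using real_arch_simple by blast
    then have "x \<in> {- real n..real n}" by auto
    then show ?case using elim[rule_format, of n] by simp
  qed
  define g where "g = (\<lambda>x. enn2real (f x))"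
  have g [measurable]: "g \<in> borel_measurable lborel" by (simp add: g_def)
  have hi: "(g has_integral (F1 b - F1 a)) {a..b}" if "a \<le> b" for a b
  proof -
    have "(\<integral>\<^sup>+x. ennreal (indicator {a..b} x * g x) \<partial>lborel) = (\<integral>\<^sup>+x. f x * indicator {a..b} x \<partial>lborel)"
      using fin by (intro nn_integral_cong_AE) (auto simp: g_def indicator_def less_top)
    also have "\<dots> = ennreal (F1 b - F1 a)" by (rule int_f[OF that])
    finally have "((\<lambda>x. indicator {a..b} x * g x) has_integral (F1 b - F1 a)) UNIV"
      using F1_ge[OF that] that by (intro nn_integral_has_integral) (auto simp: g_def)
    moreover have "(\<lambda>x. indicator {a..b} x * g x) = (\<lambda>x. if x \<in> {a..b} then g x else 0)"
      by (auto simp: indicator_def)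
    ultimately show ?thesis
      using has_integral_restrict_UNIV[of "{a..b}" g] by simp
  qed
  have "g integrable_on cbox a b" for a b
    using hi[of a b] by (cases "a \<le> b") (auto intro!: integrable_on_empty has_integral_integrable)
  \<comment> \<open>The differentiation theorem averages over cubes with \<open>x\<close> as a
    corner, here over \<open>{x..x+h}\<close>. This is why right derivatives come out, and they
    suffice below.\<close>
  then obtain Z where Z: "negligible Z"
    and lim: "\<And>x e. \<lbrakk>x \<notin> Z; 0 < e\<rbrakk> \<Longrightarrow>
      \<exists>d>0. \<forall>h. 0 < h \<and> h < d \<longrightarrow> norm (integral (cbox x (x + h *\<^sub>R One)) g /\<^sub>R h ^ DIM(real) - g x) < e"
    using integrable_ccontinuous_explicit[of g] by metis
  have "((\<lambda>h. (F (x + h) - F x) / h) \<longlongrightarrow> g x - (L + 1)) (at_right 0)" if "x \<notin> Z" for x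
  proof (rule tendstoI)
    fix e :: real assume "0 < e"
    with lim[OF that] obtain d where d: "d > 0"
      and dd: "\<forall>h. 0 < h \<and> h < d \<longrightarrow> norm (integral (cbox x (x + h *\<^sub>R One)) g /\<^sub>R h ^ DIM(real) - g x) < e"
      by blast
    have "dist ((F (x + h) - F x) / h) (g x - (L + 1)) < e" if "0 < h" "h < d" for h
    proof -
      have "integral {x..x+h} g = F1 (x + h) - F1 x"
        using hi[of x "x+h"] that by (simp add: integral_unique)
      moreover have "(F1 (x + h) - F1 x) / h = (F (x + h) - F x) / h + (L + 1)"
        using that by (simp add: F1_def field_simps)
      ultimately show ?thesis using dd[rule_format, of h] that
        by (simp add: dist_real_def divide_inverse mult.commute diff_diff_eq2 diff_add_eq)
    qed
    then show "\<forall>\<^sub>F h in at_right 0. dist ((F (x + h) - F x) / h) (g x - (L + 1)) < e"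
      using d by (auto simp: eventually_at_right_field)
  qed
  then show ?thesis using Z by blast
qed

section \<open>Directional derivatives in several variables\<close>

lemma AE_lborel_negligible:
  fixes P :: "'a::euclidean_space \<Rightarrow> bool"
  assumes "negligible N" and "\<And>x. x \<notin> N \<Longrightarrow> P x"
  shows "AE x in lborel. P x"
proof -
  have "AE x in lebesgue. P x"
    using assms by (intro AE_I'[of N]) (auto simp: negligible_iff_null_sets)
  then show ?thesis by (simp add: AE_completion_iff)
qed

text \<open>Restricting the increments to the sequence \<open>1 / (n + 1)\<close> makes the set of
  convergence Borel, as Fubini's theorem requires. General increments are recovered in
  \<open>rademacher\<close> from the Lipschitz bound.\<close>

lemma AE_convergent_difference_quotient:
  fixes G :: "'a::euclidean_space \<Rightarrow> real"
  assumes "L-lipschitz_on UNIV G"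
  shows "AE x in lborel. convergent (\<lambda>n. (G (x + inverse (real (Suc n)) *\<^sub>R e) - G x) * real (Suc n))"
proof -
  have G [measurable]: "G \<in> borel_measurable borel"
    using lipschitz_on_continuous_on[OF assms] by (rule borel_measurable_continuous_onI)
  define P where "P = (\<lambda>x. convergent (\<lambda>n. (G (x + inverse (real (Suc n)) *\<^sub>R e) - G x) * real (Suc n)))"
  have P [measurable]: "Measurable.pred borel P"
    unfolding P_def Cauchy_convergent_iff[symmetric] by measurable
  txt \<open>Fubini for \<open>(x, t) \<mapsto> x + t e\<close> needs no rotation of the coordinates.\<close>
  have line: "AE t in lborel. P (x + t *\<^sub>R e)" for x
  proof -
    define F where "F = (\<lambda>t. G (x + t *\<^sub>R e))"
    have "(L * norm e)-lipschitz_on UNIV F"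
    proof (rule lipschitz_onI)
      fix s t :: real
      have "dist (F s) (F t) \<le> L * dist (x + s *\<^sub>R e) (x + t *\<^sub>R e)"
        unfolding F_def by (rule lipschitz_onD[OF assms]) auto
      also have "dist (x + s *\<^sub>R e) (x + t *\<^sub>R e) = norm e * dist s t"
        by (simp add: dist_norm flip: scaleR_diff_left)
      finally show "dist (F s) (F t) \<le> L * norm e * dist s t" by (simp add: mult.assoc)
    qed (use lipschitz_on_nonneg[OF assms] in auto)
    from lipschitz_real_right_deriv[OF this] obtain N where N: "negligible N"
      and lim: "\<And>t. t \<notin> N \<Longrightarrow> \<exists>l. ((\<lambda>h. (F (t + h) - F t) / h) \<longlongrightarrow> l) (at_right 0)" by blast
    have "P (x + t *\<^sub>R e)" if "t \<notin> N" for t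
    proof -
      from lim[OF that] obtain l where l: "((\<lambda>h. (F (t + h) - F t) / h) \<longlongrightarrow> l) (at_right 0)" by blast
      have "filterlim (\<lambda>n. inverse (real (Suc n))) (at_right 0) sequentially"
        using LIMSEQ_inverse_real_of_nat by (auto simp: filterlim_at)
      from filterlim_compose[OF l this]
      have "(\<lambda>n. (F (t + inverse (real (Suc n))) - F t) / inverse (real (Suc n))) \<longlonglongrightarrow> l" .
      then show ?thesis
        unfolding P_def F_def convergent_def
        by (auto simp: divide_inverse scaleR_add_left add.assoc simp del: of_nat_Suc)
    qed
    then show ?thesis using N by (rule AE_lborel_negligible[rotated])
  qed
  then have "AE x in lborel. AE t in lborel. P (x + t *\<^sub>R e)" by simp
  moreover have "Measurable.pred (borel \<Otimes>\<^sub>M borel) (\<lambda>z :: 'a \<times> real. P (fst z + snd z *\<^sub>R e))"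
    by measurable
  ultimately have "AE t in lborel. AE x in lborel. P (x + t *\<^sub>R e)"
    by (subst (asm) lborel_pair.AE_commute) (auto simp: pred_def space_pair_measure)
  \<comment> \<open>One good \<open>t\<close> is enough: the property holds at almost every point of
    the translate by \<open>t e\<close>, and Lebesgue measure is translation invariant.\<close>
  then obtain t where "AE x in (lborel :: 'a measure). P (x + t *\<^sub>R e)"
    using eventually_happens'[of "ae_filter (lborel :: real measure)"]
    by (auto simp: ae_filter_eq_bot_iff)
  then have "AE x in distr lborel borel ((+) (t *\<^sub>R e)). P x"
    by (subst AE_distr_iff) (auto simp: add.commute)
  then show ?thesis unfolding lborel_distr_plus P_def .
qed

text \<open>Additivity in the direction can fail at single points; it comes from averaging. The
  second difference \<open>G (x + t (e + f)) - G (x + t e) - G (x + t f) + G x\<close>, divided by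
  \<open>t\<close>, is bounded, and its integral over every box tends to zero, so its pointwise
  limit is zero almost everywhere. Indicators of boxes take the place of the smooth test functions
  of the usual proof.\<close>

lemma AE_difference_quotient_additive:
  fixes G :: "'a::euclidean_space \<Rightarrow> real" and e f :: 'a
  assumes lip: "L-lipschitz_on UNIV G"
  defines "d \<equiv> \<lambda>v x. lim (\<lambda>n. (G (x + inverse (real (Suc n)) *\<^sub>R v) - G x) * real (Suc n))"
  shows "AE x in lborel. d (e + f) x = d e x + d f x"
proof -
  have L0: "0 \<le> L" by (rule lipschitz_on_nonneg[OF lip])
  have L: "\<bar>G y - G x\<bar> \<le> L * norm (y - x)" for x y
    using lipschitz_onD[OF lip, of y x] by (simp add: dist_norm)
  have G [measurable]: "G \<in> borel_measurable borel"
    using lipschitz_on_continuous_on[OF lip] by (rule borel_measurable_continuous_onI)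
  define t where "t = (\<lambda>n. inverse (real (Suc n)))"
  have t0: "t \<longlonglongrightarrow> 0" unfolding t_def by (rule LIMSEQ_inverse_real_of_nat)
  have t1: "0 < t n" "t n \<le> 1" "real (Suc n) * t n = 1" for n
    by (auto simp: t_def field_simps)
  define q where "q = (\<lambda>n v x. (G (x + t n *\<^sub>R v) - G x) * real (Suc n))"
  have q [measurable]: "q n v \<in> borel_measurable borel" for n v
    unfolding q_def by measurable
  have d_eq: "d v x = lim (\<lambda>n. q n v x)" for v x by (simp add: d_def q_def t_def)
  have d [measurable]: "d v \<in> borel_measurable borel" for v
    unfolding d_eq[abs_def] by measurable
  have q_bound: "\<bar>q n v x\<bar> \<le> L * norm v" for n v x
  proof -
    have "\<bar>q n v x\<bar> = \<bar>G (x + t n *\<^sub>R v) - G x\<bar> * real (Suc n)" by (simp add: q_def abs_mult)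
    also have "\<dots> \<le> (L * norm (t n *\<^sub>R v)) * real (Suc n)"
      using L[of "x + t n *\<^sub>R v" x] by (intro mult_right_mono) auto
    also have "\<dots> = L * norm v * (real (Suc n) * t n)" using t1(1)[of n] by simp
    finally show ?thesis by (simp only: t1(3) mult_1_right)
  qed
  have AE_lim: "AE x in lborel. (\<lambda>n. q n v x) \<longlonglongrightarrow> d v x" for v
    using AE_convergent_difference_quotient[OF lip, of v]
    by eventually_elim (simp add: d_eq q_def t_def convergent_LIMSEQ_iff del: of_nat_Suc)
  define R where "R = (\<lambda>x. d (e + f) x - d e x - d f x)"
  define r where "r = (\<lambda>n x. q n (e + f) x - q n e x - q n f x)"
  txt \<open>Because \<open>r n\<close> is a difference of two translates of a bounded function, its integral over a box
    only sees the boundary layer of the box.\<close>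
  have r_alt: "r n x = q n f (t n *\<^sub>R e + x) - q n f x" for n x
    by (simp add: r_def q_def algebra_simps)
  have R_lim: "AE x in lborel. (\<lambda>n. r n x) \<longlonglongrightarrow> R x"
    using AE_lim[of "e + f"] AE_lim[of e] AE_lim[of f]
    by eventually_elim (auto simp: r_def R_def intro!: tendsto_intros)
  have [measurable]: "R \<in> borel_measurable borel" "r n \<in> borel_measurable borel" for n
    unfolding R_def r_def by measurable
  have r_bound: "\<bar>r n x\<bar> \<le> 2 * (L * norm f)" for n x
    using q_bound[of n f "t n *\<^sub>R e + x"] q_bound[of n f x] by (simp add: r_alt)
  have box: "integrable lborel (\<lambda>x. indicator (cbox a b) x * R x) \<and>
    (LINT x|lborel. indicator (cbox a b) x * R x) = 0" for a b
  proof -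
    let ?I = "indicator (cbox a b) :: 'a \<Rightarrow> real"
    have fin: "emeasure lborel (cbox a b) < \<infinity>" using emeasure_lborel_cbox_finite[of a b] by simp
    have intI: "integrable lborel (\<lambda>x. (2 * (L * norm f)) * ?I x)" 
      using fin by (intro integrable_mult_right integrable_real_indicator) auto
    have lim1: "AE x in lborel. (\<lambda>n. ?I x * r n x) \<longlonglongrightarrow> ?I x * R x"
      using R_lim by eventually_elim (auto intro!: tendsto_intros)
    have bd1: "AE x in lborel. norm (?I x * r n x) \<le> 2 * (L * norm f) * ?I x" for n
      using r_bound by (auto simp: indicator_def)
    have int1: "integrable lborel (\<lambda>x. ?I x * R x)"
      by (rule integrable_dominated_convergence[OF _ _ intI lim1 bd1]) auto
    have conv1: "(\<lambda>n. LINT x|lborel. ?I x * r n x) \<longlonglongrightarrow> (LINT x|lborel. ?I x * R x)"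
      by (rule integral_dominated_convergence[OF _ _ intI lim1 bd1]) auto
    have intq: "integrable lborel (\<lambda>x. ?I x * q n f x)" for n
    proof (rule Bochner_Integration.integrable_bound[of _ "\<lambda>x. (L * norm f) * ?I x"])
      show "integrable lborel (\<lambda>x. (L * norm f) * ?I x)"
        using fin by (intro integrable_mult_right integrable_real_indicator) auto
      show "AE x in lborel. norm (?I x * q n f x) \<le> norm (L * norm f * ?I x)"
        using q_bound[of n f] L0 by (auto simp: indicator_def)
    qed auto
    have shift_int: "integrable lborel (\<lambda>x. g (c + x))" and shift: "(LINT x|lborel. g (c + x)) = (LINT x|lborel. g x)"
      if "integrable lborel g" for c and g :: "'a \<Rightarrow> real"
    proof -
      have g: "g \<in> borel_measurable borel" using that by auto
      have "integrable (distr lborel borel ((+) c)) g" using that by (simp add: lborel_distr_plus)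
      then show "integrable lborel (\<lambda>x. g (c + x))"
        using g by (subst (asm) integrable_distr_eq) auto
      have "(LINT x|distr lborel borel ((+) c). g x) = (LINT x|lborel. g (c + x))"
        using g by (intro integral_distr) auto
      then show "(LINT x|lborel. g (c + x)) = (LINT x|lborel. g x)" by (simp add: lborel_distr_plus)
    qed
    have eq: "(LINT x|lborel. ?I x * r n x) = (LINT x|lborel. (?I (x - t n *\<^sub>R e) - ?I x) * q n f x)" for n
    proof -
      have i1: "integrable lborel (\<lambda>x. ?I x * q n f (t n *\<^sub>R e + x))"
      proof (rule Bochner_Integration.integrable_bound[of _ "\<lambda>x. (L * norm f) * ?I x"])
        show "integrable lborel (\<lambda>x. (L * norm f) * ?I x)"
          using fin by (intro integrable_mult_right integrable_real_indicator) auto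
        show "AE x in lborel. norm (?I x * q n f (t n *\<^sub>R e + x)) \<le> norm (L * norm f * ?I x)"
          using q_bound[of n f] L0 by (auto simp: indicator_def)
      qed auto
      from shift_int[OF this, of "- (t n *\<^sub>R e)"] shift[OF this, of "- (t n *\<^sub>R e)"]
      have i2: "integrable lborel (\<lambda>x. ?I (x - t n *\<^sub>R e) * q n f x)"
        and s2: "(LINT x|lborel. ?I (x - t n *\<^sub>R e) * q n f x) = (LINT x|lborel. ?I x * q n f (t n *\<^sub>R e + x))"
        by simp_all
      show ?thesis
        using i1 i2 s2 intq[of n] by (simp add: r_alt right_diff_distrib left_diff_distrib)
    qed
    obtain B where B: "\<And>x. x \<in> cbox a b \<Longrightarrow> norm x \<le> B"
      using bounded_cbox[of a b] by (auto simp: bounded_iff)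
    let ?J = "indicator (cball 0 (B + norm e)) :: 'a \<Rightarrow> real"
    have intJ: "integrable lborel (\<lambda>x. (L * norm f) * ?J x)"
      using emeasure_lborel_cball_finite[of 0 "B + norm e"]
      by (intro integrable_mult_right integrable_real_indicator) auto
    have bd2: "AE x in lborel. norm ((?I (x - t n *\<^sub>R e) - ?I x) * q n f x) \<le> L * norm f * ?J x" for n
    proof (rule AE_I2)
      fix x
      have "norm x \<le> B + norm e" if "x - t n *\<^sub>R e \<in> cbox a b"
      proof -
        have "norm x \<le> norm (x - t n *\<^sub>R e) + norm (t n *\<^sub>R e)" by (metis diff_add_cancel norm_triangle_ineq)
        moreover have "norm (t n *\<^sub>R e) \<le> 1 * norm e"
          using t1(1,2)[of n] mult_right_mono[of "t n" 1 "norm e"] by simp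
        ultimately show ?thesis using B[OF that] by simp
      qed
      moreover have "norm x \<le> B + norm e" if "x \<in> cbox a b"
        using B[OF that] by (simp add: add_increasing2)
      ultimately have "\<bar>?I (x - t n *\<^sub>R e) - ?I x\<bar> \<le> ?J x"
        by (auto simp: indicator_def)
      then have "\<bar>?I (x - t n *\<^sub>R e) - ?I x\<bar> * \<bar>q n f x\<bar> \<le> ?J x * (L * norm f)"
        using q_bound[of n f x] by (intro mult_mono) auto
      then show "norm ((?I (x - t n *\<^sub>R e) - ?I x) * q n f x) \<le> L * norm f * ?J x"
        by (simp add: abs_mult mult.commute)
    qed
    \<comment> \<open>Off the boundary of the box, \<open>x\<close> and its small translates lie on
      the same side, so the difference of the indicators is eventually zero.\<close>
    have "AE x in lborel. x \<notin> cbox a b - box a b"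
      using negligible_frontier_interval[of a b]
      by (rule AE_lborel_negligible) simp
    then have lim2: "AE x in lborel. (\<lambda>n. (?I (x - t n *\<^sub>R e) - ?I x) * q n f x) \<longlonglongrightarrow> 0"
    proof eventually_elim
      case (elim x)
      have "(\<lambda>n. x - t n *\<^sub>R e) \<longlonglongrightarrow> x - 0 *\<^sub>R e" by (intro tendsto_intros t0)
      then have tx: "(\<lambda>n. x - t n *\<^sub>R e) \<longlonglongrightarrow> x" by simp
      have "\<forall>\<^sub>F n in sequentially. ?I (x - t n *\<^sub>R e) = ?I x"
      proof (cases "x \<in> box a b")
        case True
        from topological_tendstoD[OF tx open_box True] show ?thesis
          by eventually_elim (use True box_subset_cbox in \<open>auto simp: indicator_def\<close>)
      next
        case False
        then have x: "x \<in> - cbox a b" using elim by auto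
        from topological_tendstoD[OF tx _ x] show ?thesis
          using x by (auto elim!: eventually_mono simp: indicator_def)
      qed
      then show ?case by (intro tendsto_eventually) (auto elim!: eventually_mono)
    qed
    have "(\<lambda>n. LINT x|lborel. (?I (x - t n *\<^sub>R e) - ?I x) * q n f x) \<longlonglongrightarrow> (LINT x|(lborel :: 'a measure). 0)"
      by (rule integral_dominated_convergence[OF _ _ intJ lim2 bd2]) auto
    then have "(\<lambda>n. LINT x|lborel. ?I x * r n x) \<longlonglongrightarrow> 0" by (simp add: eq)
    then show ?thesis using conv1 int1 LIMSEQ_unique by blast
  qed
  have hi: "(R has_integral 0) (cbox a b)" for a b
  proof -
    have "((\<lambda>x. indicator (cbox a b) x * R x) has_integral 0) UNIV"
      using has_integral_integral_lborel[of "\<lambda>x. indicator (cbox a b) x * R x"] box[of a b] by auto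
    moreover have "(\<lambda>x. indicator (cbox a b) x * R x) = (\<lambda>x. if x \<in> cbox a b then R x else 0)"
      by (auto simp: indicator_def)
    ultimately show ?thesis using has_integral_restrict_UNIV[of "cbox a b" R] by simp
  qed
  \<comment> \<open>Since all box integrals of \<open>R\<close> vanish, so do its averages over
    small cubes, and these converge to \<open>R\<close> almost everywhere.\<close>
  then have "R integrable_on cbox a b" for a b by blast
  from integrable_ccontinuous_explicit[OF this] obtain N where N: "negligible N"
    and lim: "\<And>x e. \<lbrakk>x \<notin> N; 0 < e\<rbrakk> \<Longrightarrow> \<exists>d>0. \<forall>h. 0 < h \<and> h < d \<longrightarrow>
      norm (integral (cbox x (x + h *\<^sub>R One)) R /\<^sub>R h ^ DIM('a) - R x) < e"
    by metis
  have R0: "R x = 0" if "x \<notin> N" for x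
  proof (rule ccontr)
    assume "R x \<noteq> 0"
    then have "0 < norm (R x)" by simp
    from lim[OF that this] obtain d where "d > 0" "\<forall>h. 0 < h \<and> h < d \<longrightarrow>
      norm (integral (cbox x (x + h *\<^sub>R One)) R /\<^sub>R h ^ DIM('a) - R x) < norm (R x)"
      by blast
    from this(2)[rule_format, of "d/2"] \<open>d > 0\<close> show False
      using integral_unique[OF hi] by auto
  qed
  from N R0 have "AE x in lborel. R x = 0" by (rule AE_lborel_negligible)
  then show ?thesis by eventually_elim (simp add: R_def)
qed

text \<open>Cauchy's functional equation over the rationals needs no regularity of \<open>A\<close>.
  It yields homogeneity from additivity in countably many directions, which is all that a single
  exceptional null set allows.\<close>

lemma rational_additive_scale:
  fixes A :: "rat \<Rightarrow> real"
  assumes add: "\<And>r s. A (r + s) = A r + A s"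
  shows "A r = of_rat r * A 1"
proof -
  have A0: "A 0 = 0" using add[of 0 0] by simp
  have nat: "A (of_nat n * s) = of_nat n * A s" for n s
    by (induction n) (auto simp: A0 add distrib_right)
  have neg: "A (- s) = - A s" for s using add[of s "- s"] A0 by simp
  have int: "A (of_int k * s) = of_int k * A s" for k s
  proof (cases "0 \<le> k")
    case True
    then obtain n where "k = int n" using nonneg_int_cases by blast
    then show ?thesis using nat[of n s] by simp
  next
    case False
    then obtain n where k: "k = - int n" using nonneg_int_cases[of "- k"] by (metis linear minus_minus neg_0_le_iff_le)
    have "A (of_int k * s) = - A (of_nat n * s)" using neg[of "of_nat n * s"] by (simp add: k)
    then show ?thesis by (simp only: nat) (simp add: k)
  qed
  obtain a b where r: "r = of_int a / of_int b" "b > 0"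
    using quotient_of_div[of r] quotient_of_denom_pos[of r] by (cases "quotient_of r") auto
  have "of_int b * A r = A (of_int b * r)" by (simp add: int)
  also have "of_int b * r = of_int a * 1" using r by simp
  also have "A \<dots> = of_int a * A 1" by (rule int)
  finally have "of_int b * A r = of_int a * A 1" .
  moreover have "of_rat r = (of_int a / of_int b :: real)" using r by (simp add: of_rat_divide)
  ultimately have "of_int b * A r = of_int b * (of_rat r * A 1)" using r(2) by simp
  then show ?thesis using r(2) by simp
qed

text \<open>Rational combinations of the basis form a countable dense set \<open>Q\<close> closed
  under addition, so one null set contains all failures of convergence and of additivity on
  \<open>Q\<close>. Elsewhere the limits agree on \<open>Q\<close> with a linear map
  \<open>T\<close>; the Lipschitz bound and a finite net of the unit sphere make the convergence
  uniform in the direction.\<close>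

theorem rademacher:
  fixes G :: "'a::euclidean_space \<Rightarrow> real"
  assumes lip: "L-lipschitz_on UNIV G"
  shows "AE x in lborel. \<exists>D. (G has_derivative D) (at x)"
proof -
  have L0: "0 \<le> L" by (rule lipschitz_on_nonneg[OF lip])
  have L: "\<bar>G y - G x\<bar> \<le> L * norm (y - x)" for x y
    using lipschitz_onD[OF lip, of y x] by (simp add: dist_norm)
  define t where "t = (\<lambda>n. inverse (real (Suc n)))"
  define q where "q = (\<lambda>v x n. (G (x + t n *\<^sub>R v) - G x) * real (Suc n))"
  define d where "d = (\<lambda>v x. lim (q v x))"
  define Q :: "'a set" where
    "Q = (\<lambda>f. \<Sum>b\<in>Basis. of_rat (f b) *\<^sub>R b) ` (Basis \<rightarrow>\<^sub>E UNIV)"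
  have Q_iff: "v \<in> Q \<longleftrightarrow> (\<exists>f. v = (\<Sum>b\<in>Basis. of_rat (f b) *\<^sub>R b))" for v
  proof
    assume "\<exists>f. v = (\<Sum>b\<in>Basis. of_rat (f b) *\<^sub>R b)"
    then obtain f where "v = (\<Sum>b\<in>Basis. of_rat (f b) *\<^sub>R b)" by blast
    moreover have "(\<Sum>b\<in>Basis. of_rat (f b) *\<^sub>R b) = (\<Sum>b\<in>Basis. of_rat (restrict f Basis b) *\<^sub>R b)"
      by (rule sum.cong) auto
    ultimately have "v = (\<Sum>b\<in>Basis. of_rat (restrict f Basis b) *\<^sub>R b)" by (rule trans)
    then show "v \<in> Q" unfolding Q_def by (rule image_eqI[where x="restrict f Basis"]) auto
  qed (unfold Q_def, blast)
  have Q_count: "countable Q" unfolding Q_def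
    by (intro countable_image countable_PiE) auto
  have Q_dense: "\<exists>v\<in>Q. norm (w - v) < \<epsilon>" if "\<epsilon> > 0" for w \<epsilon>
  proof -
    have "\<exists>r. \<bar>w \<bullet> b - of_rat r\<bar> < \<epsilon> / DIM('a)" for b
    proof -
      have "\<epsilon> / DIM('a) > 0" using that by simp
      then have "w \<bullet> b < w \<bullet> b + \<epsilon> / DIM('a)" by simp
      from of_rat_dense[OF this] obtain r where "w \<bullet> b < of_rat r" "of_rat r < w \<bullet> b + \<epsilon> / DIM('a)" by blast
      then show ?thesis by (intro exI[of _ r]) auto
    qed
    then obtain f where f: "\<bar>w \<bullet> b - of_rat (f b)\<bar> < \<epsilon> / DIM('a)" for b by metis
    define v where "v = (\<Sum>b\<in>Basis. of_rat (f b) *\<^sub>R b)"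
    have "norm (w - v) \<le> (\<Sum>b\<in>Basis. \<bar>(w - v) \<bullet> b\<bar>)" by (rule norm_le_l1)
    also have "\<dots> < (\<Sum>b\<in>(Basis::'a set). \<epsilon> / DIM('a))"
    proof (rule sum_strict_mono)
      fix b :: 'a assume "b \<in> Basis"
      then have "v \<bullet> b = of_rat (f b)" by (simp add: v_def inner_sum_left inner_Basis if_distrib cong: if_cong)
      then show "\<bar>(w - v) \<bullet> b\<bar> < \<epsilon> / DIM('a)" using f[of b] by (simp add: inner_diff_left)
    qed auto
    also have "\<dots> = \<epsilon>" by simp
    finally show ?thesis using Q_iff v_def by blast
  qed
  have "AE x in lborel. \<forall>v\<in>Q. convergent (q v x)"
    using AE_convergent_difference_quotient[OF lip] Q_count
    by (simp add: AE_ball_countable q_def[abs_def] t_def)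
  moreover have "AE x in lborel. \<forall>v\<in>Q. \<forall>w\<in>Q. d (v + w) x = d v x + d w x"
    using AE_difference_quotient_additive[OF lip] Q_count
    by (simp add: AE_ball_countable d_def q_def[abs_def] t_def)
  ultimately show ?thesis
  proof eventually_elim
    case (elim x)
    have conv: "q v x \<longlonglongrightarrow> d v x" if "v \<in> Q" for v
      using elim(1) that by (simp add: d_def convergent_LIMSEQ_iff)
    have add: "d (v + w) x = d v x + d w x" if "v \<in> Q" "w \<in> Q" for v w
      using elim(2) that by blast
    have part: "(\<Sum>b\<in>S. of_rat (f b) *\<^sub>R b) \<in> Q" if "S \<subseteq> Basis" for S and f :: "'a \<Rightarrow> rat"
      unfolding Q_iff
    proof (intro exI)
      show "(\<Sum>b\<in>S. of_rat (f b) *\<^sub>R b) = (\<Sum>b\<in>Basis. of_rat (if b \<in> S then f b else 0) *\<^sub>R b)"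
        using that by (intro sum.mono_neutral_cong_left) auto
    qed
    have scale: "d (of_rat r *\<^sub>R b) x = of_rat r * d b x" if "b \<in> Basis" for r :: rat and b
    proof -
      have m: "of_rat s *\<^sub>R b \<in> Q" for s :: rat
        using part[of "{b}" "\<lambda>_. s"] that by simp
      have "d (of_rat (r + s) *\<^sub>R b) x = d (of_rat r *\<^sub>R b) x + d (of_rat s *\<^sub>R b) x" for r s :: rat
        using add[OF m m] by (simp add: of_rat_add scaleR_add_left)
      from rational_additive_scale[of "\<lambda>s. d (of_rat s *\<^sub>R b) x", OF this]
      show ?thesis by simp
    qed
    define T where "T = (\<lambda>v. \<Sum>b\<in>Basis. (v \<bullet> b) * d b x)"
    have dT: "d v x = T v" if v: "v \<in> Q" for v
    proof -
      obtain f where f: "v = (\<Sum>b\<in>Basis. of_rat (f b) *\<^sub>R b)" using v Q_iff by blast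
      have "d 0 x = 0" using add[of 0 0] part[of "{}" f] by simp
      have "d (\<Sum>b\<in>S. of_rat (f b) *\<^sub>R b) x = (\<Sum>b\<in>S. of_rat (f b) * d b x)" if "S \<subseteq> Basis" for S
        using finite_subset[OF that finite_Basis] that
      proof (induction S)
        case (insert b S)
        then show ?case
          using add[OF part[of "{b}" f] part[of S f]] scale[of b "f b"] by simp
      qed (use \<open>d 0 x = 0\<close> in simp)
      then have "d v x = (\<Sum>b\<in>Basis. of_rat (f b) * d b x)" using f by blast
      moreover have "v \<bullet> b = of_rat (f b)" if "b \<in> Basis" for b
        using that by (simp add: f inner_sum_left inner_Basis if_distrib cong: if_cong)
      ultimately show ?thesis by (simp add: T_def)
    qed
    have T: "bounded_linear T" unfolding T_def
      by (intro bounded_linear_sum bounded_linear_mult_left[THEN bounded_linear_compose] bounded_linear_inner_left)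
    obtain B where B: "B > 0" "\<And>v. \<bar>T v\<bar> \<le> B * norm v"
      using bounded_linear.pos_bounded[OF T] by (auto simp: mult.commute)
    interpret T: bounded_linear T by (rule T)
    have "(G has_derivative T) (at x)"
      unfolding has_derivative_at_alt
    proof (intro conjI T allI impI)
      fix e :: real assume e: "0 < e"
      \<comment> \<open>The denominator collects three errors: moving the argument of
        \<open>G\<close> costs \<open>3 L\<close>, the difference quotient \<open>2\<close>, moving
        the argument of \<open>T\<close> costs \<open>3 B\<close>, each times
        \<open>s * \<epsilon>\<close>.\<close>
      define \<epsilon> where "\<epsilon> = e / (3 * L + 2 + 3 * B)"
      have \<epsilon>: "\<epsilon> > 0" "\<epsilon> * (3 * L + 2 + 3 * B) = e"
        using e L0 B(1) by (auto simp: \<epsilon>_def)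
      have "sphere 0 1 \<subseteq> (\<Union>v\<in>Q. ball v \<epsilon>)"
        using Q_dense[OF \<epsilon>(1)] by (force simp: dist_norm norm_minus_commute)
      from compactE_image[OF compact_sphere open_ball this]
      obtain F where F: "F \<subseteq> Q" "finite F" "sphere (0::'a) 1 \<subseteq> (\<Union>v\<in>F. ball v \<epsilon>)"
        by metis
      have "\<forall>\<^sub>F n in sequentially. \<forall>v\<in>F. dist (q v x n) (T v) < \<epsilon>"
        using F conv dT \<epsilon>(1) by (subst eventually_ball_finite_distrib) (auto intro!: tendstoD)
      moreover have "\<forall>\<^sub>F n in sequentially. t n < \<epsilon>"
        using order_tendstoD(2)[OF LIMSEQ_inverse_real_of_nat \<epsilon>(1)] by (simp add: t_def)
      ultimately have "\<forall>\<^sub>F n in sequentially. (\<forall>v\<in>F. dist (q v x n) (T v) < \<epsilon>) \<and> t n < \<epsilon>"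
        by (rule eventually_conj)
      then obtain N where "\<forall>n\<ge>N. (\<forall>v\<in>F. dist (q v x n) (T v) < \<epsilon>) \<and> t n < \<epsilon>"
        unfolding eventually_sequentially by blast
      then have N: "\<And>n v. n \<ge> N \<Longrightarrow> v \<in> F \<Longrightarrow> \<bar>q v x n - T v\<bar> < \<epsilon>"
        "\<And>n. n \<ge> N \<Longrightarrow> t n < \<epsilon>"
        by (auto simp: dist_real_def)
      have "norm (G y - G x - T (y - x)) \<le> e * norm (y - x)" if y: "norm (y - x) < t N" for y
      proof (cases "y = x")
        case False
        define s where "s = norm (y - x)"
        have s: "s > 0" using False by (simp add: s_def)
        define w where "w = (y - x) /\<^sub>R s"
        have w: "norm w = 1" "y = x + s *\<^sub>R w" using s by (auto simp: w_def s_def)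
        \<comment> \<open>\<open>n + 1\<close> is the integer part of \<open>1 / s\<close>, so
          \<open>t n\<close> is the smallest member of the sequence that is at least
          \<open>s\<close>. Then \<open>t n - s \<le> s * t n\<close>, and replacing
          \<open>s\<close> by \<open>t n\<close> is an error of lower order than
          \<open>s\<close>.\<close>
        define n where "n = nat \<lfloor>1 / s\<rfloor> - 1"
        have "1 / s > real (Suc N)" using y s by (simp add: t_def s_def field_simps)
        then have fl: "\<lfloor>1 / s\<rfloor> \<ge> int (Suc N)" by linarith
        then have "real (Suc n) = of_int \<lfloor>1 / s\<rfloor>" by (simp add: n_def)
        then have n: "real (Suc n) \<le> 1 / s" "1 / s < real (Suc n) + 1" by linarith+
        have "n \<ge> N" using fl by (simp add: n_def le_diff_conv2)
        have tn: "s \<le> t n" "t n > 0" "t n \<le> 1"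
          using n s by (auto simp: t_def field_simps)
        have tn2: "t n - s \<le> s * t n"
        proof -
          have "1 \<le> s * (real (Suc n) + 1)" using n(2) s by (simp add: field_simps)
          then have "t n * 1 \<le> t n * (s * (real (Suc n) + 1))" using tn(2) by (intro mult_left_mono) auto
          also have "\<dots> = s * (t n * real (Suc n)) + s * t n" by (simp add: algebra_simps)
          also have "t n * real (Suc n) = 1" by (simp add: t_def)
          finally show ?thesis by simp
        qed
        have t\<epsilon>: "t n < \<epsilon>" using N(2)[OF \<open>n \<ge> N\<close>] .
        have t2: "t n \<le> 2 * s" using tn tn2 mult_left_mono[of "t n" 1 s] s by linarith
        have t3: "t n - s \<le> s * \<epsilon>" using tn2 t\<epsilon> s by (meson less_imp_le mult_left_mono order_trans)
        from w F(3) obtain v where v: "v \<in> F" "norm (v - w) < \<epsilon>" by (force simp: dist_norm)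
        have dv: "norm (t n *\<^sub>R v - s *\<^sub>R w) \<le> 3 * s * \<epsilon>"
        proof -
          have "t n *\<^sub>R v - s *\<^sub>R w = t n *\<^sub>R (v - w) + (t n - s) *\<^sub>R w" by (simp add: algebra_simps)
          then have "norm (t n *\<^sub>R v - s *\<^sub>R w) \<le> t n * norm (v - w) + (t n - s)"
            using norm_triangle_ineq[of "t n *\<^sub>R (v - w)" "(t n - s) *\<^sub>R w"] tn w by simp
          also have "t n * norm (v - w) \<le> (2 * s) * \<epsilon>"
            using t2 v(2) tn s \<epsilon>(1) by (intro mult_mono) auto
          finally show ?thesis using t3 by (simp add: algebra_simps)
        qed
        have "\<bar>G y - G (x + t n *\<^sub>R v)\<bar> \<le> L * (3 * s * \<epsilon>)"
        proof -
          have "\<bar>G y - G (x + t n *\<^sub>R v)\<bar> \<le> L * norm (t n *\<^sub>R v - s *\<^sub>R w)"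
            using L[of y "x + t n *\<^sub>R v"] w(2) by (simp add: norm_minus_commute)
          also have "\<dots> \<le> L * (3 * s * \<epsilon>)" using dv L0 by (rule mult_left_mono)
          finally show ?thesis .
        qed
        moreover have "\<bar>G (x + t n *\<^sub>R v) - G x - T (t n *\<^sub>R v)\<bar> \<le> 2 * s * \<epsilon>"
        proof -
          have 1: "t n * real (Suc n) = 1" by (simp add: t_def)
          have "t n * (q v x n - T v) = (t n * real (Suc n)) * (G (x + t n *\<^sub>R v) - G x) - t n * T v"
            by (simp only: q_def right_diff_distrib mult_ac)
          also have "\<dots> = G (x + t n *\<^sub>R v) - G x - T (t n *\<^sub>R v)"
            by (simp only: 1 mult_1_left T.scaleR real_scaleR_def)
          finally have "\<bar>G (x + t n *\<^sub>R v) - G x - T (t n *\<^sub>R v)\<bar> = t n * \<bar>q v x n - T v\<bar>"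
            using tn(2) by (metis abs_mult abs_of_pos)
          also have "\<dots> \<le> (2 * s) * \<epsilon>"
            using N(1)[OF \<open>n \<ge> N\<close> v(1)] t2 tn s by (intro mult_mono) auto
          finally show ?thesis .
        qed
        moreover have "\<bar>T (t n *\<^sub>R v) - T (s *\<^sub>R w)\<bar> \<le> B * (3 * s * \<epsilon>)"
        proof -
          have "\<bar>T (t n *\<^sub>R v) - T (s *\<^sub>R w)\<bar> \<le> B * norm (t n *\<^sub>R v - s *\<^sub>R w)"
            using B(2)[of "t n *\<^sub>R v - s *\<^sub>R w"] by (simp add: T.diff)
          also have "\<dots> \<le> B * (3 * s * \<epsilon>)" using dv B(1) by (intro mult_left_mono) auto
          finally show ?thesis .
        qed
        ultimately have "\<bar>G y - G x - T (s *\<^sub>R w)\<bar> \<le> L * (3 * s * \<epsilon>) + 2 * s * \<epsilon> + B * (3 * s * \<epsilon>)"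
          by linarith
        also have "\<dots> = s * (\<epsilon> * (3 * L + 2 + 3 * B))" by (simp add: algebra_simps)
        also have "\<dots> = e * s" using \<epsilon>(2) by (simp only: mult.commute)
        finally have "\<bar>G y - G x - T (s *\<^sub>R w)\<bar> \<le> e * s" .
        moreover have "y - x = s *\<^sub>R w" "norm (y - x) = s" using s by (simp_all add: w_def s_def)
        ultimately show ?thesis by simp
      qed simp
      moreover have "t N > 0" by (simp add: t_def)
      ultimately show "\<exists>d>0. \<forall>y. norm (y - x) < d \<longrightarrow> norm (G y - G x - T (y - x)) \<le> e * norm (y - x)"
        by blast
    qed
    then show ?case by blast
  qed
qed

section \<open>Semiconvex functions\<close>

text \<open>In an inner product space this is convexity of \<open>f\<close> plus
  \<open>c / 2\<close> times the squared norm. The inequality form passes directly to suprema,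
  translates and affine perturbations with the same \<open>c\<close>.\<close>

definition semiconvex :: "real \<Rightarrow> ('a::real_inner \<Rightarrow> real) \<Rightarrow> bool" where
  "semiconvex c f \<longleftrightarrow> (\<forall>x y t. 0 \<le> t \<and> t \<le> 1 \<longrightarrow>
     f ((1 - t) *\<^sub>R x + t *\<^sub>R y) \<le> (1 - t) * f x + t * f y + c / 2 * (t * (1 - t) * (norm (x - y))\<^sup>2))"

lemma semiconvexD:
  "semiconvex c f \<Longrightarrow> 0 \<le> t \<Longrightarrow> t \<le> 1 \<Longrightarrow>
     f ((1 - t) *\<^sub>R x + t *\<^sub>R y) \<le> (1 - t) * f x + t * f y + c / 2 * (t * (1 - t) * (norm (x - y))\<^sup>2)"
  unfolding semiconvex_def by blast

lemma semiconvex_add_affine: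
  assumes "semiconvex c f"
  shows "semiconvex c (\<lambda>x. f x + p \<bullet> x + k)"
  unfolding semiconvex_def
proof (intro allI impI)
  fix x y :: 'a and t :: real assume t: "0 \<le> t \<and> t \<le> 1"
  have "p \<bullet> ((1 - t) *\<^sub>R x + t *\<^sub>R y) = (1 - t) * (p \<bullet> x) + t * (p \<bullet> y)"
    by (simp add: inner_add_right)
  moreover have "k = (1 - t) * k + t * k" by (simp add: algebra_simps)
  ultimately show "f ((1 - t) *\<^sub>R x + t *\<^sub>R y) + p \<bullet> ((1 - t) *\<^sub>R x + t *\<^sub>R y) + k
    \<le> (1 - t) * (f x + p \<bullet> x + k) + t * (f y + p \<bullet> y + k) + c / 2 * (t * (1 - t) * (norm (x - y))\<^sup>2)"
    using semiconvexD[OF assms conjunct1[OF t] conjunct2[OF t], of x y] by (simp only: distrib_left)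
qed

lemma norm_convex_comb_squared:
  fixes x y :: "'a::real_inner"
  shows "(norm ((1 - t) *\<^sub>R x + t *\<^sub>R y))\<^sup>2 = (1 - t) * (norm x)\<^sup>2 + t * (norm y)\<^sup>2 - t * (1 - t) * (norm (x - y))\<^sup>2"
  by (simp add: power2_norm_eq_inner inner_add_left inner_add_right inner_diff_left inner_diff_right inner_commute)
    (simp add: algebra_simps)

lemma semiconvex_iff_convex_on:
  "semiconvex c f \<longleftrightarrow> convex_on UNIV (\<lambda>x. f x + c / 2 * (norm x)\<^sup>2)" (is "_ \<longleftrightarrow> convex_on UNIV ?g")
proof
  assume f: "semiconvex c f"
  show "convex_on UNIV ?g"
  proof (rule convex_onI)
    fix t :: real and x y :: 'a assume "0 < t" "t < 1"
    then show "?g ((1 - t) *\<^sub>R x + t *\<^sub>R y) \<le> (1 - t) * ?g x + t * ?g y"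
      using semiconvexD[OF f, of t x y] unfolding norm_convex_comb_squared
      by (simp add: algebra_simps add_divide_distrib diff_divide_distrib)
  qed simp
next
  assume g: "convex_on UNIV ?g"
  show "semiconvex c f" unfolding semiconvex_def
  proof (intro allI impI)
    fix x y :: 'a and t :: real assume "0 \<le> t \<and> t \<le> 1"
    then show "f ((1 - t) *\<^sub>R x + t *\<^sub>R y) \<le> (1 - t) * f x + t * f y + c / 2 * (t * (1 - t) * (norm (x - y))\<^sup>2)"
      using convex_onD[OF g, of t x y] unfolding norm_convex_comb_squared
      by (simp add: algebra_simps add_divide_distrib diff_divide_distrib)
  qed
qed

text \<open>The infimum of all semiconcave majorants is again semiconcave; that it is also
  semiconvex is the core of Ilmanen's insertion lemma. The last conclusion is what matters later:
  one \<open>\<psi>\<close> lies below a whole family of majorants at once.\<close>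

lemma semiconvex_envelope:
  fixes a :: "'a::real_inner \<Rightarrow> real"
  assumes a: "semiconvex c a"
    and g0: "semiconvex c (\<lambda>x. - g0 x)" "\<And>x. a x \<le> g0 x"
  obtains \<psi> where "semiconvex c \<psi>" "semiconvex c (\<lambda>x. - \<psi> x)" "\<And>x. a x \<le> \<psi> x"
    "\<And>g x. semiconvex c (\<lambda>x. - g x) \<Longrightarrow> (\<And>x. a x \<le> g x) \<Longrightarrow> \<psi> x \<le> g x"
proof
  define S where "S = {g. semiconvex c (\<lambda>x. - g x) \<and> (\<forall>x. a x \<le> g x)}"
  define \<psi> where "\<psi> = (\<lambda>x. INF g\<in>S. g x)"
  have ne: "S \<noteq> {}" using g0 by (auto simp: S_def)
  have bdd: "bdd_below ((\<lambda>g. g x) ` S)" for x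
    by (rule bdd_belowI[of _ "a x"]) (auto simp: S_def)
  have lower: "\<psi> x \<le> g x" if "g \<in> S" for g x
    unfolding \<psi>_def using bdd that by (rule cINF_lower)
  have greatest: "k \<le> \<psi> x" if "\<And>g. g \<in> S \<Longrightarrow> k \<le> g x" for k x
    unfolding \<psi>_def using ne that by (rule cINF_greatest)
  show ge: "a x \<le> \<psi> x" for x by (rule greatest) (auto simp: S_def)
  show "\<psi> x \<le> g x" if "semiconvex c (\<lambda>x. - g x)" "\<And>x. a x \<le> g x" for g x
    using that by (intro lower) (auto simp: S_def)
  show conc: "semiconvex c (\<lambda>x. - \<psi> x)" unfolding semiconvex_def
  proof (intro allI impI)
    fix x y :: 'a and t :: real assume t: "0 \<le> t \<and> t \<le> 1"
    have "(1 - t) * \<psi> x + t * \<psi> y - c / 2 * (t * (1 - t) * (norm (x - y))\<^sup>2) \<le> \<psi> ((1 - t) *\<^sub>R x + t *\<^sub>R y)"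
    proof (rule greatest)
      fix g assume g: "g \<in> S"
      then have "semiconvex c (\<lambda>x. - g x)" by (simp add: S_def)
      from semiconvexD[OF this, of t x y] t
      have "(1 - t) * g x + t * g y - c / 2 * (t * (1 - t) * (norm (x - y))\<^sup>2) \<le> g ((1 - t) *\<^sub>R x + t *\<^sub>R y)"
        by simp
      moreover have "(1 - t) * \<psi> x \<le> (1 - t) * g x" "t * \<psi> y \<le> t * g y"
        using t lower[OF g] by (auto intro!: mult_left_mono)
      ultimately show "(1 - t) * \<psi> x + t * \<psi> y - c / 2 * (t * (1 - t) * (norm (x - y))\<^sup>2) \<le> g ((1 - t) *\<^sub>R x + t *\<^sub>R y)"
        by linarith
    qed
    then show "- \<psi> ((1 - t) *\<^sub>R x + t *\<^sub>R y) \<le> (1 - t) * - \<psi> x + t * - \<psi> y + c / 2 * (t * (1 - t) * (norm (x - y))\<^sup>2)"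
      by simp
  qed
  show "semiconvex c \<psi>" unfolding semiconvex_def
  proof (intro allI impI)
    fix x y :: 'a and t :: real assume t: "0 \<le> t \<and> t \<le> 1"
    define z where "z = (1 - t) *\<^sub>R x + t *\<^sub>R y"
    define k where "k = c / 2 * (t * (1 - t) * (norm (x - y))\<^sup>2)"
    txt \<open>Semiconvexity of \<open>\<psi>\<close> is minimality of \<open>\<psi>\<close>, evaluated at \<open>z\<close>, against this semiconcave majorant of \<open>a\<close>.\<close>
    define g where "g = (\<lambda>w. (1 - t) * \<psi> (w + (x - z)) + t * \<psi> (w + (y - z)) + k)"
    have "g \<in> S" unfolding S_def
    proof (intro CollectI conjI allI)
      show "semiconvex c (\<lambda>w. - g w)" unfolding semiconvex_def
      proof (intro allI impI)
        fix v w :: 'a and s :: real assume s: "0 \<le> s \<and> s \<le> 1"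
        have shift: "- \<psi> ((1 - s) *\<^sub>R v + s *\<^sub>R w + u)
            \<le> (1 - s) * - \<psi> (v + u) + s * - \<psi> (w + u) + c / 2 * (s * (1 - s) * (norm (v - w))\<^sup>2)" for u
        proof -
          have "(1 - s) *\<^sub>R (v + u) + s *\<^sub>R (w + u) = (1 - s) *\<^sub>R v + s *\<^sub>R w + u"
            by (simp add: algebra_simps)
          then show ?thesis using semiconvexD[OF conc, of s "v + u" "w + u"] s by simp
        qed
        define K where "K = c / 2 * (s * (1 - s) * (norm (v - w))\<^sup>2)"
        have "(1 - t) * - \<psi> ((1 - s) *\<^sub>R v + s *\<^sub>R w + (x - z))
          \<le> (1 - t) * ((1 - s) * - \<psi> (v + (x - z)) + s * - \<psi> (w + (x - z)) + K)"
          using shift t unfolding K_def by (intro mult_left_mono) auto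
        moreover have "t * - \<psi> ((1 - s) *\<^sub>R v + s *\<^sub>R w + (y - z))
          \<le> t * ((1 - s) * - \<psi> (v + (y - z)) + s * - \<psi> (w + (y - z)) + K)"
          using shift t unfolding K_def by (intro mult_left_mono) auto
        ultimately show "- g ((1 - s) *\<^sub>R v + s *\<^sub>R w) \<le> (1 - s) * - g v + s * - g w
            + c / 2 * (s * (1 - s) * (norm (v - w))\<^sup>2)"
          unfolding g_def K_def[symmetric] by (simp add: algebra_simps)
      qed
      fix w
      have "w = (1 - t) *\<^sub>R (w + (x - z)) + t *\<^sub>R (w + (y - z))"
        by (simp add: z_def algebra_simps)
      then have "a w \<le> (1 - t) * a (w + (x - z)) + t * a (w + (y - z)) + k"
        using semiconvexD[OF a, of t "w + (x - z)" "w + (y - z)"] t by (simp add: k_def)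
      moreover have "(1 - t) * a (w + (x - z)) \<le> (1 - t) * \<psi> (w + (x - z))" "t * a (w + (y - z)) \<le> t * \<psi> (w + (y - z))"
        using t ge by (auto intro!: mult_left_mono)
      ultimately show "a w \<le> g w" unfolding g_def by linarith
    qed
    from lower[OF this, of z] have "\<psi> z \<le> (1 - t) * \<psi> x + t * \<psi> y + k" by (simp add: g_def)
    then show "\<psi> ((1 - t) *\<^sub>R x + t *\<^sub>R y) \<le> (1 - t) * \<psi> x + t * \<psi> y + c / 2 * (t * (1 - t) * (norm (x - y))\<^sup>2)"
      by (simp add: z_def k_def)
  qed
qed

section \<open>Subgradients, and gradients of functions that are both semiconvex and
  semiconcave\<close>

lemma convex_on_subgradient:
  fixes f :: "'a::euclidean_space \<Rightarrow> real"
  assumes f: "convex_on UNIV f"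
  obtains p where "\<And>y. f x + p \<bullet> (y - x) \<le> f y"
proof -
  define E where "E = {z :: 'a \<times> real. f (fst z) < snd z}"
  have "convex E"
  proof (rule convexI)
    fix z w :: "'a \<times> real" and u v :: real
    assume zw: "z \<in> E" "w \<in> E" and uv: "0 \<le> u" "0 \<le> v" "u + v = 1"
    have "f (u *\<^sub>R fst z + v *\<^sub>R fst w) \<le> u * f (fst z) + v * f (fst w)"
      using f uv unfolding convex_on_def by simp
    also have "\<dots> < u * snd z + v * snd w"
    proof (cases "u = 0")
      case True then show ?thesis using zw uv by (simp add: E_def)
    next
      case False
      then have "u * f (fst z) < u * snd z" using zw uv by (simp add: E_def)
      moreover have "v * f (fst w) \<le> v * snd w" using zw uv by (intro mult_left_mono) (auto simp: E_def)
      ultimately show ?thesis by linarith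
    qed
    finally show "u *\<^sub>R z + v *\<^sub>R w \<in> E" by (simp add: E_def)
  qed
  moreover have "(x, f x + 1) \<in> E" "{(x, f x)} \<inter> E = {}" by (auto simp: E_def)
  ultimately obtain q b where q: "q \<noteq> 0" "\<And>z. z \<in> {(x, f x)} \<Longrightarrow> q \<bullet> z \<le> b" "\<And>z. z \<in> E \<Longrightarrow> b \<le> q \<bullet> z"
    using separating_hyperplane_sets[of "{(x, f x)}" E] by (metis convex_singleton empty_iff insert_not_empty)
  define r where "r = snd q"
  have sep: "fst q \<bullet> x + r * f x \<le> fst q \<bullet> y + r * s" if "f y < s" for y s
  proof -
    have "q \<bullet> (x, f x) \<le> q \<bullet> (y, s)" using q(2,3)[of "(x, f x)"] q(3)[of "(y, s)"] that by (simp add: E_def)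
    then show ?thesis by (simp add: r_def inner_prod_def)
  qed
  have "r \<ge> 0" using sep[of x "f x + 1"] by (simp add: algebra_simps)
  \<comment> \<open>A separating hyperplane cannot be vertical: \<open>f\<close> is finite
    everywhere, so the linear form of \<open>fst q\<close> would be bounded below on the whole
    space.\<close>
  moreover have "r \<noteq> 0"
  proof
    assume "r = 0"
    then have "fst q \<bullet> x \<le> fst q \<bullet> y" for y using sep[of y "f y + 1"] by simp
    from this[of "x - fst q"] have "fst q \<bullet> fst q \<le> 0" by (simp add: inner_diff_right)
    then have "fst q = 0" by (metis antisym inner_eq_zero_iff inner_ge_zero)
    then show False using q(1) \<open>r = 0\<close> by (simp add: r_def prod_eq_iff)
  qed
  ultimately have r: "r > 0" by simp
  have "f x + (- (1 / r) *\<^sub>R fst q) \<bullet> (y - x) \<le> f y" for y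
  proof (rule field_le_epsilon)
    fix e :: real assume "0 < e"
    then have "fst q \<bullet> x + r * f x \<le> fst q \<bullet> y + r * (f y + e)" by (intro sep) simp
    then show "f x + (- (1 / r) *\<^sub>R fst q) \<bullet> (y - x) \<le> f y + e"
      using r by (simp add: inner_diff_right field_simps)
  qed
  then show ?thesis by (rule that)
qed

lemma semiconvex_subgradient:
  fixes f :: "'a::euclidean_space \<Rightarrow> real"
  assumes "semiconvex c f"
  obtains p where "\<And>y. f x + p \<bullet> (y - x) - c / 2 * (norm (y - x))\<^sup>2 \<le> f y"
proof -
  obtain q where q: "\<And>y. f x + c / 2 * (norm x)\<^sup>2 + q \<bullet> (y - x) \<le> f y + c / 2 * (norm y)\<^sup>2"
    using convex_on_subgradient assms[unfolded semiconvex_iff_convex_on] by blast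
  have "f x + (q - c *\<^sub>R x) \<bullet> (y - x) - c / 2 * (norm (y - x))\<^sup>2 \<le> f y" for y
    using q[of y]
    by (simp add: power2_norm_eq_inner inner_diff_left inner_diff_right inner_commute algebra_simps)
  then show ?thesis by (rule that)
qed

lemma inner_le_quadratic_imp_zero:
  fixes w :: "'a::real_inner"
  assumes "r > 0" and le: "\<And>h. norm h < r \<Longrightarrow> w \<bullet> h \<le> c * (norm h)\<^sup>2"
  shows "w = 0"
proof (rule ccontr)
  assume w: "w \<noteq> 0"
  define t where "t = min (r / (2 * norm w)) (1 / (2 * (\<bar>c\<bar> + 1)))"
  have t: "t > 0" using w \<open>r > 0\<close> by (simp add: t_def)
  have "t * norm w \<le> r / (2 * norm w) * norm w" by (intro mult_right_mono) (auto simp: t_def)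
  then have "norm (t *\<^sub>R w) < r" using w t \<open>r > 0\<close> by simp
  from le[OF this] have "t * (norm w)\<^sup>2 \<le> t * (c * t * (norm w)\<^sup>2)"
    by (simp add: power_mult_distrib power2_eq_square dot_square_norm algebra_simps)
  then have "(norm w)\<^sup>2 \<le> c * t * (norm w)\<^sup>2" using t by simp
  then have "1 \<le> c * t" using w by simp
  also have "c * t \<le> (\<bar>c\<bar> + 1) * (1 / (2 * (\<bar>c\<bar> + 1)))" using t by (intro mult_mono) (auto simp: t_def)
  also have "\<dots> = 1 / 2" by simp
  finally show False by simp
qed

lemma semiconvex_semiconcave_gradient:
  fixes f :: "'a::euclidean_space \<Rightarrow> real"
  assumes "0 \<le> c" "semiconvex c f" "semiconvex c (\<lambda>x. - f x)"
  obtains D :: "'a \<Rightarrow> 'a" where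
    "\<And>x y. \<bar>f y - f x - D x \<bullet> (y - x)\<bar> \<le> c / 2 * (norm (y - x))\<^sup>2"
    "(3 * c)-lipschitz_on UNIV D"
proof -
  have "\<exists>p. \<forall>y. \<bar>f y - f x - p \<bullet> (y - x)\<bar> \<le> c / 2 * (norm (y - x))\<^sup>2" for x
  proof -
    obtain p where p: "\<And>y. f x + p \<bullet> (y - x) - c / 2 * (norm (y - x))\<^sup>2 \<le> f y"
      using semiconvex_subgradient[OF assms(2)] by blast
    obtain p' where p': "\<And>y. - f x + p' \<bullet> (y - x) - c / 2 * (norm (y - x))\<^sup>2 \<le> - f y"
      using semiconvex_subgradient[OF assms(3)] by blast
    \<comment> \<open>Adding the bounds for \<open>f\<close> and \<open>- f\<close> eliminates
      \<open>f\<close>. The linear form of \<open>p + p'\<close> is dominated by a quadratic, hence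
      zero, and the lower and upper gradients coincide.\<close>
    have "(p + p') \<bullet> h \<le> c * (norm h)\<^sup>2" for h
      using p[of "x + h"] p'[of "x + h"] by (simp add: inner_add_left)
    then have "p + p' = 0" by (intro inner_le_quadratic_imp_zero[of 1]) auto
    then have "p' = - p" by (simp add: add_eq_0_iff)
    then have "\<bar>f y - f x - p \<bullet> (y - x)\<bar> \<le> c / 2 * (norm (y - x))\<^sup>2" for y
      using p[of y] p'[of y] unfolding \<open>p' = - p\<close> inner_minus_left by linarith
    then show ?thesis by blast
  qed
  then obtain D where D: "\<bar>f y - f x - D x \<bullet> (y - x)\<bar> \<le> c / 2 * (norm (y - x))\<^sup>2" for x y by metis
  have "norm (D x - D y) \<le> 3 * c * norm (x - y)" for x y
  proof (cases "D x = D y")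
    case False
    \<comment> \<open>Testing at distance \<open>d\<close> from \<open>y\<close> in the direction of
      \<open>D x - D y\<close> makes three expansions combine to
      \<open>d * norm (D x - D y)\<close>. The squared distances are at most \<open>d^2\<close>,
      \<open>4 d^2\<close> and \<open>d^2\<close>, whence the factor 3.\<close>
    define d where "d = norm (x - y)"
    define w where "w = (D x - D y) /\<^sub>R norm (D x - D y)"
    define z where "z = y + d *\<^sub>R w"
    have w: "norm w = 1" "(D x - D y) \<bullet> w = norm (D x - D y)"
      using False by (auto simp: w_def dot_square_norm power2_eq_square)
    have zy: "norm (z - y) = d" by (simp add: z_def w d_def)
    have zx: "norm (z - x) \<le> 2 * d"
      using norm_triangle_ineq[of "z - y" "y - x"] zy by (simp add: d_def norm_minus_commute)
    have "D x \<bullet> (z - x) - D y \<bullet> (z - y) - D x \<bullet> (y - x)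
      \<le> c / 2 * (norm (z - y))\<^sup>2 + c / 2 * (norm (z - x))\<^sup>2 + c / 2 * (norm (y - x))\<^sup>2"
      using D[of z y] D[of z x] D[of y x] by linarith
    also have "D x \<bullet> (z - x) - D y \<bullet> (z - y) - D x \<bullet> (y - x) = d * norm (D x - D y)"
      by (simp add: z_def inner_diff_left inner_diff_right inner_add_right w(2)[symmetric] algebra_simps)
    also have "c / 2 * (norm (z - y))\<^sup>2 + c / 2 * (norm (z - x))\<^sup>2 + c / 2 * (norm (y - x))\<^sup>2
      \<le> c / 2 * d\<^sup>2 + c / 2 * (2 * d)\<^sup>2 + c / 2 * d\<^sup>2"
      using zx zy \<open>0 \<le> c\<close> by (intro add_mono mult_left_mono power_mono) (auto simp: d_def norm_minus_commute)
    also have "\<dots> = d * (3 * c * d)" by (simp add: power2_eq_square)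
    finally have *: "d * norm (D x - D y) \<le> d * (3 * c * d)" .
    show ?thesis
    proof (cases "d = 0")
      case True then show ?thesis by (simp add: d_def)
    next
      case False
      then have "d > 0" by (simp add: d_def)
      then show ?thesis using * by (simp add: d_def)
    qed
  qed (use \<open>0 \<le> c\<close> in simp)
  then have "(3 * c)-lipschitz_on UNIV D"
    using \<open>0 \<le> c\<close> by (intro lipschitz_onI) (auto simp: dist_norm)
  then show ?thesis using D that by blast
qed

text \<open>Rademacher's theorem applies to the components of the Lipschitz map \<open>D\<close>.
  Symmetry of the derivative of \<open>D\<close> is not known, but only its quadratic form enters
  the expansion, so its symmetric part serves.\<close>

lemma AE_second_order_expansion:
  fixes f :: "'a::euclidean_space \<Rightarrow> real" and D :: "'a \<Rightarrow> 'a"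
  assumes D: "\<And>x y. \<bar>f y - f x - D x \<bullet> (y - x)\<bar> \<le> c / 2 * (norm (y - x))\<^sup>2"
    and lip: "K-lipschitz_on UNIV D"
  shows "AE x in lborel. \<exists>W. linear W \<and> (\<forall>v w. W v \<bullet> w = v \<bullet> W w) \<and>
    (\<forall>e>0. \<exists>r>0. \<forall>h. norm h < r \<longrightarrow>
      \<bar>f (x + h) - f x - D x \<bullet> h - (W h \<bullet> h) / 2\<bar> \<le> e * (norm h)\<^sup>2)"
proof -
  have "K-lipschitz_on UNIV (\<lambda>x. D x \<bullet> b)" if "b \<in> Basis" for b
  proof (rule lipschitz_onI)
    fix x y
    have "dist (D x \<bullet> b) (D y \<bullet> b) = \<bar>(D x - D y) \<bullet> b\<bar>" by (simp add: dist_real_def inner_diff_left)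
    also have "\<dots> \<le> norm (D x - D y)" using that by (rule Basis_le_norm)
    also have "\<dots> \<le> K * dist x y" using lipschitz_onD[OF lip, of x y] by (simp add: dist_norm)
    finally show "dist (D x \<bullet> b) (D y \<bullet> b) \<le> K * dist x y" .
  qed (rule lipschitz_on_nonneg[OF lip])
  then have "AE x in lborel. \<exists>A. ((\<lambda>x. D x \<bullet> b) has_derivative A) (at x)" if "b \<in> Basis" for b
    using that rademacher by blast
  then have "AE x in lborel. \<forall>b\<in>Basis. \<exists>A. ((\<lambda>x. D x \<bullet> b) has_derivative A) (at x)"
    by (simp add: AE_ball_countable countable_finite)
  then show ?thesis
  proof eventually_elim
    case (elim x)
    then obtain T where T: "\<And>b. b \<in> Basis \<Longrightarrow> ((\<lambda>x. D x \<bullet> b) has_derivative T b) (at x)" by metis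
    define A where "A = (\<lambda>h. \<Sum>b\<in>Basis. T b h *\<^sub>R b)"
    have A: "(D has_derivative A) (at x)"
    proof (subst has_derivative_componentwise_within, intro ballI)
      fix b :: 'a assume b: "b \<in> Basis"
      then have "A h \<bullet> b = T b h" for h
        by (simp add: A_def inner_sum_left inner_Basis if_distrib cong: if_cong)
      then show "((\<lambda>x. D x \<bullet> b) has_derivative (\<lambda>x. A x \<bullet> b)) (at x)" using T[OF b] by simp
    qed
    then have blA: "bounded_linear A" by (rule has_derivative_bounded_linear)
    then have linA: "linear A" by (rule bounded_linear.linear)
    define W where "W = (\<lambda>h. (1 / 2) *\<^sub>R (A h + adjoint A h))"
    have "linear W" unfolding W_def
      by (intro linear_compose_scale_right linear_compose_add linA adjoint_linear)
    moreover have "W v \<bullet> w = v \<bullet> W w" for v w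
      using adjoint_works[OF linA] adjoint_works[OF linA, of w v]
      by (simp add: W_def inner_add_left inner_add_right inner_commute)
    moreover have WA: "W h \<bullet> h = A h \<bullet> h" for h
      using adjoint_works[OF linA, of h h] inner_commute[of "adjoint A h" h]
        inner_commute[of "A h" h] by (simp add: W_def inner_add_left)
    moreover have "\<exists>r>0. \<forall>h. norm h < r \<longrightarrow>
      \<bar>f (x + h) - f x - D x \<bullet> h - (W h \<bullet> h) / 2\<bar> \<le> e * (norm h)\<^sup>2" if "e > 0" for e
    proof -
      from A that obtain r where r: "r > 0"
        and rr: "\<forall>y. norm (y - x) < r \<longrightarrow> norm (D y - D x - A (y - x)) \<le> e * norm (y - x)"
        unfolding has_derivative_at_alt by blast
      have "\<bar>f (x + h) - f x - D x \<bullet> h - (W h \<bullet> h) / 2\<bar> \<le> e * (norm h)\<^sup>2" if h: "norm h < r" for h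
      proof -
        \<comment> \<open>Along the segment, \<open>g\<close> is \<open>f\<close> minus its expected
          expansion at first and second order. Differentiability of \<open>D\<close> makes
          \<open>g'\<close> small, and the mean value theorem replaces an integration.\<close>
        define g where "g = (\<lambda>t::real. f (x + t *\<^sub>R h) - t * (D x \<bullet> h) - t\<^sup>2 / 2 * (A h \<bullet> h))"
        define g' where "g' = (\<lambda>t::real. D (x + t *\<^sub>R h) \<bullet> h - D x \<bullet> h - t * (A h \<bullet> h))"
        have fd: "(f has_derivative (\<lambda>k. D y \<bullet> k)) (at y)" for y
        proof (rule has_derivativeI_sandwich[of 1])
          show "bounded_linear ((\<bullet>) (D y))" by (rule bounded_linear_inner_right)
          show "norm (f z - f y - D y \<bullet> (z - y)) / norm (z - y) \<le> c / 2 * norm (z - y)" if "z \<noteq> y" for z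
            using D[of z y] that by (simp add: field_simps power2_eq_square)
          have "((\<lambda>z. c / 2 * norm (z - y)) \<longlongrightarrow> c / 2 * norm (y - y)) (at y)"
            by (intro tendsto_intros)
          then show "((\<lambda>z. c / 2 * norm (z - y)) \<longlongrightarrow> 0) (at y)" by simp
        qed auto
        have gd: "(g has_real_derivative g' t) (at t)" for t
        proof -
          have "((\<lambda>t. f (x + t *\<^sub>R h)) has_derivative (\<lambda>s. D (x + t *\<^sub>R h) \<bullet> (s *\<^sub>R h))) (at t)"
            by (rule has_derivative_compose[OF _ fd]) (auto intro!: derivative_eq_intros)
          then have "((\<lambda>t. f (x + t *\<^sub>R h)) has_real_derivative D (x + t *\<^sub>R h) \<bullet> h) (at t)"
            by (simp add: has_field_derivative_def mult_commute_abs)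
          then show ?thesis unfolding g_def g'_def
            by (auto intro!: derivative_eq_intros)
        qed
        have "\<exists>z. 0 < z \<and> z < 1 \<and> g 1 - g 0 = (1 - 0) * g' z"
          using gd by (intro MVT2) auto
        then obtain z where z: "0 < z" "z < 1" "g 1 - g 0 = g' z" by auto
        have "norm (z *\<^sub>R h) \<le> 1 * norm h" using z mult_right_mono[of z 1 "norm h"] by simp
        then have "norm (D (x + z *\<^sub>R h) - D x - A (z *\<^sub>R h)) \<le> e * norm (z *\<^sub>R h)"
          using rr[rule_format, of "x + z *\<^sub>R h"] h by simp
        also have "\<dots> \<le> e * norm h"
          using \<open>norm (z *\<^sub>R h) \<le> 1 * norm h\<close> \<open>e > 0\<close> by (intro mult_left_mono) auto
        finally have "norm (D (x + z *\<^sub>R h) - D x - A (z *\<^sub>R h)) * norm h \<le> e * norm h * norm h"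
          by (rule mult_right_mono) simp
        moreover have "\<bar>g' z\<bar> \<le> norm (D (x + z *\<^sub>R h) - D x - A (z *\<^sub>R h)) * norm h"
        proof -
          have "g' z = (D (x + z *\<^sub>R h) - D x - A (z *\<^sub>R h)) \<bullet> h"
            by (simp add: g'_def inner_diff_left linear_cmul[OF linA])
          then show ?thesis using Cauchy_Schwarz_ineq2 by metis
        qed
        ultimately have "\<bar>g 1 - g 0\<bar> \<le> e * norm h * norm h" using z(3) by simp
        then show ?thesis by (simp add: g_def WA power2_eq_square algebra_simps)
      qed
      then show ?thesis using r by blast
    qed
    ultimately show ?case by blast
  qed
qed

lemma quadratic_le_of_local:
  fixes Q :: "'a::real_normed_vector \<Rightarrow> real"
  assumes hom: "\<And>t h. Q (t *\<^sub>R h) = t\<^sup>2 * Q h"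
    and loc: "\<And>e. e > 0 \<Longrightarrow> \<exists>r>0. \<forall>h. norm h < r \<longrightarrow> Q h \<le> (c + e) * (norm h)\<^sup>2"
  shows "Q h \<le> c * (norm h)\<^sup>2"
proof (cases "h = 0")
  case True then show ?thesis using hom[of 0 h] by simp
next
  case False
  have "Q h / (norm h)\<^sup>2 \<le> c"
  proof (rule field_le_epsilon)
    fix e :: real assume "0 < e"
    then obtain r where r: "r > 0" "\<forall>h. norm h < r \<longrightarrow> Q h \<le> (c + e) * (norm h)\<^sup>2" using loc by blast
    define t where "t = r / (2 * norm h)"
    have t: "t > 0" using r False by (simp add: t_def)
    have "norm (t *\<^sub>R h) < r" using r False by (simp add: t_def)
    from r(2)[rule_format, OF this] have "t\<^sup>2 * Q h \<le> t\<^sup>2 * ((c + e) * (norm h)\<^sup>2)"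
      by (simp add: hom power_mult_distrib mult_ac)
    then have "Q h \<le> (c + e) * (norm h)\<^sup>2" using t by simp
    then show "Q h / (norm h)\<^sup>2 \<le> c + e" using False by (simp add: field_simps)
  qed
  then show ?thesis using False by (simp add: field_simps)
qed

text \<open>A maximum point of \<open>a - b\<close> itself may be exceptional for the expansion; the
  tilts \<open>p\<close> supply enough contact points. At a contact point
  \<open>a \<le> \<psi> \<le> b + p \<bullet> y + m p\<close> holds with equality, so the expansion
  of \<open>\<psi>\<close> alone bounds \<open>a\<close> from above and \<open>b\<close> from below
  with the same \<open>W\<close>.\<close>

theorem semiconvex_contact_expansion:
  fixes a b :: "'a::euclidean_space \<Rightarrow> real"
  assumes c: "0 \<le> c" and a: "semiconvex c a" and b: "semiconvex c (\<lambda>y. - b y)" and "\<delta> > 0"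
    and ex: "\<forall>p. norm p < \<delta> \<longrightarrow> (\<exists>y. \<forall>z. a z - b z - p \<bullet> z \<le> a y - b y - p \<bullet> y)"
  shows "\<exists>p y g W. norm p < \<delta> \<and> (\<forall>z. a z - b z - p \<bullet> z \<le> a y - b y - p \<bullet> y) \<and>
    linear W \<and> (\<forall>v w. W v \<bullet> w = v \<bullet> W w) \<and> (\<forall>h. \<bar>W h \<bullet> h\<bar> \<le> c * (norm h)\<^sup>2) \<and>
    (\<forall>e>0. \<exists>r>0. \<forall>h. norm h < r \<longrightarrow>
      a (y + h) \<le> a y + g \<bullet> h + (W h \<bullet> h) / 2 + e * (norm h)\<^sup>2 \<and>
      b (y + h) \<ge> b y + (g - p) \<bullet> h + (W h \<bullet> h) / 2 - e * (norm h)\<^sup>2)"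
proof -
  from ex obtain Y where Y: "\<And>p z. norm p < \<delta> \<Longrightarrow> a z - b z - p \<bullet> z \<le> a (Y p) - b (Y p) - p \<bullet> Y p"
    by metis
  define m where "m = (\<lambda>p. a (Y p) - b (Y p) - p \<bullet> Y p)"
  have conc: "semiconvex c (\<lambda>y. - (b y + p \<bullet> y + m p))" for p
    using semiconvex_add_affine[OF b, of "- p" "- m p"] by (simp add: algebra_simps)
  have maj: "a y \<le> b y + p \<bullet> y + m p" if "norm p < \<delta>" for p y
    using Y[OF that, of y] by (simp add: m_def)
  obtain \<psi> where \<psi>: "semiconvex c \<psi>" "semiconvex c (\<lambda>x. - \<psi> x)" "\<And>x. a x \<le> \<psi> x"
    and \<psi>min: "\<And>g x. semiconvex c (\<lambda>x. - g x) \<Longrightarrow> (\<And>x. a x \<le> g x) \<Longrightarrow> \<psi> x \<le> g x"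
    using semiconvex_envelope[OF a conc[of 0]] maj[of 0] \<open>\<delta> > 0\<close> by auto
  have \<psi>le: "\<psi> y \<le> b y + p \<bullet> y + m p" if "norm p < \<delta>" for p y
    by (rule \<psi>min[OF conc maj[OF that]])
  \<comment> \<open>The gradient of \<open>\<psi>\<close> alone does not determine \<open>p\<close>.
    A second function, \<open>- \<omega>\<close>, is therefore inserted between all
    \<open>\<psi> - p \<bullet> y - m p\<close> and \<open>b\<close>. It too has a Lipschitz
    gradient and touches at the contact points, and \<open>p\<close> is the difference of the two
    gradients.\<close>
  have conc': "semiconvex c (\<lambda>y. - (- \<psi> y + p \<bullet> y + m p))" for p
    using semiconvex_add_affine[OF \<psi>(1), of "- p" "- m p"] by (simp add: algebra_simps)
  have maj': "- b y \<le> - \<psi> y + p \<bullet> y + m p" if "norm p < \<delta>" for p y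
    using \<psi>le[OF that, of y] by simp
  obtain \<omega> where \<omega>: "semiconvex c \<omega>" "semiconvex c (\<lambda>x. - \<omega> x)" "\<And>x. - b x \<le> \<omega> x"
    and \<omega>min: "\<And>g x. semiconvex c (\<lambda>x. - g x) \<Longrightarrow> (\<And>x. - b x \<le> g x) \<Longrightarrow> \<omega> x \<le> g x"
    using semiconvex_envelope[OF b conc'[of 0]] maj'[of 0] \<open>\<delta> > 0\<close> by auto
  have \<omega>le: "\<omega> y \<le> - \<psi> y + p \<bullet> y + m p" if "norm p < \<delta>" for p y
    by (rule \<omega>min[OF conc' maj'[OF that]])
  obtain D where D: "\<And>x y. \<bar>\<psi> y - \<psi> x - D x \<bullet> (y - x)\<bar> \<le> c / 2 * (norm (y - x))\<^sup>2"
    and Dlip: "(3 * c)-lipschitz_on UNIV D"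
    using semiconvex_semiconcave_gradient[OF c \<psi>(1,2)] by blast
  obtain E where E: "\<And>x y. \<bar>\<omega> y - \<omega> x - E x \<bullet> (y - x)\<bar> \<le> c / 2 * (norm (y - x))\<^sup>2"
    and Elip: "(3 * c)-lipschitz_on UNIV E"
    using semiconvex_semiconcave_gradient[OF c \<omega>(1,2)] by blast
  have touch: "\<psi> (Y p) = a (Y p)" "\<omega> (Y p) = - b (Y p)" if "norm p < \<delta>" for p
    using \<psi>le[OF that, of "Y p"] \<psi>(3)[of "Y p"] \<omega>le[OF that, of "Y p"] \<omega>(3)[of "Y p"]
    by (auto simp: m_def)
  \<comment> \<open>At \<open>Y p\<close> the function
    \<open>\<psi> + \<omega> - p \<bullet> y\<close> attains its maximum \<open>m p\<close>, so its
    gradient vanishes.\<close>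
  have DE: "D (Y p) + E (Y p) = p" if p: "norm p < \<delta>" for p
  proof -
    have "(D (Y p) + E (Y p) - p) \<bullet> h \<le> c * (norm h)\<^sup>2" for h
    proof -
      have "\<psi> (Y p) + D (Y p) \<bullet> h - c / 2 * (norm h)\<^sup>2 \<le> \<psi> (Y p + h)"
        "\<omega> (Y p) + E (Y p) \<bullet> h - c / 2 * (norm h)\<^sup>2 \<le> \<omega> (Y p + h)"
        using D[of "Y p + h" "Y p"] E[of "Y p + h" "Y p"] unfolding add_diff_cancel_left' by linarith+
      then show ?thesis using \<omega>le[OF p, of "Y p + h"] touch[OF p]
        by (simp add: m_def inner_add_left inner_diff_left inner_add_right)
    qed
    then have "D (Y p) + E (Y p) - p = 0" by (intro inner_le_quadratic_imp_zero[of 1]) auto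
    then show ?thesis by simp
  qed
  define good where "good = (\<lambda>x. \<exists>W. linear W \<and> (\<forall>v w. W v \<bullet> w = v \<bullet> W w) \<and>
    (\<forall>e>0. \<exists>r>0. \<forall>h. norm h < r \<longrightarrow>
      \<bar>\<psi> (x + h) - \<psi> x - D x \<bullet> h - (W h \<bullet> h) / 2\<bar> \<le> e * (norm h)\<^sup>2))"
  have "AE x in lborel. good x"
    unfolding good_def by (rule AE_second_order_expansion[OF D Dlip])
  then obtain N where N: "N \<in> null_sets lborel" "{x. \<not> good x} \<subseteq> N"
    by (auto elim!: AE_E simp: null_sets_def)
  have "negligible N" using N by (simp add: negligible_iff_null_sets null_sets_completionI)
  have "\<exists>p. norm p < \<delta> \<and> good (Y p)"
  proof (rule ccontr)
    assume "\<not> ?thesis"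
    then have "Y ` ball 0 \<delta> \<subseteq> N" using N by auto
    then have neg: "negligible (Y ` ball 0 \<delta>)" using \<open>negligible N\<close> negligible_subset by blast
    \<comment> \<open>Lipschitz maps preserve null sets. This one sends \<open>Y p\<close> to
      \<open>p\<close>, so a null set of contact points would have a whole ball of tilts as its
      image.\<close>
    have "negligible ((\<lambda>y. D y + E y) ` (Y ` ball 0 \<delta>))"
    proof (rule negligible_locally_Lipschitz_image[OF _ neg])
      fix x
      have "norm (D y + E y - (D x + E x)) \<le> (6 * c) * norm (y - x)" for y
        using lipschitz_onD[OF Dlip, of y x] lipschitz_onD[OF Elip, of y x]
          norm_triangle_ineq[of "D y - D x" "E y - E x"]
        by (simp add: dist_norm algebra_simps)
      then show "\<exists>T B. open T \<and> x \<in> T \<and> (\<forall>y\<in>Y ` ball 0 \<delta> \<inter> T. norm (D y + E y - (D x + E x)) \<le> B * norm (y - x))"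
        by (intro exI[of _ UNIV]) auto
    qed simp
    moreover have "(\<lambda>y. D y + E y) ` (Y ` ball 0 \<delta>) = ball 0 \<delta>"
      using DE by (force simp: image_image)
    ultimately have "negligible (ball (0::'a) \<delta>)" by simp
    then show False using \<open>\<delta> > 0\<close> by (simp add: open_not_negligible)
  qed
  then obtain p where p: "norm p < \<delta>" "good (Y p)" by blast
  then obtain W where W: "linear W" "\<And>v w. W v \<bullet> w = v \<bullet> W w"
    and exp: "\<And>e. e > 0 \<Longrightarrow> \<exists>r>0. \<forall>h. norm h < r \<longrightarrow>
      \<bar>\<psi> (Y p + h) - \<psi> (Y p) - D (Y p) \<bullet> h - (W h \<bullet> h) / 2\<bar> \<le> e * (norm h)\<^sup>2"
    unfolding good_def by blast
  have hom: "W (t *\<^sub>R h) \<bullet> (t *\<^sub>R h) = t\<^sup>2 * (W h \<bullet> h)" for t h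
    by (simp add: linear_cmul[OF W(1)] power2_eq_square)
  have loc: "\<exists>r>0. \<forall>h. norm h < r \<longrightarrow> \<bar>W h \<bullet> h\<bar> \<le> (c + e) * (norm h)\<^sup>2" if "e > 0" for e
  proof -
    obtain r where r: "r > 0" "\<forall>h. norm h < r \<longrightarrow>
      \<bar>\<psi> (Y p + h) - \<psi> (Y p) - D (Y p) \<bullet> h - (W h \<bullet> h) / 2\<bar> \<le> e / 2 * (norm h)\<^sup>2"
      using exp[of "e/2"] \<open>e > 0\<close> by auto
    have "\<bar>W h \<bullet> h\<bar> \<le> (c + e) * (norm h)\<^sup>2" if "norm h < r" for h
      using r(2)[rule_format, OF that] D[of "Y p + h" "Y p"]
      unfolding add_diff_cancel_left' distrib_right by linarith
    then show ?thesis using r(1) by blast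
  qed
  have "W h \<bullet> h \<le> c * (norm h)\<^sup>2" for h
  proof (rule quadratic_le_of_local[of "\<lambda>h. W h \<bullet> h", OF hom])
    show "\<exists>r>0. \<forall>h. norm h < r \<longrightarrow> W h \<bullet> h \<le> (c + e) * (norm h)\<^sup>2" if "e > 0" for e
      using loc[OF that] by (meson abs_le_D1)
  qed
  moreover have "- (W h \<bullet> h) \<le> c * (norm h)\<^sup>2" for h
  proof (rule quadratic_le_of_local[of "\<lambda>h. - (W h \<bullet> h)"])
    show "- (W (t *\<^sub>R h) \<bullet> (t *\<^sub>R h)) = t\<^sup>2 * - (W h \<bullet> h)" for t h
      using hom by simp
    show "\<exists>r>0. \<forall>h. norm h < r \<longrightarrow> - (W h \<bullet> h) \<le> (c + e) * (norm h)\<^sup>2" if "e > 0" for e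
      using loc[OF that] by (meson abs_le_D2)
  qed
  ultimately have Wc: "\<bar>W h \<bullet> h\<bar> \<le> c * (norm h)\<^sup>2" for h by (simp add: abs_le_iff)
  have fin: "\<exists>r>0. \<forall>h. norm h < r \<longrightarrow>
      a (Y p + h) \<le> a (Y p) + D (Y p) \<bullet> h + (W h \<bullet> h) / 2 + e * (norm h)\<^sup>2 \<and>
      b (Y p + h) \<ge> b (Y p) + (D (Y p) - p) \<bullet> h + (W h \<bullet> h) / 2 - e * (norm h)\<^sup>2" if "e > 0" for e
  proof -
    from exp[OF that] obtain r where r: "r > 0" "\<forall>h. norm h < r \<longrightarrow>
      \<bar>\<psi> (Y p + h) - \<psi> (Y p) - D (Y p) \<bullet> h - (W h \<bullet> h) / 2\<bar> \<le> e * (norm h)\<^sup>2"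
      by blast
    have "a (Y p + h) \<le> a (Y p) + D (Y p) \<bullet> h + (W h \<bullet> h) / 2 + e * (norm h)\<^sup>2 \<and>
      b (Y p + h) \<ge> b (Y p) + (D (Y p) - p) \<bullet> h + (W h \<bullet> h) / 2 - e * (norm h)\<^sup>2" if "norm h < r" for h
      using r(2)[rule_format, OF that] \<psi>(3)[of "Y p + h"] \<psi>le[OF p(1), of "Y p + h"] touch[OF p(1)]
      by (simp add: abs_le_iff m_def inner_diff_left inner_add_right)
    then show ?thesis using r(1) by blast
  qed
  show ?thesis
  proof (rule exI[of _ p], rule exI[of _ "Y p"], rule exI[of _ "D (Y p)"], rule exI[of _ W], intro conjI)
    show "norm p < \<delta>" by (rule p(1))
    show "\<forall>z. a z - b z - p \<bullet> z \<le> a (Y p) - b (Y p) - p \<bullet> Y p" by (intro allI Y[OF p(1)])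
    show "linear W" by (rule W(1))
    show "\<forall>v w. W v \<bullet> w = v \<bullet> W w" by (intro allI W(2))
    show "\<forall>h. \<bar>W h \<bullet> h\<bar> \<le> c * (norm h)\<^sup>2" by (intro allI Wc)
  qed (intro allI impI fin)
qed

section \<open>Calculus of twice continuously differentiable test functions\<close>

lemma has_derivative_grad:
  assumes "\<phi> differentiable (at x)"
  shows "(\<phi> has_derivative (\<lambda>h. grad \<phi> x \<bullet> h)) (at x)"
proof -
  let ?f = "frechet_derivative \<phi> (at x)"
  have d: "(\<phi> has_derivative ?f) (at x)" using assms by (simp add: frechet_derivative_works)
  then have lin: "linear ?f" by (rule has_derivative_linear)
  have "?f h = grad \<phi> x \<bullet> h" for h
  proof -
    have "?f h = ?f (\<Sum>i\<in>UNIV. h $ i *\<^sub>R axis i 1)"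
      by (simp add: basis_expansion flip: scalar_mult_eq_scaleR)
    also have "\<dots> = (\<Sum>i\<in>UNIV. h $ i * ?f (axis i 1))"
      using lin by (simp add: linear_sum linear_cmul)
    finally show ?thesis by (simp add: grad_def inner_vec_def mult.commute)
  qed
  then have "?f = (\<lambda>h. grad \<phi> x \<bullet> h)" by blast
  then show ?thesis using d by simp
qed

lemma has_derivative_hess:
  assumes "grad \<phi> differentiable (at x)"
  shows "(grad \<phi> has_derivative (\<lambda>h. hess \<phi> x *v h)) (at x)"
proof -
  let ?f = "frechet_derivative (grad \<phi>) (at x)"
  have d: "(grad \<phi> has_derivative ?f) (at x)" using assms by (simp add: frechet_derivative_works)
  then have "linear ?f" by (rule has_derivative_linear)
  then have "?f = (\<lambda>h. hess \<phi> x *v h)" by (simp add: hess_def fun_eq_iff matrix_works)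
  then show ?thesis using d by simp
qed

lemma gradI:
  assumes "(\<phi> has_derivative (\<lambda>h. g \<bullet> h)) (at x)"
  shows "grad \<phi> x = g"
proof -
  have "frechet_derivative \<phi> (at x) = (\<lambda>h. g \<bullet> h)" using frechet_derivative_at[OF assms] by simp
  then show ?thesis by (simp add: grad_def vec_eq_iff inner_axis)
qed

lemma C2_from_derivatives:
  assumes g: "\<And>x. (\<phi> has_derivative (\<lambda>h. g x \<bullet> h)) (at x)"
    and A: "\<And>x. (g has_derivative (\<lambda>h. A x *v h)) (at x)"
    and "continuous_on UNIV A"
  shows "C2 \<phi>" "grad \<phi> x = g x" "hess \<phi> x = A x"
proof -
  have gg: "grad \<phi> = g" using gradI[OF g] by blast
  have h: "hess \<phi> x = A x" for x
  proof -
    have "frechet_derivative g (at x) = (\<lambda>h. A x *v h)" using frechet_derivative_at[OF A] by metis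
    then show ?thesis by (simp add: hess_def gg)
  qed
  then have hh: "hess \<phi> = A" by blast
  show "C2 \<phi>" unfolding C2_def gg hh using assms by (auto simp: differentiable_def)
  show "grad \<phi> x = g x" "hess \<phi> x = A x" by (simp_all add: gg hh)
qed

lemma C2_derivatives:
  assumes "C2 \<phi>"
  shows "(\<phi> has_derivative (\<lambda>h. grad \<phi> x \<bullet> h)) (at x)"
    "(grad \<phi> has_derivative (\<lambda>h. hess \<phi> x *v h)) (at x)"
    "continuous_on UNIV (hess \<phi>)" "continuous_on UNIV (grad \<phi>)"
proof -
  have "grad \<phi> differentiable (at y)" for y using assms by (simp add: C2_def)
  then show "continuous_on UNIV (grad \<phi>)"
    by (intro continuous_at_imp_continuous_on) (auto intro: differentiable_imp_continuous_within)
qed (use assms in \<open>auto simp: C2_def intro: has_derivative_grad has_derivative_hess\<close>)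

lemma C2_add:
  assumes "C2 \<phi>" "C2 \<psi>"
  shows "C2 (\<lambda>x. \<phi> x + \<psi> x)" "grad (\<lambda>x. \<phi> x + \<psi> x) x = grad \<phi> x + grad \<psi> x"
    "hess (\<lambda>x. \<phi> x + \<psi> x) x = hess \<phi> x + hess \<psi> x"
proof -
  have "((\<lambda>x. \<phi> x + \<psi> x) has_derivative (\<lambda>h. (grad \<phi> x + grad \<psi> x) \<bullet> h)) (at x)" for x
    unfolding inner_add_left by (intro has_derivative_add C2_derivatives assms)
  moreover have "((\<lambda>x. grad \<phi> x + grad \<psi> x) has_derivative (\<lambda>h. (hess \<phi> x + hess \<psi> x) *v h)) (at x)" for x
    unfolding matrix_vector_mult_add_rdistrib by (intro has_derivative_add C2_derivatives assms)
  moreover have "continuous_on UNIV (\<lambda>x. hess \<phi> x + hess \<psi> x)"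
    by (intro continuous_intros C2_derivatives assms)
  ultimately show "C2 (\<lambda>x. \<phi> x + \<psi> x)" "grad (\<lambda>x. \<phi> x + \<psi> x) x = grad \<phi> x + grad \<psi> x"
    "hess (\<lambda>x. \<phi> x + \<psi> x) x = hess \<phi> x + hess \<psi> x"
    by (rule C2_from_derivatives)+
qed

lemma C2_scale:
  assumes "C2 \<phi>"
  shows "C2 (\<lambda>x. c * \<phi> x)" "grad (\<lambda>x. c * \<phi> x) x = c *\<^sub>R grad \<phi> x"
    "hess (\<lambda>x. c * \<phi> x) x = c *\<^sub>R hess \<phi> x"
proof -
  have "((\<lambda>x. c * \<phi> x) has_derivative (\<lambda>h. (c *\<^sub>R grad \<phi> x) \<bullet> h)) (at x)" for x
    unfolding inner_scaleR_left by (intro has_derivative_mult_right C2_derivatives assms)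
  moreover have "((\<lambda>x. c *\<^sub>R grad \<phi> x) has_derivative (\<lambda>h. (c *\<^sub>R hess \<phi> x) *v h)) (at x)" for x
    unfolding scaleR_matrix_vector_assoc[symmetric]
    by (intro has_derivative_scaleR_right C2_derivatives assms)
  moreover have "continuous_on UNIV (\<lambda>x. c *\<^sub>R hess \<phi> x)"
    by (intro continuous_intros C2_derivatives assms)
  ultimately show "C2 (\<lambda>x. c * \<phi> x)" "grad (\<lambda>x. c * \<phi> x) x = c *\<^sub>R grad \<phi> x"
    "hess (\<lambda>x. c * \<phi> x) x = c *\<^sub>R hess \<phi> x"
    by (rule C2_from_derivatives)+
qed

lemma sym_mats_inner:
  assumes "A \<in> sym_mats"
  shows "v \<bullet> (A *v w) = (A *v v) \<bullet> w"
proof -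
  have t: "transpose A = A" using assms by (simp add: sym_mats_def)
  have "A *v v = v v* A" using transpose_matrix_vector[of A v] unfolding t .
  then show ?thesis by (simp add: dot_lmul_matrix)
qed

lemma C2_quadratic:
  fixes x q :: "real^'n" and A :: "real^'n^'n"
  assumes "A \<in> sym_mats"
  defines "\<phi> \<equiv> \<lambda>y. q \<bullet> (y - x) + 1 / 2 * ((y - x) \<bullet> (A *v (y - x)))"
  shows "C2 \<phi>" "grad \<phi> y = q + A *v (y - x)" "hess \<phi> y = A"
proof -
  have sym: "v \<bullet> (A *v w) = w \<bullet> (A *v v)" for v w
    by (simp add: sym_mats_inner[OF assms(1), of v w] inner_commute)
  have d: "((\<lambda>y. y - x) has_derivative (\<lambda>h. h)) (at y)" for y
    by (auto intro!: derivative_eq_intros)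
  have A: "((\<lambda>y. A *v (y - x)) has_derivative (\<lambda>h. A *v h)) (at y)" for y
    by (rule bounded_linear.has_derivative[OF matrix_vector_mul_bounded_linear d])
  have "(\<phi> has_derivative (\<lambda>h. (q + A *v (y - x)) \<bullet> h)) (at y)" for y
  proof -
    have "(\<phi> has_derivative (\<lambda>h. q \<bullet> h + 1 / 2 * ((y - x) \<bullet> (A *v h) + h \<bullet> (A *v (y - x))))) (at y)"
      unfolding \<phi>_def
      by (intro has_derivative_add has_derivative_mult_right has_derivative_inner has_derivative_inner_right d A)
    moreover have "q \<bullet> h + 1 / 2 * ((y - x) \<bullet> (A *v h) + h \<bullet> (A *v (y - x))) = (q + A *v (y - x)) \<bullet> h" for h
      using sym[of "y - x" h] inner_commute[of h "A *v (y - x)"] by (simp add: inner_add_left)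
    ultimately show ?thesis by simp
  qed
  moreover have "((\<lambda>y. q + A *v (y - x)) has_derivative (\<lambda>h. A *v h)) (at y)" for y
    using has_derivative_add[OF has_derivative_const A] by simp
  moreover have "continuous_on UNIV (\<lambda>_ :: real^'n. A)" by simp
  ultimately show "C2 \<phi>" "grad \<phi> y = q + A *v (y - x)" "hess \<phi> y = A"
    by (rule C2_from_derivatives)+
qed

text \<open>The fourth power vanishes at \<open>x\<close> beyond second order. It can dominate a
  bounded function away from \<open>x\<close>, or make a maximum strict, without disturbing the
  derivatives there.\<close>

lemma C2_quartic:
  fixes x :: "real^'n"
  defines "\<phi> \<equiv> \<lambda>y. ((y - x) \<bullet> (y - x))\<^sup>2"
  shows "C2 \<phi>" "grad \<phi> x = 0" "hess \<phi> x = 0"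
proof -
  define g where "g = (\<lambda>y. (4 * ((y - x) \<bullet> (y - x))) *\<^sub>R (y - x))"
  define A :: "real^'n \<Rightarrow> real^'n^'n" where
    "A = (\<lambda>y. (\<chi> i j. 8 * (y - x) $ i * (y - x) $ j) + (4 * ((y - x) \<bullet> (y - x))) *\<^sub>R mat 1)"
  have outer: "(\<chi> i j. 8 * z $ i * z $ j) *v h = (8 * (z \<bullet> h)) *\<^sub>R z" for z h :: "real^'n"
    by (simp add: vec_eq_iff matrix_vector_mult_def inner_vec_def sum_distrib_left sum_distrib_right mult_ac)
  have A: "A y *v h = (8 * ((y - x) \<bullet> h)) *\<^sub>R (y - x) + (4 * ((y - x) \<bullet> (y - x))) *\<^sub>R h" for y h
    unfolding A_def matrix_vector_mult_add_rdistrib scaleR_matrix_vector_assoc[symmetric] outer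
    by simp
  have d: "((\<lambda>y. y - x) has_derivative (\<lambda>h. h)) (at y)" for y
    by (auto intro!: derivative_eq_intros)
  have sq: "((\<lambda>y. (y - x) \<bullet> (y - x)) has_derivative (\<lambda>h. (y - x) \<bullet> h + h \<bullet> (y - x))) (at y)" for y
    by (intro has_derivative_inner d)
  have "(\<phi> has_derivative (\<lambda>h. g y \<bullet> h)) (at y)" for y
  proof -
    have "(\<phi> has_derivative (\<lambda>h. ((y - x) \<bullet> (y - x)) * ((y - x) \<bullet> h + h \<bullet> (y - x)) +
        ((y - x) \<bullet> h + h \<bullet> (y - x)) * ((y - x) \<bullet> (y - x)))) (at y)"
      unfolding \<phi>_def power2_eq_square by (intro has_derivative_mult sq)
    moreover have "((y - x) \<bullet> (y - x)) * ((y - x) \<bullet> h + h \<bullet> (y - x)) +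
        ((y - x) \<bullet> h + h \<bullet> (y - x)) * ((y - x) \<bullet> (y - x)) = g y \<bullet> h" for h
      using inner_commute[of h "y - x"] by (simp add: g_def)
    ultimately show ?thesis by simp
  qed
  moreover have "(g has_derivative (\<lambda>h. A y *v h)) (at y)" for y
  proof -
    have "(g has_derivative (\<lambda>h. (4 * ((y - x) \<bullet> (y - x))) *\<^sub>R h
        + (4 * ((y - x) \<bullet> h + h \<bullet> (y - x))) *\<^sub>R (y - x))) (at y)"
      unfolding g_def by (intro has_derivative_scaleR has_derivative_mult_right sq d)
    moreover have "(4 * ((y - x) \<bullet> (y - x))) *\<^sub>R h + (4 * ((y - x) \<bullet> h + h \<bullet> (y - x))) *\<^sub>R (y - x)
        = A y *v h" for h
      using inner_commute[of h "y - x"] by (simp add: A)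
    ultimately show ?thesis by simp
  qed
  moreover have "continuous_on UNIV A" unfolding A_def
    by (intro continuous_intros continuous_on_vec_lambda)
  ultimately have *: "C2 \<phi>" "grad \<phi> y = g y" "hess \<phi> y = A y" for y
    by (rule C2_from_derivatives)+
  then show "C2 \<phi>" "grad \<phi> x = 0" "hess \<phi> x = 0"
    by (simp_all add: g_def A_def vec_eq_iff)
qed

text \<open>The conditions on \<open>H\<close> speak of symmetric matrices only, so Hessians must be
  shown to be symmetric before they are inserted. The second difference \<open>S t e f\<close> is
  symmetric in the two directions, and two mean value steps identify the limit of
  \<open>S t e f / t^2\<close>.\<close>

lemma hess_symmetric:
  fixes \<phi> :: "real^'n \<Rightarrow> real"
  assumes "C2 \<phi>"
  shows "hess \<phi> x \<in> sym_mats"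
proof -
  have dg: "((\<lambda>t. \<phi> (z + t *\<^sub>R e)) has_real_derivative grad \<phi> (z + t *\<^sub>R e) \<bullet> e) (at t)" for z e t
  proof -
    have "((\<lambda>t. \<phi> (z + t *\<^sub>R e)) has_derivative (\<lambda>s. grad \<phi> (z + t *\<^sub>R e) \<bullet> (s *\<^sub>R e))) (at t)"
      by (rule has_derivative_compose[OF _ C2_derivatives(1)[OF assms]]) (auto intro!: derivative_eq_intros)
    then show ?thesis by (simp add: has_field_derivative_def mult_commute_abs)
  qed
  have dh: "((\<lambda>t. grad \<phi> (z + t *\<^sub>R f) \<bullet> e) has_real_derivative (hess \<phi> (z + t *\<^sub>R f) *v f) \<bullet> e) (at t)" for z e f t
  proof -
    have "((\<lambda>t. grad \<phi> (z + t *\<^sub>R f)) has_derivative (\<lambda>s. hess \<phi> (z + t *\<^sub>R f) *v (s *\<^sub>R f))) (at t)"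
      by (rule has_derivative_compose[OF _ C2_derivatives(2)[OF assms]]) (auto intro!: derivative_eq_intros)
    from has_derivative_inner_left[OF this, of e] show ?thesis
      by (simp add: has_field_derivative_def mult_commute_abs matrix_vector_mult_scaleR)
  qed
  define S where "S = (\<lambda>t e f. \<phi> (x + t *\<^sub>R e + t *\<^sub>R f) - \<phi> (x + t *\<^sub>R e) - \<phi> (x + t *\<^sub>R f) + \<phi> x)"
  have lim: "((\<lambda>t. S t e f / t\<^sup>2) \<longlongrightarrow> (hess \<phi> x *v f) \<bullet> e) (at_right 0)" for e f
  proof (rule tendstoI)
    fix \<epsilon> :: real assume "\<epsilon> > 0"
    have "isCont (\<lambda>z. (hess \<phi> z *v f) \<bullet> e) x"
    proof -
      have "isCont (hess \<phi>) x" using C2_derivatives(3)[OF assms] by (simp add: continuous_on_eq_continuous_at)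
      then show ?thesis unfolding isCont_def matrix_vector_mult_def
        by (intro tendsto_inner tendsto_vec_lambda tendsto_sum tendsto_mult tendsto_vec_nth tendsto_const)
    qed
    then obtain d where d: "d > 0" "\<And>z. dist z x < d \<Longrightarrow> dist ((hess \<phi> z *v f) \<bullet> e) ((hess \<phi> x *v f) \<bullet> e) < \<epsilon>"
      using \<open>\<epsilon> > 0\<close> unfolding continuous_at_eps_delta by (metis UNIV_I)
    define k where "k = d / (norm e + norm f + 1)"
    have k: "k > 0" using d(1) by (simp add: k_def add_nonneg_pos)
    have "dist (S t e f / t\<^sup>2) ((hess \<phi> x *v f) \<bullet> e) < \<epsilon>" if t: "0 < t" "t < k" for t
    proof -
      define F where "F = (\<lambda>s. \<phi> (x + t *\<^sub>R f + s *\<^sub>R e) - \<phi> (x + s *\<^sub>R e))"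
      have "\<exists>s. 0 < s \<and> s < t \<and> F t - F 0
        = (t - 0) * (grad \<phi> (x + t *\<^sub>R f + s *\<^sub>R e) \<bullet> e - grad \<phi> (x + s *\<^sub>R e) \<bullet> e)"
        unfolding F_def by (rule MVT2) (auto intro!: DERIV_diff dg simp: t)
      then obtain s where s: "0 < s" "s < t"
        and 1: "F t - F 0 = t * (grad \<phi> (x + t *\<^sub>R f + s *\<^sub>R e) \<bullet> e - grad \<phi> (x + s *\<^sub>R e) \<bullet> e)" by auto
      have "\<exists>r. 0 < r \<and> r < t \<and> grad \<phi> (x + s *\<^sub>R e + t *\<^sub>R f) \<bullet> e - grad \<phi> (x + s *\<^sub>R e + 0 *\<^sub>R f) \<bullet> e
        = (t - 0) * ((hess \<phi> (x + s *\<^sub>R e + r *\<^sub>R f) *v f) \<bullet> e)"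
        by (rule MVT2) (auto intro!: dh simp: t)
      then obtain r where r: "0 < r" "r < t"
        and 2: "grad \<phi> (x + s *\<^sub>R e + t *\<^sub>R f) \<bullet> e - grad \<phi> (x + s *\<^sub>R e) \<bullet> e
          = t * ((hess \<phi> (x + s *\<^sub>R e + r *\<^sub>R f) *v f) \<bullet> e)" by auto
      have "S t e f = t * (t * ((hess \<phi> (x + s *\<^sub>R e + r *\<^sub>R f) *v f) \<bullet> e))"
        using 1 2 by (simp add: S_def F_def add_ac)
      then have eq: "S t e f / t\<^sup>2 = (hess \<phi> (x + s *\<^sub>R e + r *\<^sub>R f) *v f) \<bullet> e"
        using t by (simp add: power2_eq_square)
      have "norm (s *\<^sub>R e + r *\<^sub>R f) \<le> s * norm e + r * norm f"
        using norm_triangle_ineq[of "s *\<^sub>R e" "r *\<^sub>R f"] s r by simp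
      also have "\<dots> \<le> t * norm e + t * norm f" using s r by (intro add_mono mult_right_mono) auto
      also have "\<dots> < k * (norm e + norm f + 1)"
      proof -
        have "t * (norm e + norm f) \<le> k * (norm e + norm f)" using t by (intro mult_right_mono) auto
        then show ?thesis using k by (simp add: algebra_simps)
      qed
      also have "\<dots> = d"
      proof -
        have "norm e + norm f + 1 > 0" by (simp add: add_nonneg_pos)
        then show ?thesis by (simp add: k_def)
      qed
      finally have "dist (x + s *\<^sub>R e + r *\<^sub>R f) x < d" by (simp add: dist_norm add.assoc)
      then show ?thesis unfolding eq by (rule d(2))
    qed
    then show "\<forall>\<^sub>F t in at_right 0. dist (S t e f / t\<^sup>2) ((hess \<phi> x *v f) \<bullet> e) < \<epsilon>"
      using k by (auto simp: eventually_at_right_field)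
  qed
  have comm: "S t e f = S t f e" for t e f
    unfolding S_def add.assoc add.commute[of "t *\<^sub>R e" "t *\<^sub>R f"] by linarith
  have swap: "(hess \<phi> x *v f) \<bullet> e = (hess \<phi> x *v e) \<bullet> f" for e f
  proof (rule tendsto_unique[OF trivial_limit_at_right_real lim])
    show "((\<lambda>t. S t e f / t\<^sup>2) \<longlongrightarrow> (hess \<phi> x *v e) \<bullet> f) (at_right 0)"
      unfolding comm[of _ e f] by (rule lim)
  qed
  have comp: "(hess \<phi> x *v axis j 1) \<bullet> axis i 1 = hess \<phi> x $ i $ j" for i j
    by (simp add: inner_axis matrix_vector_mult_basis column_def)
  have "hess \<phi> x $ i $ j = hess \<phi> x $ j $ i" for i j
    using swap[of "axis j 1" "axis i 1"] unfolding comp .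
  then show ?thesis by (simp add: sym_mats_def transpose_def vec_eq_iff)
qed

section \<open>Second-order doubling of variables\<close>

lemma sym_mats_iff_nth: "A \<in> sym_mats \<longleftrightarrow> (\<forall>i j. A $ i $ j = A $ j $ i)"
  by (auto simp: sym_mats_def transpose_def vec_eq_iff)

lemma sum_UNIV_sum_type:
  fixes f :: "'a::finite + 'b::finite \<Rightarrow> 'c::comm_monoid_add"
  shows "(\<Sum>k\<in>UNIV. f k) = (\<Sum>i\<in>UNIV. f (Inl i)) + (\<Sum>j\<in>UNIV. f (Inr j))"
  unfolding UNIV_Plus_UNIV[symmetric] by (subst sum.Plus) (auto simp: comp_def)

lemma block_mat_quadratic_form:
  fixes v :: "real^('n::finite + 'n)"
  defines "x \<equiv> \<chi> i. v $ Inl i" and "y \<equiv> \<chi> i. v $ Inr i"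
  shows "v \<bullet> (block_mat A B C D *v v) = x \<bullet> (A *v x) + x \<bullet> (B *v y) + y \<bullet> (C *v x) + y \<bullet> (D *v y)"
  unfolding inner_vec_def matrix_vector_mult_def sum_UNIV_sum_type block_mat_def x_def y_def
  by (simp add: distrib_left sum.distrib)

lemma symmetric_form_norm_bound:
  fixes W :: "'a::real_inner \<Rightarrow> 'a"
  assumes W: "linear W" "\<And>v w. W v \<bullet> w = v \<bullet> W w" and bound: "\<And>h. \<bar>W h \<bullet> h\<bar> \<le> c * (norm h)\<^sup>2"
  shows "norm (W h) \<le> c * norm h"
proof (cases "W h = 0")
  case True
  have "0 \<le> c * (norm h)\<^sup>2" using bound[of h] by linarith
  then have "0 \<le> c * norm h" by (cases "h = 0") (auto simp: zero_le_mult_iff)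
  then show ?thesis using True by simp
next
  case False
  then have h: "h \<noteq> 0" using W(1) linear_0 by auto
  \<comment> \<open>Polarisation with \<open>W h\<close> rescaled to the length of \<open>h\<close>:
    by the parallelogram law the two squared norms then add up to four times that of
    \<open>h\<close>.\<close>
  define k where "k = (norm h / norm (W h)) *\<^sub>R W h"
  have nk: "norm k = norm h" using False by (simp add: k_def)
  have "4 * (W h \<bullet> k) = W (h + k) \<bullet> (h + k) - W (h - k) \<bullet> (h - k)"
    using W(2)[of k h] inner_commute[of k "W h"]
    by (simp add: linear_add[OF W(1)] linear_diff[OF W(1)] inner_add_left inner_add_right inner_diff_left inner_diff_right)
  also have "\<dots> \<le> c * (norm (h + k))\<^sup>2 + c * (norm (h - k))\<^sup>2"
    using bound[of "h + k"] bound[of "h - k"] by linarith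
  also have "\<dots> = 4 * c * (norm h)\<^sup>2"
    using nk[unfolded norm_eq_sqrt_inner]
    by (simp add: power2_norm_eq_inner inner_add_left inner_add_right inner_diff_left inner_diff_right algebra_simps)
  finally have "W h \<bullet> k \<le> c * (norm h)\<^sup>2" by simp
  moreover have "W h \<bullet> k = norm h * norm (W h)"
    using False by (simp add: k_def dot_square_norm power2_eq_square)
  ultimately have "norm h * norm (W h) \<le> norm h * (c * norm h)" by (simp add: power2_eq_square mult_ac)
  then show ?thesis using h by simp
qed

text \<open>The inequality \<open>le'\<close> may be used at \<open>x + h\<close> and
  \<open>y + k\<close> for any \<open>k\<close>, which transfers the expansion of \<open>a\<close>
  at \<open>y\<close> to \<open>u\<close> at \<open>x\<close>. Taking \<open>k = h\<close> would
  only reproduce \<open>W\<close>; shifting \<open>k\<close> by a multiple of \<open>W h\<close>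
  gains the squared term that the block inequality needs.\<close>

lemma sup_convolution_expansion:
  fixes W :: "'a::real_inner \<Rightarrow> 'a" and u a :: "'a \<Rightarrow> real"
  assumes c: "0 < c" and W: "linear W" "\<And>v w. W v \<bullet> w = v \<bullet> W w" "\<And>h. \<bar>W h \<bullet> h\<bar> \<le> c * (norm h)\<^sup>2"
    and le': "\<forall>x'\<in>K. \<forall>y'. u x' \<le> a y' + c / 2 * (norm (x' - d - y'))\<^sup>2"
    and x: "x \<in> K" and eq: "u x = a y + c / 2 * (norm (x - d - y))\<^sup>2"
    and exp': "\<forall>e>0. \<exists>r>0. \<forall>h. norm h < r \<longrightarrow>
      a (y + h) \<le> a y + g \<bullet> h + (W h \<bullet> h) / 2 + e * (norm h)\<^sup>2"
  shows "g = c *\<^sub>R (x - d - y)"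
    and "e > 0 \<Longrightarrow> \<exists>r>0. \<forall>h. norm h < r \<and> x + h \<in> K \<longrightarrow>
      u (x + h) \<le> u x + g \<bullet> h + (W h \<bullet> h - (norm (W h))\<^sup>2 / (2 * c)) / 2 + e * (norm h)\<^sup>2"
proof -
  note le = le'[rule_format] and exp = exp'[rule_format]
  define \<xi> where "\<xi> = x - d - y"
  from exp[of 1] obtain r where r: "r > 0"
    and rr: "\<And>h. norm h < r \<Longrightarrow> a (y + h) \<le> a y + g \<bullet> h + (W h \<bullet> h) / 2 + (norm h)\<^sup>2" by auto
  \<comment> \<open>Keeping \<open>x\<close> fixed and moving only the base point \<open>y\<close>
    bounds a linear form by a quadratic, which determines \<open>g\<close>.\<close>
  have "(c *\<^sub>R \<xi> - g) \<bullet> h \<le> (c + 1) * (norm h)\<^sup>2" if "norm h < r" for h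
  proof -
    have "(norm (x - d - (y + h)))\<^sup>2 = (norm \<xi>)\<^sup>2 - 2 * (\<xi> \<bullet> h) + (norm h)\<^sup>2"
      unfolding \<xi>_def by (simp add: power2_norm_eq_inner inner_diff_left inner_diff_right inner_add_left inner_add_right inner_commute)
    then have "c / 2 * (norm (x - d - (y + h)))\<^sup>2 = c / 2 * (norm \<xi>)\<^sup>2 - c * (\<xi> \<bullet> h) + c / 2 * (norm h)\<^sup>2"
      by (simp only:) (simp add: algebra_simps)
    then have "u x \<le> a (y + h) + (c / 2 * (norm \<xi>)\<^sup>2 - c * (\<xi> \<bullet> h) + c / 2 * (norm h)\<^sup>2)"
      using le[OF x, of "y + h"] by linarith
    moreover have "u x = a y + c / 2 * (norm \<xi>)\<^sup>2" using eq by (simp add: \<xi>_def)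
    moreover have "W h \<bullet> h \<le> c * (norm h)\<^sup>2" using W(3)[of h] by linarith
    ultimately have "c * (\<xi> \<bullet> h) - g \<bullet> h \<le> c * (norm h)\<^sup>2 + (norm h)\<^sup>2"
      using rr[OF that] by linarith
    then show ?thesis by (simp add: inner_diff_left distrib_right)
  qed
  from inner_le_quadratic_imp_zero[OF r this] show g: "g = c *\<^sub>R (x - d - y)" by (simp add: \<xi>_def)
  show "\<exists>r>0. \<forall>h. norm h < r \<and> x + h \<in> K \<longrightarrow>
      u (x + h) \<le> u x + g \<bullet> h + (W h \<bullet> h - (norm (W h))\<^sup>2 / (2 * c)) / 2 + e * (norm h)\<^sup>2" if e: "e > 0"
  proof -
    \<comment> \<open>The \<open>k\<close> used below has norm at most \<open>2 * norm h\<close>: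
      hence \<open>e / 4\<close> here and the radius \<open>r / 2\<close> at the end.\<close>
    from exp[of "e / 4"] e obtain r where r: "r > 0"
      and rr: "\<And>h. norm h < r \<Longrightarrow> a (y + h) \<le> a y + g \<bullet> h + (W h \<bullet> h) / 2 + e / 4 * (norm h)\<^sup>2" by auto
    have "u (x + h) \<le> u x + g \<bullet> h + (W h \<bullet> h - (norm (W h))\<^sup>2 / (2 * c)) / 2 + e * (norm h)\<^sup>2"
      if h: "norm h < r / 2" "x + h \<in> K" for h
    proof -
      txt \<open>The optimal \<open>k\<close> would be \<open>(1 + W / c)\<^sup>-\<^sup>1 h\<close>, which may not exist; \<open>k = h - W h / (2 c)\<close> is good enough.\<close>
      define w where "w = (1 / (2 * c)) *\<^sub>R W h"
      define k where "k = h - w"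
      have "norm w \<le> norm h / 2"
      proof -
        have "norm w = norm (W h) / (2 * c)" using c by (simp add: w_def)
        also have "\<dots> \<le> (c * norm h) / (2 * c)"
          using symmetric_form_norm_bound[OF W, of h] c by (intro divide_right_mono) auto
        finally show ?thesis using c by simp
      qed
      then have nk: "norm k \<le> 2 * norm h" using norm_triangle_ineq4[of h w] norm_ge_zero[of h] unfolding k_def by linarith
      have "u (x + h) \<le> a (y + k) + c / 2 * (norm (x + h - d - (y + k)))\<^sup>2" by (rule le[OF h(2)])
      also have "x + h - d - (y + k) = \<xi> + w" by (simp add: \<xi>_def k_def)
      also have "(norm (\<xi> + w))\<^sup>2 = (norm \<xi>)\<^sup>2 + 2 * (\<xi> \<bullet> w) + (norm w)\<^sup>2"
        by (simp add: power2_norm_eq_inner inner_add_left inner_add_right inner_commute)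
      finally have 1: "u (x + h) \<le> a (y + k) + c / 2 * (norm \<xi>)\<^sup>2 + c * (\<xi> \<bullet> w) + c / 2 * (norm w)\<^sup>2"
        by (simp add: algebra_simps)
      have 2: "a (y + k) \<le> a y + g \<bullet> k + (W k \<bullet> k) / 2 + e / 4 * (norm k)\<^sup>2"
        using nk h(1) by (intro rr) simp
      have "(norm k)\<^sup>2 \<le> (2 * norm h)\<^sup>2" using nk by (intro power_mono) auto
      then have 3: "e / 4 * (norm k)\<^sup>2 \<le> e * (norm h)\<^sup>2" using e by (simp add: power_mult_distrib)
      have 4: "g \<bullet> k = g \<bullet> h - c * (\<xi> \<bullet> w)" using g by (simp add: k_def \<xi>_def inner_diff_right)
      have 5: "W k \<bullet> k = W h \<bullet> h - 2 * (W h \<bullet> w) + W w \<bullet> w"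
        using W(2)[of w h] inner_commute[of w "W h"]
        by (simp add: k_def linear_diff[OF W(1)] inner_diff_left inner_diff_right)
      have 6: "W w \<bullet> w \<le> c * (norm w)\<^sup>2" using W(3)[of w] by linarith
      have 7: "W h \<bullet> w = (norm (W h))\<^sup>2 / (2 * c)" by (simp add: w_def dot_square_norm)
      have 8: "c * (norm w)\<^sup>2 = (norm (W h))\<^sup>2 / (2 * c) / 2"
        using c by (simp add: w_def power2_eq_square)
      have 9: "u x = a y + c / 2 * (norm \<xi>)\<^sup>2" using eq by (simp add: \<xi>_def)
      define X where "X = (norm (W h))\<^sup>2 / (2 * c)"
      have 10: "c / 2 * (norm w)\<^sup>2 = X / 4" "c * (norm w)\<^sup>2 = X / 2" using 8 by (simp_all add: X_def)
      have "W k \<bullet> k \<le> W h \<bullet> h - 2 * X + X / 2"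
        using 5 6 7 10(2) by (simp only: X_def[symmetric])
      then have "(W k \<bullet> k) / 2 \<le> (W h \<bullet> h - X) / 2 - X / 4"
        by (simp add: diff_divide_distrib)
      then have "a (y + k) \<le> a y + (g \<bullet> h - c * (\<xi> \<bullet> w)) + ((W h \<bullet> h - X) / 2 - X / 4) + e * (norm h)\<^sup>2"
        using 2 3 unfolding 4 by linarith
      moreover have "u (x + h) \<le> a (y + k) + c / 2 * (norm \<xi>)\<^sup>2 + c * (\<xi> \<bullet> w) + X / 4"
        using 1 unfolding 10(1) .
      ultimately show ?thesis unfolding X_def[symmetric] 9 by linarith
    qed
    then show ?thesis using r by (intro exI[of _ "r / 2"]) auto
  qed
qed

text \<open>A contact gives only a second-order bound near \<open>x\<close>, while test functions
  must be \<open>C2\<close> and touch on all of \<open>K\<close>. The slack \<open>e\<close> becomes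
  \<open>2 * e\<close> in the Hessian, and a multiple of the quartic takes care of the points away
  from \<open>x\<close>.\<close>

lemma C2_test_function:
  fixes u :: "real^'n \<Rightarrow> real"
  assumes K: "compact K" "x \<in> K" and bound: "\<forall>y\<in>K. \<bar>u y\<bar> \<le> M" and A: "A \<in> sym_mats"
    and loc: "\<exists>r>0. \<forall>h. norm h < r \<and> x + h \<in> K \<longrightarrow>
      u (x + h) \<le> u x + q \<bullet> h + (h \<bullet> (A *v h)) / 2 + e * (norm h)\<^sup>2"
  obtains \<phi> where "C2 \<phi>" "grad \<phi> x = q" "hess \<phi> x = A + (2 * e) *\<^sub>R mat 1"
    "\<And>y. y \<in> K \<Longrightarrow> u y - \<phi> y \<le> u x - \<phi> x"
proof -
  define A' where "A' = A + (2 * e) *\<^sub>R mat 1"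
  have A': "A' \<in> sym_mats"
    using A by (simp add: A'_def sym_mats_def transpose_def vec_eq_iff mat_def)
  have form: "h \<bullet> (A' *v h) = h \<bullet> (A *v h) + 2 * e * (norm h)\<^sup>2" for h
    by (simp add: A'_def matrix_vector_mult_add_rdistrib inner_add_right dot_square_norm flip: scaleR_matrix_vector_assoc)
  define P where "P = (\<lambda>y. q \<bullet> (y - x) + 1 / 2 * ((y - x) \<bullet> (A' *v (y - x))))"
  have P: "C2 P" "grad P x = q" "hess P x = A'"
    unfolding P_def using C2_quadratic(1)[OF A', of q x] C2_quadratic(2,3)[OF A', of q x x] by auto
  obtain r where r: "r > 0" "\<And>h. norm h < r \<Longrightarrow> x + h \<in> K \<Longrightarrow>
      u (x + h) \<le> u x + q \<bullet> h + (h \<bullet> (A *v h)) / 2 + e * (norm h)\<^sup>2" using loc by blast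
  have "\<And>y. isCont P y" using has_derivative_continuous[OF C2_derivatives(1)[OF P(1)]] by blast
  then have "continuous_on K P" by (intro continuous_at_imp_continuous_on) auto
  then have "bounded (P ` K)" using K(1) compact_continuous_image compact_imp_bounded by blast
  then obtain B where B: "\<And>y. y \<in> K \<Longrightarrow> \<bar>P y\<bar> \<le> B" by (auto simp: bounded_iff)
  \<comment> \<open>Outside radius \<open>r\<close> the quartic term is at least
    \<open>L * r ^ 4 = 2 * M + B\<close>, which covers the oscillation of \<open>u\<close> and the
    size of \<open>P\<close>.\<close>
  define L where "L = (2 * M + B) / r ^ 4"
  have MB: "0 \<le> 2 * M + B" using bound[rule_format, OF K(2)] B[OF K(2)] by linarith
  then have L: "L \<ge> 0" using r(1) by (simp add: L_def)
  define Q where "Q = (\<lambda>y. L * ((y - x) \<bullet> (y - x))\<^sup>2)"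
  have Q: "C2 Q" "grad Q x = 0" "hess Q x = 0"
    unfolding Q_def using C2_scale(1)[OF C2_quartic(1)[of x], of L]
      C2_scale(2,3)[OF C2_quartic(1)[of x], of L x] C2_quartic(2,3)[of x] by simp_all
  define \<phi> where "\<phi> = (\<lambda>y. P y + Q y)"
  have \<phi>: "C2 \<phi>" "grad \<phi> x = q" "hess \<phi> x = A'"
    unfolding \<phi>_def using C2_add[OF P(1) Q(1)] P Q by auto
  have \<phi>0: "\<phi> x = 0" by (simp add: \<phi>_def P_def Q_def)
  have "u y - \<phi> y \<le> u x - \<phi> x" if y: "y \<in> K" for y
  proof (cases "norm (y - x) < r")
    case True
    have "u y \<le> u x + P y"
      using r(2)[OF True] y form[of "y - x"] by (simp add: P_def add_divide_distrib)
    moreover have "Q y \<ge> 0" using L by (simp add: Q_def)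
    ultimately show ?thesis using \<phi>0 by (simp add: \<phi>_def)
  next
    case False
    have "r ^ 4 \<le> (norm (y - x)) ^ 4" using False r(1) by (intro power_mono) auto
    then have "L * r ^ 4 \<le> L * (norm (y - x)) ^ 4" using L by (rule mult_left_mono)
    moreover have "Q y = L * (norm (y - x)) ^ 4"
      by (simp add: Q_def dot_square_norm power_mult[symmetric])
    moreover have "L * r ^ 4 = 2 * M + B" using r(1) by (simp add: L_def)
    ultimately have "Q y \<ge> 2 * M + B" by linarith
    then show ?thesis using bound[rule_format, OF y] bound[rule_format, OF K(2)] B[OF y] \<phi>0 by (simp add: \<phi>_def abs_le_iff)
  qed
  then show ?thesis using \<phi> that by (simp add: A'_def)
qed

text \<open>The upper inequality is the delicate one. With \<open>d = x - y\<close>,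
  \<open>p = W x\<close> and \<open>q = W y\<close> the forms of \<open>W\<close> differ by
  \<open>d \<bullet> (p + q)\<close>, and Young's inequality leaves
  \<open>norm (p + q) ^ 2 / (4 * \<alpha>)\<close>. This is at most
  \<open>(norm p ^ 2 + norm q ^ 2) / (2 * \<alpha>)\<close>, just what the corrections in
  \<open>A\<close> and \<open>B\<close> subtract. The factor \<open>l\<close> allows for dilated
  test functions.\<close>

lemma matrix_pair_structure:
  fixes W :: "real^'n^'n"
  assumes W: "W \<in> sym_mats" and \<alpha>: "0 < \<alpha>" and bound: "\<And>h. \<bar>h \<bullet> (W *v h)\<bar> \<le> \<alpha> * (norm h)\<^sup>2" and l: "0 < l"
  defines "A \<equiv> W - (1 / (2 * \<alpha>)) *\<^sub>R (W ** W)" and "B \<equiv> W + (1 / (2 * \<alpha>)) *\<^sub>R (W ** W)"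
    and "\<epsilon> \<equiv> 1 / (l * \<alpha>)"
  shows "A \<in> sym_mats" "B \<in> sym_mats"
    "h \<bullet> (A *v h) = h \<bullet> (W *v h) - (norm (W *v h))\<^sup>2 / (2 * \<alpha>)"
    "h \<bullet> (B *v h) = h \<bullet> (W *v h) + (norm (W *v h))\<^sup>2 / (2 * \<alpha>)"
    "- (3 / \<epsilon>) *\<^sub>R block_mat (mat 1) 0 0 (mat 1) \<preceq> block_mat (l *\<^sub>R A) 0 0 (- (l *\<^sub>R B))"
    "block_mat (l *\<^sub>R A) 0 0 (- (l *\<^sub>R B)) \<preceq> (3 / \<epsilon>) *\<^sub>R block_mat (mat 1) (- mat 1) (- mat 1) (mat 1)"
proof -
  have WW: "h \<bullet> ((W ** W) *v h) = (norm (W *v h))\<^sup>2" for h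
    using sym_mats_inner[OF W, of h "W *v h"] by (simp add: dot_square_norm flip: matrix_vector_mul_assoc)
  have tW: "transpose W = W" using W by (simp add: sym_mats_def)
  have "transpose (W ** W) = W ** W" by (simp add: matrix_transpose_mul tW)
  then have WWij: "(W ** W) $ i $ j = (W ** W) $ j $ i" for i j
    using sym_mats_iff_nth[of "W ** W"] unfolding sym_mats_def by blast
  have Wij: "W $ i $ j = W $ j $ i" for i j using W sym_mats_iff_nth by blast
  show "A \<in> sym_mats" "B \<in> sym_mats"
    using Wij WWij by (simp_all add: A_def B_def sym_mats_iff_nth)
  show Aform: "h \<bullet> (A *v h) = h \<bullet> (W *v h) - (norm (W *v h))\<^sup>2 / (2 * \<alpha>)" for h
    by (simp add: A_def matrix_vector_mult_diff_rdistrib inner_diff_right WW flip: scaleR_matrix_vector_assoc)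
  show Bform: "h \<bullet> (B *v h) = h \<bullet> (W *v h) + (norm (W *v h))\<^sup>2 / (2 * \<alpha>)" for h
    by (simp add: B_def matrix_vector_mult_add_rdistrib inner_add_right WW flip: scaleR_matrix_vector_assoc)
  have Wn: "norm (W *v h) \<le> \<alpha> * norm h" for h
  proof (rule symmetric_form_norm_bound[of "(*v) W"])
    show "(W *v v) \<bullet> w = v \<bullet> (W *v w)" for v w by (rule sym_mats_inner[OF W, symmetric])
    show "\<bar>(W *v h) \<bullet> h\<bar> \<le> \<alpha> * (norm h)\<^sup>2" for h using bound[of h] by (simp only: inner_commute[of h])
  qed (rule matrix_vector_mul_linear)
  have Wn2: "(norm (W *v h))\<^sup>2 / (2 * \<alpha>) \<le> \<alpha> * (norm h)\<^sup>2" for h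
  proof -
    have "(norm (W *v h))\<^sup>2 \<le> (\<alpha> * norm h)\<^sup>2" using Wn by (intro power_mono) auto
    then have "(norm (W *v h))\<^sup>2 / (2 * \<alpha>) \<le> (\<alpha> * norm h)\<^sup>2 / (2 * \<alpha>)" using \<alpha> by (intro divide_right_mono) auto
    also have "\<dots> \<le> \<alpha> * (norm h)\<^sup>2" using \<alpha> by (simp add: power2_eq_square)
    finally show ?thesis .
  qed
  have \<epsilon>: "3 / \<epsilon> = 3 * (l * \<alpha>)" by (simp add: \<epsilon>_def)
  have lower: "- 3 * \<alpha> * ((norm x)\<^sup>2 + (norm y)\<^sup>2) \<le> x \<bullet> (A *v x) - y \<bullet> (B *v y)" for x y
  proof -
    have "0 \<le> \<alpha> * (norm x)\<^sup>2" "0 \<le> \<alpha> * (norm y)\<^sup>2" using \<alpha> by auto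
    then show ?thesis using bound[of x] bound[of y] Wn2[of x] Wn2[of y] unfolding Aform Bform
      by (simp only: distrib_left)
  qed
  have upper: "x \<bullet> (A *v x) - y \<bullet> (B *v y) \<le> 3 * \<alpha> * (norm (x - y))\<^sup>2" for x y
  proof -
    define p where "p = W *v x" define q where "q = W *v y" define d where "d = x - y"
    have "x \<bullet> p - y \<bullet> q = d \<bullet> (p + q)"
      using sym_mats_inner[OF W, of x y] inner_commute[of "W *v x" y]
      by (simp add: p_def q_def d_def inner_add_right inner_diff_left)
    moreover have "d \<bullet> (p + q) \<le> \<alpha> * (norm d)\<^sup>2 + (norm (p + q))\<^sup>2 / (4 * \<alpha>)"
    proof -
      have "0 \<le> (norm ((2 * \<alpha>) *\<^sub>R d - (p + q)))\<^sup>2" by simp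
      also have "\<dots> = 4 * \<alpha>\<^sup>2 * (norm d)\<^sup>2 - 4 * \<alpha> * (d \<bullet> (p + q)) + (norm (p + q))\<^sup>2"
        unfolding power2_norm_eq_inner inner_diff_left inner_diff_right inner_scaleR_left inner_scaleR_right
          inner_commute[of "p + q" d] by (simp add: power2_eq_square algebra_simps)
      finally show ?thesis using \<alpha> by (simp add: field_simps power2_eq_square)
    qed
    moreover have "(norm (p + q))\<^sup>2 \<le> 2 * (norm p)\<^sup>2 + 2 * (norm q)\<^sup>2"
    proof -
      have "0 \<le> (norm (p - q))\<^sup>2" by simp
      then show ?thesis
        by (simp add: power2_norm_eq_inner inner_add_left inner_add_right inner_diff_left inner_diff_right)
    qed
    then have "(norm (p + q))\<^sup>2 / (4 * \<alpha>) \<le> (2 * (norm p)\<^sup>2 + 2 * (norm q)\<^sup>2) / (4 * \<alpha>)"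
      using \<alpha> by (intro divide_right_mono) auto
    moreover have "(2 * (norm p)\<^sup>2 + 2 * (norm q)\<^sup>2) / (4 * \<alpha>) = (norm p)\<^sup>2 / (2 * \<alpha>) + (norm q)\<^sup>2 / (2 * \<alpha>)"
      using \<alpha> by (simp add: field_simps)
    moreover have "0 \<le> \<alpha> * (norm d)\<^sup>2" using \<alpha> by simp
    ultimately show ?thesis unfolding Aform Bform p_def[symmetric] q_def[symmetric] d_def[symmetric]
      by linarith
  qed
  let ?P = "block_mat (l *\<^sub>R A) 0 0 (- (l *\<^sub>R B))" and ?L = "- (3 / \<epsilon>) *\<^sub>R block_mat (mat 1) 0 0 (mat 1)"
    and ?R = "(3 / \<epsilon>) *\<^sub>R block_mat (mat 1) (- mat 1) (- mat 1) (mat 1)"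
  have neg: "z \<bullet> ((- M) *v y) = - (z \<bullet> (M *v y))" for y z and M :: "real^'n^'n"
    by (simp add: matrix_vector_mult_def inner_vec_def sum_negf)
  have sc: "y \<bullet> ((k *\<^sub>R M) *v y) = k * (y \<bullet> (M *v y))" for y k and M :: "real^'m^'m"
    by (simp flip: scaleR_matrix_vector_assoc)
  show "?L \<preceq> ?P"
    unfolding mat_le_def
  proof
    fix v :: "real^('n + 'n)"
    define x y where "x = (\<chi> i. v $ Inl i)" and "y = (\<chi> i. v $ Inr i)"
    have "l * (- 3 * \<alpha> * ((norm x)\<^sup>2 + (norm y)\<^sup>2)) \<le> l * (x \<bullet> (A *v x) - y \<bullet> (B *v y))"
      using lower l by (intro mult_left_mono) auto
    then show "v \<bullet> (?L *v v)
        \<le> v \<bullet> (?P *v v)"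
      unfolding sc block_mat_quadratic_form x_def[symmetric] y_def[symmetric] \<epsilon> neg
      by (simp add: dot_square_norm algebra_simps)
  qed
  show "?P \<preceq> ?R"
    unfolding mat_le_def
  proof
    fix v :: "real^('n + 'n)"
    define x y where "x = (\<chi> i. v $ Inl i)" and "y = (\<chi> i. v $ Inr i)"
    have "l * (x \<bullet> (A *v x) - y \<bullet> (B *v y)) \<le> l * (3 * \<alpha> * (norm (x - y))\<^sup>2)"
      using upper l by (intro mult_left_mono) auto
    also have "(norm (x - y))\<^sup>2 = x \<bullet> x - x \<bullet> y - y \<bullet> x + y \<bullet> y"
      by (simp add: power2_norm_eq_inner inner_diff_left inner_diff_right)
    finally show "v \<bullet> (?P *v v)
        \<le> v \<bullet> (?R *v v)"
      unfolding sc block_mat_quadratic_form x_def[symmetric] y_def[symmetric] \<epsilon> neg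
      by (simp add: algebra_simps)
  qed
qed

lemma sym_mats_closed:
  "A \<in> sym_mats \<Longrightarrow> - A \<in> sym_mats"
  "A \<in> sym_mats \<Longrightarrow> c *\<^sub>R A \<in> sym_mats"
  "A \<in> sym_mats \<Longrightarrow> B \<in> sym_mats \<Longrightarrow> A + B \<in> sym_mats"
  "A \<in> sym_mats \<Longrightarrow> B \<in> sym_mats \<Longrightarrow> A - B \<in> sym_mats"
  "mat k \<in> sym_mats"
proof -
  show "A \<in> sym_mats \<Longrightarrow> - A \<in> sym_mats"
    unfolding sym_mats_iff_nth uminus_vec_def by simp
  show "mat k \<in> sym_mats" by (simp add: sym_mats_iff_nth mat_def)
qed (auto simp: sym_mats_iff_nth)

section \<open>Sup-convolutions and existence of contact points\<close>

lemma sup_convolution_exists: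
  fixes f :: "'a::euclidean_space \<Rightarrow> real"
  assumes K: "compact K" "K \<noteq> {}" and f: "continuous_on K f"
  obtains s where "semiconvex c s" "\<And>x y. x \<in> K \<Longrightarrow> f x \<le> s y + c / 2 * (norm (x - y))\<^sup>2"
    "\<And>y. \<exists>x\<in>K. s y = f x - c / 2 * (norm (x - y))\<^sup>2"
proof -
  have "\<exists>x\<in>K. \<forall>z\<in>K. f z - c / 2 * (norm (z - y))\<^sup>2 \<le> f x - c / 2 * (norm (x - y))\<^sup>2" for y
    by (rule continuous_attains_sup[OF K]) (intro continuous_intros f)
  then obtain X where X: "\<And>y. X y \<in> K"
    and max: "\<And>y z. z \<in> K \<Longrightarrow> f z - c / 2 * (norm (z - y))\<^sup>2 \<le> f (X y) - c / 2 * (norm (X y - y))\<^sup>2"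
    by metis
  define s where "s = (\<lambda>y. f (X y) - c / 2 * (norm (X y - y))\<^sup>2)"
  have le: "f x \<le> s y + c / 2 * (norm (x - y))\<^sup>2" if "x \<in> K" for x y
    using max[OF that, of y] by (simp add: s_def)
  have "semiconvex c s" unfolding semiconvex_def
  proof (intro allI impI)
    fix x y :: 'a and t :: real assume t: "0 \<le> t \<and> t \<le> 1"
    define z where "z = (1 - t) *\<^sub>R x + t *\<^sub>R y"
    \<comment> \<open>The maximiser for the intermediate point \<open>z\<close> is used as a
      competitor at both end points.\<close>
    define k where "k = X z"
    have "k - z = (1 - t) *\<^sub>R (k - x) + t *\<^sub>R (k - y)" by (simp add: z_def algebra_simps)
    then have "(norm (k - z))\<^sup>2 = (1 - t) * (norm (k - x))\<^sup>2 + t * (norm (k - y))\<^sup>2 - t * (1 - t) * (norm (x - y))\<^sup>2"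
      using norm_convex_comb_squared[of t "k - x" "k - y"] by (simp add: norm_minus_commute)
    then have "s z = f k - c / 2 * ((1 - t) * (norm (k - x))\<^sup>2 + t * (norm (k - y))\<^sup>2 - t * (1 - t) * (norm (x - y))\<^sup>2)"
      by (simp add: s_def k_def)
    also have "\<dots> = (1 - t) * (f k - c / 2 * (norm (k - x))\<^sup>2) + t * (f k - c / 2 * (norm (k - y))\<^sup>2)
        + c / 2 * (t * (1 - t) * (norm (x - y))\<^sup>2)"
      by (simp add: field_simps)
    also have "\<dots> \<le> (1 - t) * s x + t * s y + c / 2 * (t * (1 - t) * (norm (x - y))\<^sup>2)"
    proof -
      have "f k - c / 2 * (norm (k - x))\<^sup>2 \<le> s x" "f k - c / 2 * (norm (k - y))\<^sup>2 \<le> s y"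
        using le[OF X[of z], of x] le[OF X[of z], of y] by (simp_all add: k_def)
      then have "(1 - t) * (f k - c / 2 * (norm (k - x))\<^sup>2) \<le> (1 - t) * s x"
        "t * (f k - c / 2 * (norm (k - y))\<^sup>2) \<le> t * s y"
        using t by (simp_all only: mult_left_mono diff_ge_0_iff_ge)
      then show ?thesis by linarith
    qed
    finally show "s ((1 - t) *\<^sub>R x + t *\<^sub>R y) \<le> (1 - t) * s x + t * s y + c / 2 * (t * (1 - t) * (norm (x - y))\<^sup>2)"
      by (simp add: z_def)
  qed
  moreover have "\<exists>x\<in>K. s y = f x - c / 2 * (norm (x - y))\<^sup>2" for y using X s_def by blast
  ultimately show ?thesis using that le by blast
qed

lemma semiconvex_continuous:
  fixes f :: "'a::euclidean_space \<Rightarrow> real"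
  assumes "semiconvex c f"
  shows "continuous_on UNIV f"
proof -
  have "continuous_on UNIV (\<lambda>x. f x + c / 2 * (norm x)\<^sup>2)"
    using assms unfolding semiconvex_iff_convex_on by (intro convex_on_continuous) auto
  moreover have "continuous_on UNIV (\<lambda>x :: 'a. c / 2 * (norm x)\<^sup>2)"
    by (intro continuous_intros)
  ultimately have "continuous_on UNIV (\<lambda>x. (f x + c / 2 * (norm x)\<^sup>2) - c / 2 * (norm x)\<^sup>2)"
    by (rule continuous_on_diff)
  then show ?thesis by simp
qed

lemma semiconvex_shift:
  assumes "semiconvex c f"
  shows "semiconvex c (\<lambda>y. f (y + d))"
  unfolding semiconvex_def
proof (intro allI impI)
  fix x y :: 'a and t :: real assume t: "0 \<le> t \<and> t \<le> 1"
  have "(1 - t) *\<^sub>R (x + d) + t *\<^sub>R (y + d) = (1 - t) *\<^sub>R x + t *\<^sub>R y + d" by (simp add: algebra_simps)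
  then show "f ((1 - t) *\<^sub>R x + t *\<^sub>R y + d) \<le> (1 - t) * f (x + d) + t * f (y + d) + c / 2 * (t * (1 - t) * (norm (x - y))\<^sup>2)"
    using semiconvexD[OF assms, of t "x + d" "y + d"] t by simp
qed

lemma continuous_max_of_coercive:
  fixes f :: "'a::euclidean_space \<Rightarrow> real"
  assumes f: "continuous_on UNIV f" and \<alpha>: "0 < \<alpha>" and R: "0 \<le> R" and \<beta>: "0 \<le> \<beta>"
    and bound: "\<And>y. norm y \<ge> R \<Longrightarrow> f y \<le> k + \<beta> * norm y - \<alpha> * (norm y - R)\<^sup>2"
  shows "\<exists>y. \<forall>z. f z \<le> f y"
proof -
  define m where "m = max 0 (k - f 0)"
  have m: "0 \<le> m" "k \<le> f 0 + m" by (auto simp: m_def)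
  \<comment> \<open>For \<open>t = norm y - R \<ge> 1\<close> the lower-order terms, apart from
    \<open>f 0\<close>, add up to at most \<open>b * t\<close>, so the quadratic term wins once
    \<open>t \<ge> b / \<alpha>\<close>.\<close>
  define b where "b = \<beta> * (R + 1) + m"
  define S where "S = R + 1 + b / \<alpha>"
  have b: "b \<ge> 0" using R \<beta> m by (simp add: b_def)
  have S: "S \<ge> 0" using R b \<alpha> by (simp add: S_def)
  have far: "f y \<le> f 0" if "norm y > S" for y
  proof -
    define t where "t = norm y - R"
    have "0 \<le> b / \<alpha>" using b \<alpha> by simp
    then have t: "t \<ge> 1" "t \<ge> b / \<alpha>" using that unfolding t_def S_def by linarith+
    have ny: "norm y = R + t" by (simp add: t_def)
    have "f y \<le> k + \<beta> * (R + t) - \<alpha> * t\<^sup>2" using bound[of y] t by (simp add: ny)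
    also have "\<beta> * (R + t) \<le> \<beta> * ((R + 1) * t)"
    proof (rule mult_left_mono[OF _ \<beta>])
      have "R * 1 \<le> R * t" using t R by (intro mult_left_mono) auto
      then show "R + t \<le> (R + 1) * t" by (simp add: algebra_simps)
    qed
    also have "k \<le> f 0 + m * t"
    proof -
      have "m * 1 \<le> m * t" using t m by (intro mult_left_mono) auto
      then show ?thesis using m by linarith
    qed
    also have "f 0 + m * t + \<beta> * ((R + 1) * t) - \<alpha> * t\<^sup>2 = f 0 + t * (b - \<alpha> * t)"
      by (simp add: b_def algebra_simps power2_eq_square)
    also have "\<dots> \<le> f 0"
    proof -
      have "b \<le> \<alpha> * t" using t(2) \<alpha> by (simp add: field_simps)
      then show ?thesis using t by (simp add: mult_nonneg_nonpos)
    qed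
    finally show ?thesis by simp
  qed
  have "cball (0 :: 'a) S \<noteq> {}" "continuous_on (cball 0 S) f"
    using S continuous_on_subset[OF f] by auto
  then obtain y where "\<forall>z\<in>cball 0 S. f z \<le> f y"
    using continuous_attains_sup[OF compact_cball] by blast
  then have y: "\<And>z. z \<in> cball 0 S \<Longrightarrow> f z \<le> f y" by blast
  have "f z \<le> f y" for z
  proof (cases "norm z \<le> S")
    case False
    then have "f z \<le> f 0" by (intro far) simp
    also have "f 0 \<le> f y" using S by (intro y) simp
    finally show ?thesis .
  qed (use y in simp)
  then show ?thesis by blast
qed

text \<open>This plays the role of the Crandall-Ishii maximum principle for semicontinuous
  functions. Maximising first over \<open>x1\<close> and \<open>y2\<close> leaves
  \<open>a y1 - b y1 - p \<bullet> y1\<close> with \<open>a\<close> a shifted sup-convolution and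
  \<open>b\<close> an inf-convolution, so the contact theorem applies. The price of the tilt is that
  the two gradients differ by \<open>p\<close>.\<close>

theorem doubling_contact:
  fixes u v :: "real^'n \<Rightarrow> real" and d :: "real^'n"
  assumes K: "compact K" "K \<noteq> {}" and u: "continuous_on K u" and v: "continuous_on K v"
    and \<alpha>: "0 < \<alpha>" and \<delta>: "0 < \<delta>"
  obtains p x y y' W where "norm p < \<delta>" "x \<in> K" "y' \<in> K"
    "\<forall>x1\<in>K. \<forall>y2\<in>K. \<forall>y1. u x1 - v y2 - \<alpha> / 2 * (norm (x1 - d - y1))\<^sup>2 - \<alpha> / 2 * (norm (y2 - y1))\<^sup>2 - p \<bullet> y1
      \<le> u x - v y' - \<alpha> / 2 * (norm (x - d - y))\<^sup>2 - \<alpha> / 2 * (norm (y' - y))\<^sup>2 - p \<bullet> y"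
    "W \<in> sym_mats" "\<forall>h. \<bar>h \<bullet> (W *v h)\<bar> \<le> \<alpha> * (norm h)\<^sup>2"
    "\<alpha> *\<^sub>R (x - d - y) = \<alpha> *\<^sub>R (y - y') + p"
    "\<forall>e>0. \<exists>\<phi>. C2 \<phi> \<and> grad \<phi> x = \<alpha> *\<^sub>R (x - d - y) \<and>
      hess \<phi> x = (W - (1 / (2 * \<alpha>)) *\<^sub>R (W ** W)) + e *\<^sub>R mat 1 \<and> (\<forall>z\<in>K. u z - \<phi> z \<le> u x - \<phi> x)"
    "\<forall>e>0. \<exists>\<phi>. C2 \<phi> \<and> grad \<phi> y' = \<alpha> *\<^sub>R (y - y') \<and>
      hess \<phi> y' = (W + (1 / (2 * \<alpha>)) *\<^sub>R (W ** W)) - e *\<^sub>R mat 1 \<and> (\<forall>z\<in>K. v y' - \<phi> y' \<le> v z - \<phi> z)"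
proof -
  obtain a0 where a0: "semiconvex \<alpha> a0" "\<And>x y. x \<in> K \<Longrightarrow> u x \<le> a0 y + \<alpha> / 2 * (norm (x - y))\<^sup>2"
    "\<And>y. \<exists>x\<in>K. a0 y = u x - \<alpha> / 2 * (norm (x - y))\<^sup>2"
    using sup_convolution_exists[OF K u] by blast
  have "continuous_on K (\<lambda>x. - v x)" by (intro continuous_intros v)
  from sup_convolution_exists[OF K this] obtain b0 where b0: "semiconvex \<alpha> b0"
    "\<And>x y. x \<in> K \<Longrightarrow> - v x \<le> b0 y + \<alpha> / 2 * (norm (x - y))\<^sup>2"
    "\<And>y. \<exists>x\<in>K. b0 y = - v x - \<alpha> / 2 * (norm (x - y))\<^sup>2" by blast
  define a where "a = (\<lambda>y. a0 (y + d))"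
  define b where "b = (\<lambda>y. - b0 y)"
  have a: "semiconvex \<alpha> a" unfolding a_def by (rule semiconvex_shift[OF a0(1)])
  have b: "semiconvex \<alpha> (\<lambda>y. - b y)" using b0(1) by (simp add: b_def)
  have a_ge: "u x' \<le> a y' + \<alpha> / 2 * (norm (x' - d - y'))\<^sup>2" if "x' \<in> K" for x' y'
    using a0(2)[OF that, of "y' + d"] by (simp add: a_def algebra_simps)
  have a_at: "\<exists>x\<in>K. a y = u x - \<alpha> / 2 * (norm (x - d - y))\<^sup>2" for y
    using a0(3)[of "y + d"] by (simp add: a_def algebra_simps)
  obtain Bu where Bu: "\<And>x. x \<in> K \<Longrightarrow> \<bar>u x\<bar> \<le> Bu"
    using compact_imp_bounded[OF compact_continuous_image[OF u K(1)]] by (auto simp: bounded_iff)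
  obtain Bv where Bv: "\<And>x. x \<in> K \<Longrightarrow> \<bar>v x\<bar> \<le> Bv"
    using compact_imp_bounded[OF compact_continuous_image[OF v K(1)]] by (auto simp: bounded_iff)
  obtain BK where BK: "\<And>x. x \<in> K \<Longrightarrow> norm x \<le> BK"
    using compact_imp_bounded[OF K(1)] by (auto simp: bounded_iff)
  define R where "R = BK + norm d"
  have R: "0 \<le> R" using K(2) BK by (auto simp: R_def intro: add_nonneg_nonneg order_trans[OF norm_ge_zero])
  have ex: "\<exists>y. \<forall>z. a z - b z - p \<bullet> z \<le> a y - b y - p \<bullet> y" if "norm p < \<delta>" for p
  proof (rule continuous_max_of_coercive[of "\<lambda>y. a y - b y - p \<bullet> y" "\<alpha> / 2" R "norm p" "Bu + Bv"])
    have "continuous_on UNIV (\<lambda>y. a y + (- b y) - p \<bullet> y)"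
      by (intro continuous_intros semiconvex_continuous[OF a] semiconvex_continuous[OF b])
    then show "continuous_on UNIV (\<lambda>y. a y - b y - p \<bullet> y)" by simp
    fix y :: "real^'n" assume y: "R \<le> norm y"
    obtain x where x: "x \<in> K" "a y = u x - \<alpha> / 2 * (norm (x - d - y))\<^sup>2" using a_at by blast
    have "norm y - R \<le> norm (x - d - y)"
      using norm_triangle_ineq2[of y "x - d"] norm_triangle_ineq4[of x d] BK[OF x(1)]
      by (simp add: R_def norm_minus_commute)
    then have "(norm y - R)\<^sup>2 \<le> (norm (x - d - y))\<^sup>2" using y by (intro power_mono) auto
    then have "\<alpha> / 2 * (norm y - R)\<^sup>2 \<le> \<alpha> / 2 * (norm (x - d - y))\<^sup>2" using \<alpha> by (intro mult_left_mono) auto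
    then have "a y \<le> Bu - \<alpha> / 2 * (norm y - R)\<^sup>2" using x Bu[OF x(1)] by simp
    moreover have "- b y \<le> Bv"
    proof -
      obtain x' where "x' \<in> K" "b0 y = - v x' - \<alpha> / 2 * (norm (x' - y))\<^sup>2" using b0(3) by blast
      moreover have "0 \<le> \<alpha> / 2 * (norm (x' - y))\<^sup>2" using \<alpha> by simp
      ultimately show ?thesis using Bv[of x'] by (simp add: b_def)
    qed
    moreover have "- (p \<bullet> y) \<le> norm p * norm y" using Cauchy_Schwarz_ineq2[of p y] by simp
    ultimately show "a y - b y - p \<bullet> y \<le> Bu + Bv + norm p * norm y - \<alpha> / 2 * (norm y - R)\<^sup>2" by linarith
  qed (use \<alpha> R in auto)
  have \<alpha>0: "0 \<le> \<alpha>" using \<alpha> by simp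
  have "\<forall>p. norm p < \<delta> \<longrightarrow> (\<exists>y. \<forall>z. a z - b z - p \<bullet> z \<le> a y - b y - p \<bullet> y)" using ex by blast
  from semiconvex_contact_expansion[OF \<alpha>0 a b \<delta> this]
  obtain p y g T where p: "norm p < \<delta>" and max0: "\<forall>z. a z - b z - p \<bullet> z \<le> a y - b y - p \<bullet> y"
    and T0: "linear T" "\<forall>v w. T v \<bullet> w = v \<bullet> T w" "\<forall>h. \<bar>T h \<bullet> h\<bar> \<le> \<alpha> * (norm h)\<^sup>2"
    and exp0: "\<forall>e>0. \<exists>r>0. \<forall>h. norm h < r \<longrightarrow>
      a (y + h) \<le> a y + g \<bullet> h + (T h \<bullet> h) / 2 + e * (norm h)\<^sup>2 \<and>
      b (y + h) \<ge> b y + (g - p) \<bullet> h + (T h \<bullet> h) / 2 - e * (norm h)\<^sup>2"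
    by (elim exE conjE) (rule that, assumption+)
  note max = max0[rule_format] and T = T0(1) T0(2)[rule_format] T0(3)[rule_format]
    and exp = exp0[THEN spec, THEN mp]
  obtain x where x: "x \<in> K" "a y = u x - \<alpha> / 2 * (norm (x - d - y))\<^sup>2" using a_at by blast
  obtain y' where y': "y' \<in> K" "b0 y = - v y' - \<alpha> / 2 * (norm (y' - y))\<^sup>2" using b0(3) by blast
  define W where "W = matrix T"
  have WT: "W *v h = T h" for h by (simp add: W_def matrix_works T(1))
  have Wsym: "W \<in> sym_mats"
  proof -
    have "W $ i $ j = T (axis j 1) \<bullet> axis i 1" for i j
      by (simp add: W_def matrix_def inner_axis)
    then show ?thesis using T(2) by (simp add: sym_mats_iff_nth inner_commute)
  qed
  have Wb: "\<bar>h \<bullet> (W *v h)\<bar> \<le> \<alpha> * (norm h)\<^sup>2" for h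
    using T(3)[of h] by (simp add: WT inner_commute)
  note struct = matrix_pair_structure[OF Wsym \<alpha> Wb zero_less_one]
  let ?A = "W - (1 / (2 * \<alpha>)) *\<^sub>R (W ** W)" and ?B = "W + (1 / (2 * \<alpha>)) *\<^sub>R (W ** W)"
  have expa: "\<forall>e>0. \<exists>r>0. \<forall>h. norm h < r \<longrightarrow> a (y + h) \<le> a y + g \<bullet> h + (T h \<bullet> h) / 2 + e * (norm h)\<^sup>2"
    using exp by blast
  have leu: "\<forall>x'\<in>K. \<forall>y'. u x' \<le> a y' + \<alpha> / 2 * (norm (x' - d - y'))\<^sup>2" using a_ge by blast
  have eqx: "u x = a y + \<alpha> / 2 * (norm (x - d - y))\<^sup>2" using x(2) by simp
  have g: "g = \<alpha> *\<^sub>R (x - d - y)"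
    and upx: "\<And>e. e > 0 \<Longrightarrow> \<exists>r>0. \<forall>h. norm h < r \<and> x + h \<in> K \<longrightarrow>
      u (x + h) \<le> u x + g \<bullet> h + (T h \<bullet> h - (norm (T h))\<^sup>2 / (2 * \<alpha>)) / 2 + e * (norm h)\<^sup>2"
    using sup_convolution_expansion[OF \<alpha> T leu x(1) eqx expa] by blast+
  \<comment> \<open>The supersolution side is the same statement for \<open>- v\<close> and
    \<open>- b\<close> with shift 0. Negating \<open>T\<close> leaves its square unchanged, so the
    correction has the opposite sign relative to \<open>W\<close>.\<close>
  have T': "linear (\<lambda>h. - T h)" "\<And>v w. - T v \<bullet> w = v \<bullet> - T w" "\<And>h. \<bar>- T h \<bullet> h\<bar> \<le> \<alpha> * (norm h)\<^sup>2"
    using T by (auto intro: linear_compose_neg)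
  have b_ge: "- v x' \<le> - b y' + \<alpha> / 2 * (norm (x' - 0 - y'))\<^sup>2" if "x' \<in> K" for x' y'
    using b0(2)[OF that, of y'] by (simp add: b_def)
  have lev: "\<forall>x'\<in>K. \<forall>y'. - v x' \<le> - b y' + \<alpha> / 2 * (norm (x' - 0 - y'))\<^sup>2" using b_ge by blast
  have "\<exists>r>0. \<forall>h. norm h < r \<longrightarrow> - b (y + h) \<le> - b y + (p - g) \<bullet> h + (- T h \<bullet> h) / 2 + e * (norm h)\<^sup>2" if "e > 0" for e
  proof -
    from exp[OF that] obtain r where "r > 0" and r: "\<And>h. norm h < r \<Longrightarrow>
      b (y + h) \<ge> b y + (g - p) \<bullet> h + (T h \<bullet> h) / 2 - e * (norm h)\<^sup>2" by blast
    have "- b (y + h) \<le> - b y + (p - g) \<bullet> h + (- T h \<bullet> h) / 2 + e * (norm h)\<^sup>2" if "norm h < r" for h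
      using r[OF that] by (simp add: inner_diff_left)
    then show ?thesis using \<open>r > 0\<close> by blast
  qed
  then have expb: "\<forall>e>0. \<exists>r>0. \<forall>h. norm h < r \<longrightarrow>
    - b (y + h) \<le> - b y + (p - g) \<bullet> h + (- T h \<bullet> h) / 2 + e * (norm h)\<^sup>2" by blast
  have eqy: "- v y' = - b y + \<alpha> / 2 * (norm (y' - 0 - y))\<^sup>2" using y'(2) by (simp add: b_def)
  have g': "p - g = \<alpha> *\<^sub>R (y' - 0 - y)"
    and lowy: "\<And>e. e > 0 \<Longrightarrow> \<exists>r>0. \<forall>h. norm h < r \<and> y' + h \<in> K \<longrightarrow>
      - v (y' + h) \<le> - v y' + (p - g) \<bullet> h + (- T h \<bullet> h - (norm (- T h))\<^sup>2 / (2 * \<alpha>)) / 2 + e * (norm h)\<^sup>2"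
    using sup_convolution_expansion[OF \<alpha> T' lev y'(1) eqy expb] by blast+
  have gp: "g - p = \<alpha> *\<^sub>R (y - y')" using g' by (simp add: algebra_simps)
  have testu: "\<exists>\<phi>. C2 \<phi> \<and> grad \<phi> x = \<alpha> *\<^sub>R (x - d - y) \<and> hess \<phi> x = ?A + e *\<^sub>R mat 1 \<and>
      (\<forall>z\<in>K. u z - \<phi> z \<le> u x - \<phi> x)" if "e > 0" for e
  proof -
    have "\<exists>r>0. \<forall>h. norm h < r \<and> x + h \<in> K \<longrightarrow>
      u (x + h) \<le> u x + g \<bullet> h + (h \<bullet> (?A *v h)) / 2 + e / 2 * (norm h)\<^sup>2"
      using upx[of "e / 2"] that by (simp add: struct(3) WT inner_commute)
    moreover have "\<forall>z\<in>K. \<bar>u z\<bar> \<le> Bu" using Bu by blast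
    ultimately
    obtain \<phi> where "C2 \<phi>" "grad \<phi> x = g" "hess \<phi> x = ?A + (2 * (e / 2)) *\<^sub>R mat 1"
      "\<And>z. z \<in> K \<Longrightarrow> u z - \<phi> z \<le> u x - \<phi> x"
      using C2_test_function[OF K(1) x(1) _ struct(1), of u Bu g "e / 2"] by blast
    then show ?thesis using g by (intro exI[of _ \<phi>]) auto
  qed
  have testv: "\<exists>\<phi>. C2 \<phi> \<and> grad \<phi> y' = \<alpha> *\<^sub>R (y - y') \<and> hess \<phi> y' = ?B - e *\<^sub>R mat 1 \<and>
      (\<forall>z\<in>K. v y' - \<phi> y' \<le> v z - \<phi> z)" if "e > 0" for e
  proof -
    have form: "h \<bullet> ((- ?B) *v h) = - T h \<bullet> h - (norm (- T h))\<^sup>2 / (2 * \<alpha>)" for h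
    proof -
      have "h \<bullet> ((- ?B) *v h) = - (h \<bullet> (?B *v h))"
        using matrix_vector_mult_diff_rdistrib[of 0 ?B h] by (simp add: inner_diff_right)
      then show ?thesis unfolding struct(4) by (simp add: WT inner_commute)
    qed
    have "\<exists>r>0. \<forall>h. norm h < r \<and> y' + h \<in> K \<longrightarrow>
      - v (y' + h) \<le> - v y' + (p - g) \<bullet> h + (h \<bullet> ((- ?B) *v h)) / 2 + e / 2 * (norm h)\<^sup>2"
      using lowy[of "e / 2"] that unfolding form by simp
    moreover have "- ?B \<in> sym_mats" using struct(2) by (rule sym_mats_closed)
    moreover have "\<forall>z\<in>K. \<bar>- v z\<bar> \<le> Bv" using Bv by simp
    ultimately obtain \<phi> where \<phi>: "C2 \<phi>" "grad \<phi> y' = p - g" "hess \<phi> y' = - ?B + (2 * (e / 2)) *\<^sub>R mat 1"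
      "\<And>z. z \<in> K \<Longrightarrow> - v z - \<phi> z \<le> - v y' - \<phi> y'"
      using C2_test_function[OF K(1) y'(1), of "\<lambda>z. - v z" Bv "- ?B" "p - g" "e / 2"] by blast
    have "C2 (\<lambda>z. (-1) * \<phi> z)" "grad (\<lambda>z. (-1) * \<phi> z) y' = g - p" "hess (\<lambda>z. (-1) * \<phi> z) y' = ?B - e *\<^sub>R mat 1"
      using C2_scale(1)[OF \<phi>(1), of "-1"] C2_scale(2,3)[OF \<phi>(1), of "-1" y'] \<phi>(2,3) by simp_all
    moreover have "v y' - (-1) * \<phi> y' \<le> v z - (-1) * \<phi> z" if "z \<in> K" for z using \<phi>(4)[OF that] by simp
    ultimately show ?thesis unfolding gp by blast
  qed
  have maxi: "u x1 - v y2 - \<alpha> / 2 * (norm (x1 - d - y1))\<^sup>2 - \<alpha> / 2 * (norm (y2 - y1))\<^sup>2 - p \<bullet> y1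
      \<le> u x - v y' - \<alpha> / 2 * (norm (x - d - y))\<^sup>2 - \<alpha> / 2 * (norm (y' - y))\<^sup>2 - p \<bullet> y"
    if "x1 \<in> K" "y2 \<in> K" for x1 y1 y2
    using a_ge[OF that(1), of y1] b_ge[OF that(2), of y1] max[of y1] eqx eqy by simp
  have "\<alpha> *\<^sub>R (x - d - y) = \<alpha> *\<^sub>R (y - y') + p" unfolding g[symmetric] gp[symmetric] by simp
  then show ?thesis
    using that[of p x y' y W] p x(1) y'(1) maxi Wsym Wb testu testv by blast
qed

section \<open>Comparison principle\<close>

text \<open>The hypothesis bounds \<open>q ^ 2\<close> by a multiple of
  \<open>\<sigma> ^ 6 * (\<sigma> ^ 4 + q)\<close>. The first term allows \<open>q\<close> of order
  \<open>\<sigma> ^ 5\<close>, the second only \<open>\<sigma> ^ 6\<close>. Thus \<open>q\<close> is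
  one order smaller than the shift \<open>\<sigma> ^ 4\<close> of the comparison proof.\<close>

lemma penalty_estimate:
  fixes \<sigma> C q t k :: real
  assumes \<sigma>: "0 < \<sigma>" "\<sigma> \<le> 1" and C: "1 \<le> C" and q: "0 \<le> q" and t: "0 \<le> t" and k: "0 < k"
    and le: "q\<^sup>2 / (4 * \<sigma> ^ 6) + k\<^sup>2 * t\<^sup>2 \<le> C * (\<sigma> ^ 4 + q)"
  shows "q \<le> 8 * C * \<sigma> ^ 5" "k * t \<le> 3 * C * \<sigma>\<^sup>2"
proof -
  have p: "0 < \<sigma> ^ n" for n using \<sigma> by simp
  have "q\<^sup>2 / (4 * \<sigma> ^ 6) \<le> C * (\<sigma> ^ 4 + q)"
    using le zero_le_power2[of "k * t"] unfolding power_mult_distrib by linarith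
  then have q2: "q\<^sup>2 \<le> 4 * C * \<sigma> ^ 6 * (\<sigma> ^ 4 + q)"
    using p[of 6] by (simp add: field_simps)
  show ql: "q \<le> 8 * C * \<sigma> ^ 5"
  proof (rule ccontr)
    assume "\<not> q \<le> 8 * C * \<sigma> ^ 5"
    then have big: "8 * C * \<sigma> ^ 5 < q" by simp
    have s5: "8 * \<sigma> ^ 5 \<le> q" 
    proof -
      have "8 * \<sigma> ^ 5 * 1 \<le> 8 * \<sigma> ^ 5 * C" using C p[of 5] by (intro mult_left_mono) auto
      then show ?thesis using big by (simp add: mult_ac)
    qed
    have q0: "0 < q" using s5 p[of 5] by linarith
    have a: "4 * C * \<sigma> ^ 6 * q \<le> q / 2 * q"
    proof (rule mult_right_mono[OF _ q])
      have "C * \<sigma> ^ 6 \<le> C * \<sigma> ^ 5" using C \<sigma> by (intro mult_left_mono power_decreasing) auto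
      then show "4 * C * \<sigma> ^ 6 \<le> q / 2" using big by simp
    qed
    have b: "4 * C * \<sigma> ^ 6 * \<sigma> ^ 4 \<le> q / 2 * (q / 8)"
    proof -
      have "4 * C * \<sigma> ^ 6 * \<sigma> ^ 4 = (4 * C * \<sigma> ^ 5) * \<sigma> ^ 5" by (simp add: power_add[symmetric])
      also have "\<dots> \<le> q / 2 * (q / 8)" using big s5 C p[of 5] q0 by (intro mult_mono) auto
      finally show ?thesis .
    qed
    have "q * q \<le> q / 2 * q + q / 2 * (q / 8)"
      using q2 a b unfolding power2_eq_square distrib_left by linarith
    then have "q * q \<le> 0" by (simp add: field_simps)
    then show False using q0 by (simp add: mult_le_0_iff)
  qed
  have "k\<^sup>2 * t\<^sup>2 \<le> C * (\<sigma> ^ 4 + q)"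
  proof -
    have "0 \<le> q\<^sup>2 / (4 * \<sigma> ^ 6)" using p[of 6] by simp
    then show ?thesis using le by linarith
  qed
  also have "\<dots> \<le> C * (\<sigma> ^ 4 + 8 * C * \<sigma> ^ 4)"
  proof -
    have "8 * C * \<sigma> ^ 5 \<le> 8 * C * \<sigma> ^ 4" using C \<sigma> by (intro mult_left_mono power_decreasing) auto
    then have "q \<le> 8 * C * \<sigma> ^ 4" using ql by linarith
    then show ?thesis using C by (intro mult_left_mono) auto
  qed
  also have "\<dots> \<le> C * (C * \<sigma> ^ 4 + 8 * C * \<sigma> ^ 4)"
  proof -
    have "1 * \<sigma> ^ 4 \<le> C * \<sigma> ^ 4" using C p[of 4] by (intro mult_right_mono) auto
    then show ?thesis using C by (intro mult_left_mono) auto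
  qed
  also have "\<dots> = (3 * C * \<sigma>\<^sup>2)\<^sup>2" by (simp add: power2_eq_square power4_eq_xxxx)
  finally have "(k * t)\<^sup>2 \<le> (3 * C * \<sigma>\<^sup>2)\<^sup>2" by (simp add: power_mult_distrib)
  then show "k * t \<le> 3 * C * \<sigma>\<^sup>2" by (rule power2_le_imp_le) (use C in simp)
qed

section \<open>Continuity and structure estimates for the Hamiltonian\<close>

lemma uniformly_continuous_on_triple:
  fixes H :: "real^'n \<Rightarrow> real^'n \<Rightarrow> real^'n^'n \<Rightarrow> real"
  assumes "uniformly_continuous_on (UNIV \<times> UNIV \<times> sym_mats) (\<lambda>(x, p, A). H x p A)" "0 < e"
  obtains d where "0 < d" "\<And>x y p q A B. A \<in> sym_mats \<Longrightarrow> B \<in> sym_mats \<Longrightarrow>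
    norm (x - y) + norm (p - q) + norm (A - B) < d \<Longrightarrow> \<bar>H x p A - H y q B\<bar> < e"
proof -
  from assms obtain d where d: "0 < d"
    and dd: "\<And>z w. z \<in> UNIV \<times> UNIV \<times> sym_mats \<Longrightarrow> w \<in> UNIV \<times> UNIV \<times> sym_mats \<Longrightarrow> dist w z < d \<Longrightarrow>
      dist ((\<lambda>(x, p, A). H x p A) w) ((\<lambda>(x, p, A). H x p A) z) < e"
    unfolding uniformly_continuous_on_def by meson
  have "\<bar>H x p A - H y q B\<bar> < e"
    if "A \<in> sym_mats" "B \<in> sym_mats" "norm (x - y) + norm (p - q) + norm (A - B) < d" for x y p q A B
  proof -
    have "dist (x, p, A) (y, q, B) \<le> dist x y + dist (p, A) (q, B)"
      unfolding dist_Pair_Pair[of x "(p, A)"] by (rule sqrt_sum_squares_le_sum) auto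
    also have "dist (p, A) (q, B) \<le> dist p q + dist A B"
      unfolding dist_Pair_Pair by (rule sqrt_sum_squares_le_sum) auto
    finally have "dist (x, p, A) (y, q, B) < d" using that(3) by (simp add: dist_norm)
    with dd[of "(y, q, B)" "(x, p, A)"] that show ?thesis by (simp add: dist_real_def)
  qed
  then show ?thesis using d that by blast
qed

lemma hamiltonian_cond_contact_estimate:
  assumes "hamiltonian_cond H" "0 < e" and l: "0 < l"
  obtains t0 where "0 < t0" "\<And>\<alpha> W x y p. 0 < \<alpha> \<Longrightarrow> W \<in> sym_mats \<Longrightarrow> (\<And>h. \<bar>h \<bullet> (W *v h)\<bar> \<le> \<alpha> * (norm h)\<^sup>2) \<Longrightarrow>
    l * \<alpha> * (norm (x - y))\<^sup>2 + norm (x - y) * (norm p + 1) < t0 \<Longrightarrow>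
    H y p (l *\<^sub>R (W + (1 / (2 * \<alpha>)) *\<^sub>R (W ** W))) - H x p (l *\<^sub>R (W - (1 / (2 * \<alpha>)) *\<^sub>R (W ** W))) < e"
proof -
  have mono: "\<And>x p A B. A \<in> sym_mats \<Longrightarrow> B \<in> sym_mats \<Longrightarrow> B \<preceq> A \<Longrightarrow> H x p A \<le> H x p B"
    using assms(1) unfolding hamiltonian_cond_def by blast
  from assms(1)[unfolded hamiltonian_cond_def]
  obtain \<rho> where \<rho>: "modulus \<rho>" and st0: "\<forall>x y p. \<forall>\<epsilon>>0. \<forall>A\<in>sym_mats. \<forall>B\<in>sym_mats.
      - (3 / \<epsilon>) *\<^sub>R block_mat (mat 1) 0 0 (mat 1) \<preceq> block_mat A 0 0 (- B) \<and>
      block_mat A 0 0 (- B) \<preceq> (3 / \<epsilon>) *\<^sub>R block_mat (mat 1) (- mat 1) (- mat 1) (mat 1) \<longrightarrow>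
      H y p B - H x p A \<le> \<rho> (1 / \<epsilon> * (norm (x - y))\<^sup>2 + norm (x - y) * (norm p + 1))"
    by (elim exE conjE) (rule that, assumption+)
  note st = st0[rule_format, OF _ _ _ conjI]
  have "\<forall>\<^sub>F t in at_right 0. dist (\<rho> t) 0 < e"
    using \<rho> \<open>0 < e\<close> unfolding modulus_def by (auto dest: tendstoD)
  then obtain t0 where t0: "0 < t0" "\<And>t. 0 < t \<Longrightarrow> t < t0 \<Longrightarrow> \<rho> t < e"
    by (auto simp: eventually_at_right_field dist_real_def abs_less_iff)
  have "H y p (l *\<^sub>R (W + (1 / (2 * \<alpha>)) *\<^sub>R (W ** W))) - H x p (l *\<^sub>R (W - (1 / (2 * \<alpha>)) *\<^sub>R (W ** W))) < e"
    if \<alpha>: "0 < \<alpha>" and W: "W \<in> sym_mats" and b: "\<And>h. \<bar>h \<bullet> (W *v h)\<bar> \<le> \<alpha> * (norm h)\<^sup>2"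
      and small: "l * \<alpha> * (norm (x - y))\<^sup>2 + norm (x - y) * (norm p + 1) < t0" for \<alpha> W x y p
  proof -
    let ?A = "W - (1 / (2 * \<alpha>)) *\<^sub>R (W ** W)" and ?B = "W + (1 / (2 * \<alpha>)) *\<^sub>R (W ** W)"
    note S = matrix_pair_structure[OF W \<alpha> b l]
    have sym: "l *\<^sub>R ?A \<in> sym_mats" "l *\<^sub>R ?B \<in> sym_mats" using S(1,2) by (auto intro: sym_mats_closed)
    show ?thesis
    proof (cases "x = y")
      \<comment> \<open>Here the argument of \<open>\<rho>\<close> would be 0, where
        \<open>modulus\<close> gives no smallness. Ellipticity serves instead: the matrices differ
        by a nonnegative multiple of the square of \<open>W\<close>.\<close>
      case True
      have "l *\<^sub>R ?A \<preceq> l *\<^sub>R ?B" unfolding mat_le_def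
      proof
        fix h
        have "0 \<le> (norm (W *v h))\<^sup>2 / (2 * \<alpha>)" using \<alpha> by simp
        then have "h \<bullet> (?A *v h) \<le> h \<bullet> (?B *v h)" unfolding S(3,4) by linarith
        then have "l * (h \<bullet> (?A *v h)) \<le> l * (h \<bullet> (?B *v h))" using l by (intro mult_left_mono) auto
        then show "h \<bullet> (l *\<^sub>R ?A *v h) \<le> h \<bullet> (l *\<^sub>R ?B *v h)"
          unfolding scaleR_matrix_vector_assoc[symmetric] inner_scaleR_right .
      qed
      from mono[OF sym(2) sym(1) this, of x p] show ?thesis using True \<open>0 < e\<close> by simp
    next
      case False
      have "0 < 1 / (l * \<alpha>)" using l \<alpha> by simp
      from st[OF this sym S(5,6), of y p x]
      have "H y p (l *\<^sub>R ?B) - H x p (l *\<^sub>R ?A) \<le> \<rho> (l * \<alpha> * (norm (x - y))\<^sup>2 + norm (x - y) * (norm p + 1))"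
        by simp
      also have "\<dots> < e"
      proof (rule t0(2)[OF _ small])
        have "0 < norm (x - y) * (norm p + 1)" using False by (intro mult_pos_pos) (auto simp: add_nonneg_pos)
        moreover have "0 \<le> l * \<alpha> * (norm (x - y))\<^sup>2" using l \<alpha> by simp
        ultimately show "0 < l * \<alpha> * (norm (x - y))\<^sup>2 + norm (x - y) * (norm p + 1)" by linarith
      qed
      finally show ?thesis .
    qed
  qed
  then show ?thesis using t0(1) that by blast
qed

lemma Lip_continuous_on:
  assumes "u \<in> Lip M S"
  shows "continuous_on S u"
proof (cases "S = {}")
  case False
  have "M \<ge> 0" using assms False by (force simp: Lip_def)
  then have "M-lipschitz_on S u"
    using assms by (intro lipschitz_onI) (auto simp: Lip_def dist_norm)
  then show ?thesis by (rule lipschitz_on_continuous_on)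
qed simp

lemma eventually_linear_small:
  fixes a b :: real
  assumes "0 < b"
  shows "\<forall>\<^sub>F \<sigma> in at_right 0. a * \<sigma> < b"
proof -
  have "((\<lambda>\<sigma>. a * \<sigma>) \<longlongrightarrow> a * 0) (at_right 0)" by (intro tendsto_intros)
  then show ?thesis using assms by (intro order_tendstoD(2)[of _ "a * 0"]) auto
qed

text \<open>The subsolution inequality is assumed only where \<open>u > - M\<close>, because the
  truncated Hamiltonian says nothing about \<open>H\<close> where a subsolution equals
  \<open>- M\<close>. At the contact point \<open>u\<close> exceeds a value of \<open>v\<close>,
  which is at least \<open>- M\<close>, so the restriction is harmless. The parameter
  \<open>l\<close> stands for \<open>1 / lam\<close>.\<close>

theorem comparison:
  fixes \<theta> :: "(real^'n) set"
  assumes cpt: "compact (closure \<theta>)" and dom: "domain_cond \<theta>"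
    and UC: "uniformly_continuous_on (UNIV \<times> UNIV \<times> sym_mats) (\<lambda>(x, p, A). H x p A)"
    and HC: "hamiltonian_cond H" and M: "0 < M" and l: "0 < l"
    and u: "u \<in> Lip M (closure \<theta>)" and v: "v \<in> Lip M (closure \<theta>)"
    and sub: "\<And>x \<phi>. x \<in> \<theta> \<Longrightarrow> C2 \<phi> \<Longrightarrow> \<forall>y\<in>closure \<theta>. u y - \<phi> y \<le> u x - \<phi> x \<Longrightarrow> - M < u x \<Longrightarrow>
      u x + H x (l *\<^sub>R grad \<phi> x) (l *\<^sub>R hess \<phi> x) \<le> 0"
    and super: "\<And>x \<phi>. x \<in> closure \<theta> \<Longrightarrow> C2 \<phi> \<Longrightarrow> \<forall>y\<in>closure \<theta>. v x - \<phi> x \<le> v y - \<phi> y \<Longrightarrow>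
      0 \<le> v x + H x (l *\<^sub>R grad \<phi> x) (l *\<^sub>R hess \<phi> x)"
    and x0: "x0 \<in> closure \<theta>"
  shows "u x0 \<le> v x0"
proof (rule ccontr)
  assume contra: "\<not> u x0 \<le> v x0"
  define K where "K = closure \<theta>"
  have K: "compact K" "K \<noteq> {}" using cpt x0 by (auto simp: K_def)
  have cu: "continuous_on K u" and cv: "continuous_on K v"
    using u v by (auto simp: K_def intro: Lip_continuous_on)
  have uL: "\<bar>u x - u y\<bar> \<le> M * norm (x - y)" and vB: "\<bar>v x\<bar> \<le> M" if "x \<in> K" "y \<in> K" for x y
    using u v that by (auto simp: Lip_def K_def)
  have "continuous_on K (\<lambda>x. u x - v x)" by (intro continuous_intros cu cv)
  then obtain z where z: "z \<in> K" and zmax: "\<And>x. x \<in> K \<Longrightarrow> u x - v x \<le> u z - v z"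
    using continuous_attains_sup[OF K] by blast
  define \<delta>0 where "\<delta>0 = u z - v z"
  have \<delta>0: "0 < \<delta>0" using zmax[of x0] x0 contra by (simp add: \<delta>0_def K_def)
  from dom obtain m r where m: "uniformly_continuous_on K m" "\<And>x. x \<in> K \<Longrightarrow> norm (m x) \<le> 1" and r: "0 < r"
    and cone: "\<And>x s. x \<in> K \<Longrightarrow> 0 < s \<Longrightarrow> s \<le> r \<Longrightarrow> ball (x + s *\<^sub>R m x) (r * s) \<subseteq> \<theta>"
    unfolding domain_cond_def K_def by blast
  have \<theta>K: "\<theta> \<subseteq> K" by (simp add: K_def closure_subset)
  obtain B where B: "\<And>x. x \<in> K \<Longrightarrow> norm x \<le> B"
    using compact_imp_bounded[OF K(1)] by (auto simp: bounded_iff)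
  define D where "D = 2 * B"
  have D: "norm (x - y) \<le> D" if "x \<in> K" "y \<in> K" for x y
    using norm_triangle_ineq4[of x y] B[OF that(1)] B[OF that(2)] by (simp add: D_def)
  have D0: "0 \<le> D" using D[OF z z] by simp
  \<comment> \<open>\<open>C\<close> dominates the coefficients of \<open>s\<close> and
    \<open>q\<close> that are collected in \<open>Csq\<close>.\<close>
  define C where "C = 2 * M + D + 1"
  have C: "1 \<le> C" using M D0 by (simp add: C_def)
  \<comment> \<open>Three errors below \<open>e\<close> will occur, two from continuity of
    \<open>H\<close> and one from the structure condition. Together they stay below
    \<open>\<delta>0 / 4\<close>, against a gap of more than \<open>\<delta>0 / 2\<close>.\<close>
  define e where "e = \<delta>0 / 12"
  have e: "0 < e" using \<delta>0 by (simp add: e_def)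
  obtain d0 where d0: "0 < d0" and Hcont: "\<And>x y p q A B. A \<in> sym_mats \<Longrightarrow> B \<in> sym_mats \<Longrightarrow>
    norm (x - y) + norm (p - q) + norm (A - B) < d0 \<Longrightarrow> \<bar>H x p A - H y q B\<bar> < e"
    using uniformly_continuous_on_triple[OF UC e] by metis
  obtain t0 where t0: "0 < t0" and Hstruct: "\<And>\<alpha> W x y p. 0 < \<alpha> \<Longrightarrow> W \<in> sym_mats \<Longrightarrow> (\<And>h. \<bar>h \<bullet> (W *v h)\<bar> \<le> \<alpha> * (norm h)\<^sup>2) \<Longrightarrow>
    l * \<alpha> * (norm (x - y))\<^sup>2 + norm (x - y) * (norm p + 1) < t0 \<Longrightarrow>
    H y p (l *\<^sub>R (W + (1 / (2 * \<alpha>)) *\<^sub>R (W ** W))) - H x p (l *\<^sub>R (W - (1 / (2 * \<alpha>)) *\<^sub>R (W ** W))) < e"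
    by (rule hamiltonian_cond_contact_estimate[OF HC e l]) (rule that, assumption, blast)
  define I where "I = norm (mat 1 :: real^'n^'n)"
  have I: "0 \<le> I" by (simp add: I_def)
  \<comment> \<open>With the penalty coefficient \<open>k^2\<close>, the matrix arguments of
    \<open>H\<close> are perturbed by at most \<open>3 * l * k^2\<close> times the identity; this
    choice keeps the perturbation within \<open>d0 / 2\<close>.\<close>
  define k where "k = min 1 (d0 / (8 * l * (I + 1)))"
  have lI: "0 < 8 * l * (I + 1)" using l I by (intro mult_pos_pos) auto
  have k: "0 < k" "k \<le> 1" using d0 lI by (simp_all add: k_def)
  have kl: "4 * k\<^sup>2 * l * (I + 1) \<le> d0 / 2"
  proof -
    have "k * k \<le> 1 * k" using k by (intro mult_right_mono) auto
    then have "k\<^sup>2 * (8 * l * (I + 1)) \<le> k * (8 * l * (I + 1))"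
      using lI by (intro mult_right_mono) (auto simp: power2_eq_square)
    also have "\<dots> \<le> d0 / (8 * l * (I + 1)) * (8 * l * (I + 1))"
      using lI by (intro mult_right_mono) (auto simp: k_def)
    also have "\<dots> = d0" using lI by (intro iffD1[OF nonzero_eq_divide_eq refl]) linarith
    finally have "k\<^sup>2 * (8 * l * (I + 1)) \<le> d0" .
    moreover have "4 * k\<^sup>2 * l * (I + 1) = k\<^sup>2 * (8 * l * (I + 1)) / 2" by simp
    ultimately show ?thesis by linarith
  qed
  have "0 < r / 2" using r by simp
  then obtain \<tau> where \<tau>: "0 < \<tau>" "\<And>x y. x \<in> K \<Longrightarrow> y \<in> K \<Longrightarrow> norm (y - x) < \<tau> \<Longrightarrow> norm (m y - m x) < r / 2"
    using m(1) unfolding uniformly_continuous_on_def dist_norm by metis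
  \<comment> \<open>After \<open>\<sigma> < 1\<close> and \<open>\<sigma> < r\<close>, the
    conditions serve in order: \<open>q \<le> s * r / 2\<close>; closeness of \<open>y'\<close> to
    \<open>z\<close>; the gap at the contact; the difference of the gradients; the structure
    condition, where \<open>153 = 81 + 72\<close> adds the two parts of its argument.\<close>
  have "\<forall>\<^sub>F \<sigma> in at_right 0. 0 < \<sigma> \<and> 1 * \<sigma> < 1 \<and> 1 * \<sigma> < r \<and> 16 * C * \<sigma> < r \<and> 3 * C * \<sigma> < k * \<tau> \<and>
      9 * C\<^sup>2 * \<sigma> < \<delta>0 / 2 \<and> l * (1 + 6 * C) * \<sigma> < d0 / 2 \<and> (153 * l * C\<^sup>2 + 9 * C) * \<sigma> < t0"
    using r k \<tau> \<delta>0 d0 t0 by (intro eventually_conj eventually_linear_small eventually_at_right_less) auto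
  from eventually_happens'[OF trivial_limit_at_right_real this]
  obtain \<sigma> where "0 < \<sigma> \<and> 1 * \<sigma> < 1 \<and> 1 * \<sigma> < r \<and> 16 * C * \<sigma> < r \<and> 3 * C * \<sigma> < k * \<tau> \<and>
      9 * C\<^sup>2 * \<sigma> < \<delta>0 / 2 \<and> l * (1 + 6 * C) * \<sigma> < d0 / 2 \<and> (153 * l * C\<^sup>2 + 9 * C) * \<sigma> < t0" ..
  then have \<sigma>: "0 < \<sigma>" "\<sigma> < 1" "\<sigma> < r" "16 * C * \<sigma> < r" "3 * C * \<sigma> < k * \<tau>"
    "9 * C\<^sup>2 * \<sigma> < \<delta>0 / 2" "l * (1 + 6 * C) * \<sigma> < d0 / 2" "(153 * l * C\<^sup>2 + 9 * C) * \<sigma> < t0"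
    unfolding mult_1 by blast+
  have pos: "0 < \<sigma> ^ n" for n using \<sigma> by simp
  have dec: "\<sigma> ^ n \<le> \<sigma> ^ i" if "i \<le> n" for i n using \<sigma> that by (intro power_decreasing) auto
  have dec1: "\<sigma> ^ n \<le> \<sigma>" if "1 \<le> n" for n using dec[OF that] by simp
  txt \<open>The exponents are chosen so that \<open>\<alpha> s\<close> is large (the displacement of \<open>x\<close> from \<open>y' + s m(z)\<close> is
    then \<open>o(s)\<close>, which keeps \<open>x\<close> in the cone at \<open>y'\<close>), while \<open>\<alpha> s\<^sup>2\<close> is small.\<close>
  define s where "s = \<sigma> ^ 4"
  define \<alpha> where "\<alpha> = 1 / \<sigma> ^ 6"
  have s: "0 < s" "s \<le> \<sigma>" "s \<le> r" "s \<le> 1" using pos dec1[of 4] \<sigma> by (auto simp: s_def)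
  have \<alpha>: "0 < \<alpha>" using pos[of 6] \<sigma>(1) by (simp add: \<alpha>_def)
  define d where "d = s *\<^sub>R m z"
  have nd: "norm d \<le> s" using m(2)[OF z] s mult_left_mono[of "norm (m z)" 1 s] by (simp add: d_def)
  have zd: "z + d \<in> K"
  proof -
    have "z + d \<in> ball (z + s *\<^sub>R m z) (r * s)" using r s by (simp add: d_def)
    then show ?thesis using cone[OF z s(1,3)] \<theta>K by blast
  qed
  \<comment> \<open>The penalty is centred at the maximum point \<open>z\<close> of
    \<open>u - v\<close> and attached to \<open>v\<close>. It forces \<open>y'\<close> close to
    \<open>z\<close>, so that the cone direction \<open>m y'\<close> is close to the direction
    \<open>m z\<close> of the shift.\<close>
  define \<kappa> where "\<kappa> = k\<^sup>2"
  have \<kappa>: "0 < \<kappa>" using k by (simp add: \<kappa>_def)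
  define v' where "v' = (\<lambda>y. v y + \<kappa> * (norm (y - z))\<^sup>2)"
  have cv': "continuous_on K v'" unfolding v'_def by (intro continuous_intros cv)
  obtain p x y y' W where p: "norm p < s" and xK: "x \<in> K" and y'K: "y' \<in> K"
    and mx: "\<forall>x1\<in>K. \<forall>y2\<in>K. \<forall>y1. u x1 - v' y2 - \<alpha> / 2 * (norm (x1 - d - y1))\<^sup>2 - \<alpha> / 2 * (norm (y2 - y1))\<^sup>2 - p \<bullet> y1
      \<le> u x - v' y' - \<alpha> / 2 * (norm (x - d - y))\<^sup>2 - \<alpha> / 2 * (norm (y' - y))\<^sup>2 - p \<bullet> y"
    and W: "W \<in> sym_mats" "\<forall>h. \<bar>h \<bullet> (W *v h)\<bar> \<le> \<alpha> * (norm h)\<^sup>2"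
    and grads: "\<alpha> *\<^sub>R (x - d - y) = \<alpha> *\<^sub>R (y - y') + p"
    and testu: "\<forall>e>0. \<exists>\<phi>. C2 \<phi> \<and> grad \<phi> x = \<alpha> *\<^sub>R (x - d - y) \<and>
      hess \<phi> x = (W - (1 / (2 * \<alpha>)) *\<^sub>R (W ** W)) + e *\<^sub>R mat 1 \<and> (\<forall>z\<in>K. u z - \<phi> z \<le> u x - \<phi> x)"
    and testv: "\<forall>e>0. \<exists>\<phi>. C2 \<phi> \<and> grad \<phi> y' = \<alpha> *\<^sub>R (y - y') \<and>
      hess \<phi> y' = (W + (1 / (2 * \<alpha>)) *\<^sub>R (W ** W)) - e *\<^sub>R mat 1 \<and> (\<forall>z\<in>K. v' y' - \<phi> y' \<le> v' z - \<phi> z)"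
    by (rule doubling_contact[OF K cu cv' \<alpha> s(1), where d=d]) (rule that, assumption+)
  define \<xi> where "\<xi> = x - d - y"
  define \<zeta> where "\<zeta> = y - y'"
  define q where "q = norm \<xi> + norm \<zeta>"
  define t where "t = norm (y' - z)"
  have q0: "0 \<le> q" and t0': "0 \<le> t" by (simp_all add: q_def t_def)
  have xy: "norm (x - y') \<le> q + s"
  proof -
    have "x - y' = \<xi> + \<zeta> + d" by (simp add: \<xi>_def \<zeta>_def)
    then show ?thesis
      using norm_triangle_ineq[of "\<xi> + \<zeta>" d] norm_triangle_ineq[of \<xi> \<zeta>] nd by (simp add: q_def)
  qed
  have pz: "\<bar>p \<bullet> (z - y)\<bar> \<le> s * D + q"
  proof -
    have "norm (z - y) \<le> norm (z - y') + norm \<zeta>"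
      using norm_triangle_ineq4[of "z - y'" \<zeta>] by (simp add: \<zeta>_def)
    also have "\<dots> \<le> D + q" using D[OF z y'K] norm_ge_zero[of \<xi>] unfolding q_def by linarith
    finally have "norm p * norm (z - y) \<le> s * (D + q)" using p s(1) by (intro mult_mono) auto
    moreover have "s * q \<le> 1 * q" using s q0 by (intro mult_right_mono) auto
    ultimately show ?thesis using Cauchy_Schwarz_ineq2[of p "z - y"] by (simp add: distrib_left)
  qed
  have uzd: "u z - M * s \<le> u (z + d)"
  proof -
    have "M * norm (z + d - z) \<le> M * s" using nd M by (intro mult_left_mono) auto
    then show ?thesis using uL[OF zd z] by linarith
  qed
  \<comment> \<open>The competitor is \<open>z + d\<close> in the first variable and
    \<open>z\<close> in the other two; the cone condition has put \<open>z + d\<close> into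
    \<open>K\<close>.\<close>
  have main: "u (z + d) - v z - p \<bullet> z \<le> u x - v y' - \<kappa> * t\<^sup>2 - \<alpha> / 2 * (norm \<xi>)\<^sup>2 - \<alpha> / 2 * (norm \<zeta>)\<^sup>2 - p \<bullet> y"
    using mx[rule_format, OF zd z, of z]
    by (simp add: v'_def t_def \<xi>_def \<zeta>_def norm_minus_commute[of y' y])
  have nonneg: "0 \<le> \<kappa> * t\<^sup>2" "0 \<le> \<alpha> / 2 * (norm \<xi>)\<^sup>2" "0 \<le> \<alpha> / 2 * (norm \<zeta>)\<^sup>2"
    using \<kappa> \<alpha> by auto
  have Csq: "M * s + M * (q + s) + (s * D + q) \<le> C * (s + q)" "M * s + (s * D + q) \<le> C * (s + q)"
    using M s q0 D0 by (simp_all add: C_def algebra_simps add_nonneg_nonneg)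
  \<comment> \<open>\<open>u x - v y'\<close> is at most \<open>\<delta>0\<close> plus the Lipschitz
    cost of moving \<open>x\<close> to \<open>y'\<close>, and \<open>\<delta>0\<close> cancels
    against the value of the competitor. Only terms of order \<open>s + q\<close> remain to bound
    the penalties.\<close>
  have "\<kappa> * t\<^sup>2 + \<alpha> / 2 * (norm \<xi>)\<^sup>2 + \<alpha> / 2 * (norm \<zeta>)\<^sup>2 \<le> C * (s + q)"
  proof -
    have "M * norm (x - y') \<le> M * (q + s)" using xy M by (intro mult_left_mono) auto
    then have "u x - v y' \<le> \<delta>0 + M * (q + s)"
      using uL[OF xK y'K] zmax[OF y'K] unfolding \<delta>0_def by linarith
    then show ?thesis using main uzd pz Csq(1) unfolding \<delta>0_def inner_diff_right by linarith
  qed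
  moreover have "q\<^sup>2 / (4 * \<sigma> ^ 6) \<le> \<alpha> / 2 * (norm \<xi>)\<^sup>2 + \<alpha> / 2 * (norm \<zeta>)\<^sup>2"
  proof -
    have "0 \<le> (norm \<xi> - norm \<zeta>)\<^sup>2" by simp
    then have "q\<^sup>2 \<le> 2 * (norm \<xi>)\<^sup>2 + 2 * (norm \<zeta>)\<^sup>2" by (simp add: q_def power2_eq_square algebra_simps)
    then have "\<alpha> / 4 * q\<^sup>2 \<le> \<alpha> / 4 * (2 * (norm \<xi>)\<^sup>2 + 2 * (norm \<zeta>)\<^sup>2)" using \<alpha> by (intro mult_left_mono) auto
    then show ?thesis by (simp add: \<alpha>_def algebra_simps)
  qed
  ultimately have "q\<^sup>2 / (4 * \<sigma> ^ 6) + k\<^sup>2 * t\<^sup>2 \<le> C * (\<sigma> ^ 4 + q)" by (simp add: \<kappa>_def s_def)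
  from penalty_estimate[OF \<sigma>(1) less_imp_le[OF \<sigma>(2)] C q0 t0' k(1) this]
  have q: "q \<le> 8 * C * \<sigma> ^ 5" and kt: "k * t \<le> 3 * C * \<sigma>\<^sup>2" .
  have q4: "q \<le> 8 * C * \<sigma> ^ 4"
  proof -
    have "8 * C * \<sigma> ^ 5 \<le> 8 * C * \<sigma> ^ 4" using C by (intro mult_left_mono dec) auto
    then show ?thesis using q by linarith
  qed
  have sq: "q + s \<le> 9 * C * \<sigma> ^ 4"
  proof -
    have "1 * \<sigma> ^ 4 \<le> C * \<sigma> ^ 4" using C less_imp_le[OF pos[of 4]] by (intro mult_right_mono)
    then show ?thesis using q4 unfolding s_def by linarith
  qed
  \<comment> \<open>\<open>x\<close> equals \<open>y' + s m z\<close> up to an error of norm at most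
    \<open>q\<close>. Replacing \<open>m z\<close> by \<open>m y'\<close> costs less than
    \<open>s * r / 2\<close>, and \<open>q\<close> is at most \<open>s * r / 2\<close>, so
    \<open>x\<close> lies in the cone at \<open>y'\<close>.\<close>
  have "x \<in> \<theta>"
  proof -
    have "k * t < k * \<tau>"
    proof -
      have "3 * C * \<sigma>\<^sup>2 \<le> 3 * C * \<sigma>" using dec1[of 2] C by (intro mult_left_mono) auto
      then show ?thesis using kt \<sigma>(5) by linarith
    qed
    then have "norm (y' - z) < \<tau>" using k by (simp add: t_def)
    then have "norm (m y' - m z) < r / 2" by (rule \<tau>(2)[OF z y'K])
    then have "s * norm (m y' - m z) < s * (r / 2)" using s by simp
    moreover have "q \<le> s * (r / 2)"
    proof -
      have "8 * C * \<sigma> ^ 5 = \<sigma> ^ 4 * (8 * C * \<sigma>)" using power_add[of \<sigma> 4 1] by simp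
      also have "\<dots> \<le> \<sigma> ^ 4 * (r / 2)" using \<sigma>(4) pos[of 4] by (intro mult_left_mono) auto
      finally show ?thesis using q by (simp add: s_def)
    qed
    moreover have "norm (y' + s *\<^sub>R m y' - x) \<le> s * norm (m y' - m z) + q"
    proof -
      have "y' + s *\<^sub>R m y' - x = s *\<^sub>R (m y' - m z) - (\<xi> + \<zeta>)"
        by (simp add: \<xi>_def \<zeta>_def d_def algebra_simps)
      then show ?thesis
        using norm_triangle_ineq4[of "s *\<^sub>R (m y' - m z)" "\<xi> + \<zeta>"] norm_triangle_ineq[of \<xi> \<zeta>] s
        by (simp add: q_def)
    qed
    ultimately have "x \<in> ball (y' + s *\<^sub>R m y') (r * s)" by (simp add: dist_norm mult.commute)
    then show ?thesis using cone[OF y'K s(1,3)] by blast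
  qed
  have big: "\<delta>0 / 2 < u x - v y'"
  proof -
    have "C * (s + q) \<le> C * (9 * C * \<sigma>)"
    proof (rule mult_left_mono)
      have "9 * C * \<sigma> ^ 4 \<le> 9 * C * \<sigma>" using dec1[of 4] C by (intro mult_left_mono) auto
      then show "s + q \<le> 9 * C * \<sigma>" using sq by simp
    qed (use C in simp)
    also have "\<dots> = 9 * C\<^sup>2 * \<sigma>" by (simp add: power2_eq_square)
    finally have "C * (s + q) < \<delta>0 / 2" using \<sigma>(6) by linarith
    then show ?thesis using main uzd pz Csq(2) nonneg \<delta>0_def unfolding inner_diff_right by linarith
  qed
  have ux: "- M < u x" using big \<delta>0 vB[OF y'K y'K] by linarith
  let ?A = "W - (1 / (2 * \<alpha>)) *\<^sub>R (W ** W)" and ?B = "W + (1 / (2 * \<alpha>)) *\<^sub>R (W ** W)"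
  have Wb: "\<bar>h \<bullet> (W *v h)\<bar> \<le> \<alpha> * (norm h)\<^sup>2" for h using W(2) by blast
  have symA: "?A \<in> sym_mats" and symB: "?B \<in> sym_mats"
    using matrix_pair_structure(1,2)[OF W(1) \<alpha> Wb l] by auto
  obtain \<phi> where \<phi>: "C2 \<phi>" "grad \<phi> x = \<alpha> *\<^sub>R \<xi>" "hess \<phi> x = ?A + \<kappa> *\<^sub>R mat 1" "\<forall>z\<in>K. u z - \<phi> z \<le> u x - \<phi> x"
    using testu[rule_format, OF \<kappa>] unfolding \<xi>_def by blast
  have subx: "u x + H x (l *\<^sub>R \<alpha> *\<^sub>R \<xi>) (l *\<^sub>R (?A + \<kappa> *\<^sub>R mat 1)) \<le> 0"
    using sub[OF \<open>x \<in> \<theta>\<close> \<phi>(1) _ ux] \<phi>(2,3,4) by (simp add: K_def)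
  obtain \<psi> where \<psi>: "C2 \<psi>" "grad \<psi> y' = \<alpha> *\<^sub>R \<zeta>" "hess \<psi> y' = ?B - \<kappa> *\<^sub>R mat 1" "\<forall>z\<in>K. v' y' - \<psi> y' \<le> v' z - \<psi> z"
    using testv[rule_format, OF \<kappa>] unfolding \<zeta>_def by blast
  define Q where "Q = (\<lambda>y. 0 \<bullet> (y - z) + 1 / 2 * ((y - z) \<bullet> ((2 * \<kappa>) *\<^sub>R mat 1 *v (y - z))))"
  have Qeq: "Q y = \<kappa> * (norm (y - z))\<^sup>2" for y
    by (simp add: Q_def dot_square_norm flip: scaleR_matrix_vector_assoc)
  have sym2: "(2 * \<kappa>) *\<^sub>R mat 1 \<in> (sym_mats :: (real^'n^'n) set)" by (intro sym_mats_closed)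
  have Q: "C2 Q" "grad Q y' = (2 * \<kappa>) *\<^sub>R (y' - z)" "hess Q y' = (2 * \<kappa>) *\<^sub>R mat 1"
    unfolding Q_def using C2_quadratic(1)[OF sym2, of 0 z] C2_quadratic(2,3)[OF sym2, of 0 z y']
    by (simp_all flip: scaleR_matrix_vector_assoc)
  \<comment> \<open>Taking the penalty out of the test function for \<open>v'\<close> gives one for
    \<open>v\<close>. Its Hessian drops by a further \<open>2 * \<kappa>\<close>, in total by
    \<open>3 * \<kappa>\<close> times the identity.\<close>
  define \<omega> where "\<omega> = (\<lambda>y. \<psi> y + (-1) * Q y)"
  have \<omega>: "C2 \<omega>" "grad \<omega> y' = \<alpha> *\<^sub>R \<zeta> - (2 * \<kappa>) *\<^sub>R (y' - z)" "hess \<omega> y' = ?B - \<kappa> *\<^sub>R mat 1 - (2 * \<kappa>) *\<^sub>R mat 1"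
    unfolding \<omega>_def
    using C2_add(1)[OF \<psi>(1) C2_scale(1)[OF Q(1), of "-1"]]
      C2_add(2,3)[OF \<psi>(1) C2_scale(1)[OF Q(1), of "-1"], of y'] C2_scale(2,3)[OF Q(1), of "-1" y'] \<psi>(2,3) Q(2,3)
    by simp_all
  let ?q = "l *\<^sub>R \<alpha> *\<^sub>R \<xi>" and ?q' = "l *\<^sub>R (\<alpha> *\<^sub>R \<zeta> - (2 * \<kappa>) *\<^sub>R (y' - z))"
  let ?A' = "l *\<^sub>R (?A + \<kappa> *\<^sub>R mat 1)" and ?B' = "l *\<^sub>R (?B - \<kappa> *\<^sub>R mat 1 - (2 * \<kappa>) *\<^sub>R mat 1)"
  have "\<forall>y\<in>closure \<theta>. v y' - \<omega> y' \<le> v y - \<omega> y"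
  proof
    fix w assume "w \<in> closure \<theta>"
    then have "v' y' - \<psi> y' \<le> v' w - \<psi> w" using \<psi>(4) by (simp add: K_def)
    then show "v y' - \<omega> y' \<le> v w - \<omega> w" by (simp add: \<omega>_def v'_def Qeq)
  qed
  from super[OF y'K[unfolded K_def] \<omega>(1) this]
  have supy: "0 \<le> v y' + H y' ?q' ?B'"
    by (simp only: \<omega>(2,3))
  have "\<bar>H y' ?q' ?B'
      - H y' ?q (l *\<^sub>R ?B)\<bar> < e"
  proof (rule Hcont)
    show "?B' \<in> sym_mats" "l *\<^sub>R ?B \<in> sym_mats"
      using symB by (auto intro!: sym_mats_closed)
    have "?B' - l *\<^sub>R ?B = (- (3 * l * \<kappa>)) *\<^sub>R (mat 1 :: real^'n^'n)"
      by (simp add: scaleR_diff_right algebra_simps flip: scaleR_left.add)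
    then have "norm (?B' - l *\<^sub>R ?B) = 3 * l * \<kappa> * I"
      using l \<kappa> by (simp add: I_def)
    also have "\<dots> \<le> 4 * k\<^sup>2 * l * (I + 1)"
    proof -
      have "0 \<le> l * \<kappa> * I" "0 \<le> l * \<kappa>" using l \<kappa> I by auto
      then show ?thesis by (simp add: \<kappa>_def algebra_simps)
    qed
    finally have 1: "norm (?B' - l *\<^sub>R ?B) \<le> d0 / 2" using kl by linarith
    have "?q' - ?q = - (l *\<^sub>R (p + (2 * \<kappa>) *\<^sub>R (y' - z)))"
      using grads[folded \<xi>_def \<zeta>_def] by (simp add: algebra_simps)
    then have "norm (?q' - ?q) = l * norm (p + (2 * \<kappa>) *\<^sub>R (y' - z))"
      using l by simp
    also have "\<dots> \<le> l * ((1 + 6 * C) * \<sigma>)"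
    proof (rule mult_left_mono)
      have "norm (p + (2 * \<kappa>) *\<^sub>R (y' - z)) \<le> norm p + 2 * \<kappa> * t"
        using norm_triangle_ineq[of p "(2 * \<kappa>) *\<^sub>R (y' - z)"] \<kappa> by (simp add: t_def)
      also have "2 * \<kappa> * t \<le> 6 * C * \<sigma>"
      proof -
        have "k * (k * t) \<le> 1 * (3 * C * \<sigma>\<^sup>2)" using mult_mono[OF k(2) kt] k t0' by simp
        moreover have "3 * C * \<sigma>\<^sup>2 \<le> 3 * C * \<sigma>" using dec1[of 2] C by (intro mult_left_mono) auto
        ultimately show ?thesis by (simp add: \<kappa>_def power2_eq_square)
      qed
      finally show "norm (p + (2 * \<kappa>) *\<^sub>R (y' - z)) \<le> (1 + 6 * C) * \<sigma>"
        using p s(2) by (simp add: algebra_simps)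
    qed (use l in simp)
    finally show "norm (y' - y') + norm (?q' - ?q)
        + norm (?B' - l *\<^sub>R ?B) < d0"
      using 1 \<sigma>(7) by (simp add: mult.assoc)
  qed
  moreover have "\<bar>H x ?q ?A' - H x ?q (l *\<^sub>R ?A)\<bar> < e"
  proof (rule Hcont)
    show "?A' \<in> sym_mats" "l *\<^sub>R ?A \<in> sym_mats"
      using symA by (auto intro!: sym_mats_closed)
    have "?A' - l *\<^sub>R ?A = (l * \<kappa>) *\<^sub>R (mat 1 :: real^'n^'n)"
      by (simp add: scaleR_add_right)
    then have "norm (?A' - l *\<^sub>R ?A) = l * \<kappa> * I"
      using l \<kappa> by (simp add: I_def)
    also have "\<dots> \<le> 4 * k\<^sup>2 * l * (I + 1)"
    proof -
      have "0 \<le> l * \<kappa> * I" "0 \<le> l * \<kappa>" using l \<kappa> I by auto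
      then show ?thesis by (simp add: \<kappa>_def algebra_simps)
    qed
    finally show "norm (x - x) + norm (?q - ?q)
        + norm (?A' - l *\<^sub>R ?A) < d0"
      using kl d0 by simp
  qed
  moreover have "H y' ?q (l *\<^sub>R ?B) - H x ?q (l *\<^sub>R ?A) < e"
  proof (rule Hstruct[OF \<alpha> W(1) Wb])
    have xy': "norm (x - y') \<le> 9 * C * \<sigma> ^ 4" using xy sq by linarith
    have \<sigma>\<alpha>: "\<sigma> ^ 6 * \<alpha> = 1" using pos[of 6] by (simp add: \<alpha>_def)
    have "(norm (x - y'))\<^sup>2 \<le> (9 * C * \<sigma> ^ 4)\<^sup>2" using xy' by (intro power_mono) auto
    also have "\<dots> = 81 * C\<^sup>2 * \<sigma>\<^sup>2 * \<sigma> ^ 6" by (simp add: power_mult_distrib flip: power_mult power_add)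
    finally have "l * \<alpha> * (norm (x - y'))\<^sup>2 \<le> l * \<alpha> * (81 * C\<^sup>2 * \<sigma>\<^sup>2 * \<sigma> ^ 6)"
      using l \<alpha> by (intro mult_left_mono) auto
    also have "\<dots> = l * 81 * C\<^sup>2 * \<sigma>\<^sup>2 * (\<sigma> ^ 6 * \<alpha>)" by (simp only: mult_ac)
    also have "\<dots> = 81 * l * C\<^sup>2 * \<sigma>\<^sup>2" unfolding \<sigma>\<alpha> by simp
    also have "\<dots> \<le> 81 * l * C\<^sup>2 * \<sigma>" using dec1[of 2] l by (intro mult_left_mono) auto
    finally have 1: "l * \<alpha> * (norm (x - y'))\<^sup>2 \<le> 81 * l * C\<^sup>2 * \<sigma>" .
    have "norm ?q = l * \<alpha> * norm \<xi>" using l \<alpha> by simp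
    also have "\<dots> \<le> l * \<alpha> * (8 * C * \<sigma> ^ 5)" 
    proof (rule mult_left_mono)
      show "norm \<xi> \<le> 8 * C * \<sigma> ^ 5" using q norm_ge_zero[of \<zeta>] unfolding q_def by linarith
    qed (use l \<alpha> in simp)
    finally have nx: "norm ?q \<le> l * \<alpha> * (8 * C * \<sigma> ^ 5)" .
    have "norm (x - y') * (norm ?q + 1) \<le> 9 * C * \<sigma> ^ 4 * (l * \<alpha> * (8 * C * \<sigma> ^ 5) + 1)"
      using xy' nx C pos[of 4] by (intro mult_mono) auto
    also have "\<dots> = 72 * l * C\<^sup>2 * (\<sigma> ^ 3 * (\<sigma> ^ 6 * \<alpha>)) + 9 * C * \<sigma> ^ 4"
    proof -
      have 2: "\<sigma> ^ 4 * \<sigma> ^ 5 = \<sigma> ^ 3 * \<sigma> ^ 6" by (simp flip: power_add)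
      have "9 * C * a * (l * \<alpha> * (8 * C * b) + 1) = 72 * l * C\<^sup>2 * (a * b * \<alpha>) + 9 * C * a" for a b
        by (simp add: algebra_simps power2_eq_square)
      from this[of "\<sigma> ^ 4" "\<sigma> ^ 5"] show ?thesis unfolding 2 by (simp only: mult.assoc)
    qed
    also have "\<dots> = 72 * l * C\<^sup>2 * \<sigma> ^ 3 + 9 * C * \<sigma> ^ 4" unfolding \<sigma>\<alpha> by simp
    also have "\<dots> \<le> 72 * l * C\<^sup>2 * \<sigma> + 9 * C * \<sigma>"
      using dec1[of 3] dec1[of 4] l C by (intro add_mono mult_left_mono) auto
    finally show "l * \<alpha> * (norm (x - y'))\<^sup>2 + norm (x - y') * (norm ?q + 1) < t0"
      using 1 \<sigma>(8) by (simp add: algebra_simps)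
  qed
  ultimately have "u x - v y' < 3 * e" using subx supy by linarith
  then show False using big \<delta>0 by (simp add: e_def)
qed

section \<open>Vanishing discount limit\<close>

text \<open>The discounted solutions are Lipschitz, so this removes the envelopes from the
  definition of a constrained solution.\<close>

lemma semicontinuous_envelopes_eq:
  assumes V: "continuous_on S V" and x: "x \<in> S"
  shows "usc_env S V x = V x" "lsc_env S V x = V x"
proof -
  let ?F = "inf (nhds x) (principal S)"
  have lim: "((\<lambda>y. ereal (V y)) \<longlongrightarrow> ereal (V x)) ?F"
  proof (rule tendsto_ereal, rule topological_tendstoI)
    fix B :: "real set" assume "open B" "V x \<in> B"
    then obtain A where "open A" "x \<in> A" "\<forall>y\<in>S. y \<in> A \<longrightarrow> V y \<in> B"
      using V x unfolding continuous_on_topological by meson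
    then show "\<forall>\<^sub>F y in ?F. V y \<in> B"
      unfolding eventually_inf_principal eventually_nhds by blast
  qed
  have "?F \<noteq> bot"
    using x by (auto simp: eventually_inf_principal eventually_nhds simp flip: eventually_False)
  then show "usc_env S V x = V x" "lsc_env S V x = V x"
    using lim_imp_Limsup[OF _ lim] lim_imp_Liminf[OF _ lim] by (simp_all add: usc_env_def lsc_env_def)
qed

text \<open>The dilation \<open>l = 1\<close> excludes \<open>- \<infinity>\<close> and the bound
  \<open>M\<close> excludes \<open>\<infinity>\<close>, so \<open>real_of_ereal\<close> in
  \<open>Hbar\<close> never returns its default value.\<close>

lemma Hbar_finite:
  shows "min (ereal M) (SUP l\<in>{0<..}. ereal (H x (l *\<^sub>R p) (l *\<^sub>R A))) = ereal (Hbar M H x p A)"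
proof -
  let ?S = "SUP l\<in>{0<..}. ereal (H x (l *\<^sub>R p) (l *\<^sub>R A))"
  have "ereal (H x (1 *\<^sub>R p) (1 *\<^sub>R A)) \<le> ?S" by (rule SUP_upper) simp
  then have "min (ereal M) ?S \<noteq> - \<infinity>" by (auto simp: min_def)
  moreover have "min (ereal M) ?S \<noteq> \<infinity>" by (auto simp: min_def)
  ultimately show ?thesis unfolding Hbar_def by (cases "min (ereal M) ?S") auto
qed

text \<open>\<open>w > - M\<close> forces \<open>Hbar\<close> below \<open>M\<close>. The minimum is
  then the supremum, which is finite and bounds every dilation.\<close>

lemma Hbar_leD:
  assumes "w + Hbar M H x p A \<le> 0" "- M < w" "0 < l"
  shows "w + H x (l *\<^sub>R p) (l *\<^sub>R A) \<le> 0"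
proof -
  let ?S = "SUP l\<in>{0<..}. ereal (H x (l *\<^sub>R p) (l *\<^sub>R A))"
  have fin: "min (ereal M) ?S = ereal (Hbar M H x p A)" by (rule Hbar_finite)
  have "Hbar M H x p A < M" using assms by simp
  then have "?S = ereal (Hbar M H x p A)" using fin by (auto simp: min_def split: if_splits)
  moreover have "ereal (H x (l *\<^sub>R p) (l *\<^sub>R A)) \<le> ?S" using assms(3) by (intro SUP_upper) simp
  ultimately have "H x (l *\<^sub>R p) (l *\<^sub>R A) \<le> Hbar M H x p A" by simp
  then show ?thesis using assms(1) by simp
qed

lemma Hbar_leI:
  assumes "\<And>l. 0 < l \<Longrightarrow> w + H x (l *\<^sub>R p) (l *\<^sub>R A) \<le> 0"
  shows "w + Hbar M H x p A \<le> 0"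
proof -
  let ?S = "SUP l\<in>{0<..}. ereal (H x (l *\<^sub>R p) (l *\<^sub>R A))"
  have "?S \<le> ereal (- w)"
  proof (rule SUP_least)
    fix l :: real assume "l \<in> {0<..}"
    then show "ereal (H x (l *\<^sub>R p) (l *\<^sub>R A)) \<le> ereal (- w)" using assms[of l] by simp
  qed
  then have "min (ereal M) ?S \<le> ereal (- w)" by (rule min.coboundedI2)
  then show ?thesis unfolding Hbar_finite by simp
qed

text \<open>A test function for \<open>lam * V\<close> becomes one for \<open>V\<close> after
  division by \<open>lam\<close>, which is how \<open>1 / lam\<close> enters \<open>H\<close>. The
  first part admits local maxima because the stability argument maximises over a small ball
  only.\<close>

lemma constrained_sol_scaled:
  assumes sol: "constrained_visc_sol \<theta> H lam V" and lam: "0 < lam"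
    and lip: "(\<lambda>x. lam * V x) \<in> Lip M (closure \<theta>)" and \<phi>: "C2 \<phi>"
  shows "x \<in> \<theta> \<Longrightarrow> \<forall>\<^sub>F y in at x within \<theta>. lam * V y - \<phi> y \<le> lam * V x - \<phi> x \<Longrightarrow>
      lam * V x + H x ((1 / lam) *\<^sub>R grad \<phi> x) ((1 / lam) *\<^sub>R hess \<phi> x) \<le> 0"
    and "x \<in> closure \<theta> \<Longrightarrow> \<forall>y\<in>closure \<theta>. lam * V x - \<phi> x \<le> lam * V y - \<phi> y \<Longrightarrow>
      0 \<le> lam * V x + H x ((1 / lam) *\<^sub>R grad \<phi> x) ((1 / lam) *\<^sub>R hess \<phi> x)"
proof -
  have "continuous_on (closure \<theta>) (\<lambda>x. (1 / lam) * (lam * V x))"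
    by (intro continuous_intros Lip_continuous_on[OF lip])
  then have cV: "continuous_on (closure \<theta>) V" using lam by simp
  note env = semicontinuous_envelopes_eq[OF cV]
  have \<theta>K: "y \<in> \<theta> \<Longrightarrow> y \<in> closure \<theta>" for y using closure_subset by blast
  have C: "C2 (\<lambda>y. (1 / lam) * \<phi> y)" "grad (\<lambda>y. (1 / lam) * \<phi> y) x = (1 / lam) *\<^sub>R grad \<phi> x"
    "hess (\<lambda>y. (1 / lam) * \<phi> y) x = (1 / lam) *\<^sub>R hess \<phi> x" for x
    using C2_scale[OF \<phi>] by blast+
  have scale: "lam * a - b \<le> lam * c - d \<longleftrightarrow> a - 1 / lam * b \<le> c - 1 / lam * d" for a b c d
  proof -
    have "lam * (a - 1 / lam * b) = lam * a - b" "lam * (c - 1 / lam * d) = lam * c - d"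
      using lam by (simp_all add: right_diff_distrib)
    then show ?thesis using mult_le_cancel_left_pos[OF lam, of "a - 1 / lam * b" "c - 1 / lam * d"] by simp
  qed
  show "lam * V x + H x ((1 / lam) *\<^sub>R grad \<phi> x) ((1 / lam) *\<^sub>R hess \<phi> x) \<le> 0"
    if x: "x \<in> \<theta>" and max: "\<forall>\<^sub>F y in at x within \<theta>. lam * V y - \<phi> y \<le> lam * V x - \<phi> x"
  proof -
    have "\<forall>\<^sub>F y in at x within \<theta>. y \<in> \<theta>" by (auto simp: eventually_at_topological)
    with max have "\<forall>\<^sub>F y in at x within \<theta>. usc_env (closure \<theta>) V y - 1 / lam * \<phi> y \<le> usc_env (closure \<theta>) V x - 1 / lam * \<phi> x"
      by eventually_elim (use scale env \<theta>K x in simp)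
    then have "lam * usc_env (closure \<theta>) V x + H x (grad (\<lambda>y. (1 / lam) * \<phi> y) x) (hess (\<lambda>y. (1 / lam) * \<phi> y) x) \<le> 0"
      using sol x C(1) unfolding constrained_visc_sol_def visc_subsol_def by blast
    then show ?thesis using env(1)[OF \<theta>K[OF x]] C(2,3) by simp
  qed
  show "0 \<le> lam * V x + H x ((1 / lam) *\<^sub>R grad \<phi> x) ((1 / lam) *\<^sub>R hess \<phi> x)"
    if x: "x \<in> closure \<theta>" and min: "\<forall>y\<in>closure \<theta>. lam * V x - \<phi> x \<le> lam * V y - \<phi> y"
  proof -
    have "\<forall>\<^sub>F y in at x within closure \<theta>. y \<in> closure \<theta>" by (auto simp: eventually_at_topological)
    then have "\<forall>\<^sub>F y in at x within closure \<theta>. lsc_env (closure \<theta>) V y - 1 / lam * \<phi> y \<ge> lsc_env (closure \<theta>) V x - 1 / lam * \<phi> x"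
      by eventually_elim (use scale env min x in simp)
    then have "lam * lsc_env (closure \<theta>) V x + H x (grad (\<lambda>y. (1 / lam) * \<phi> y) x) (hess (\<lambda>y. (1 / lam) * \<phi> y) x) \<ge> 0"
      using sol x C(1) unfolding constrained_visc_sol_def visc_supersol_def by blast
    then show ?thesis using env(2)[OF x] C(2,3) by simp
  qed
qed

text \<open>Dini's argument: monotonicity keeps a threshold valid for all smaller parameters, and
  the common Lipschitz constant extends it from a finite net to the surrounding balls.\<close>

lemma monotone_Lip_uniform_limit:
  fixes w :: "real \<Rightarrow> real^'n \<Rightarrow> real"
  assumes K: "compact K" and M: "0 < M" and lip': "\<forall>t>0. w t \<in> Lip M K"
    and mono: "\<forall>s>0. \<forall>t>s. \<forall>x\<in>K. w s x \<le> w t x"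
  obtains W where "W \<in> Lip M K" "uniform_limit K w W (at_right 0)"
proof -
  note lip = lip'[rule_format]
  have bd: "\<bar>w t x\<bar> \<le> M" and lp: "y \<in> K \<Longrightarrow> \<bar>w t x - w t y\<bar> \<le> M * norm (x - y)" if "0 < t" "x \<in> K" for t x y
    using lip[OF that(1)] that(2) by (auto simp: Lip_def)
  have mono': "w s x \<le> w t x" if "0 < s" "s \<le> t" "x \<in> K" for s t x
    using mono that by (cases "s = t") auto
  define W where "W = (\<lambda>x. INF t\<in>{0<..}. w t x)"
  have bdd: "bdd_below ((\<lambda>t. w t x) ` {0<..})" if "x \<in> K" for x
    using bd that by (intro bdd_belowI[of _ "- M"]) (force simp: abs_le_iff)
  have lower: "W x \<le> w t x" if "x \<in> K" "0 < t" for x t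
    unfolding W_def using that bdd by (intro cINF_lower) auto
  have approx: "\<exists>t>0. w t x < W x + e" if "x \<in> K" "0 < e" for x e
  proof -
    have "(INF t\<in>{0<..}. w t x) < W x + e" using that by (simp add: W_def)
    then show ?thesis using bdd[OF that(1)] by (subst (asm) cINF_less_iff) auto
  qed
  have Wlip: "W x \<le> W y + M * norm (x - y)" if "x \<in> K" "y \<in> K" for x y
  proof (rule field_le_epsilon)
    fix e :: real assume "0 < e"
    from approx[OF that(2) this] obtain t where t: "0 < t" "w t y < W y + e" by blast
    show "W x \<le> W y + M * norm (x - y) + e" using lower[OF that(1) t(1)] lp[OF t(1) that] t(2) by linarith
  qed
  have "W \<in> Lip M K"
    unfolding Lip_def
  proof (intro CollectI conjI ballI)
    fix x assume x: "x \<in> K"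
    have "W x \<le> M" using lower[OF x zero_less_one] bd[OF zero_less_one x] by linarith
    moreover have "- M \<le> W x" unfolding W_def
      using bd x by (intro cINF_greatest) (force simp: abs_le_iff)+
    ultimately show "\<bar>W x\<bar> \<le> M" by linarith
    show "\<bar>W x - W y\<bar> \<le> M * norm (x - y)" if y: "y \<in> K" for y
      using Wlip[OF x y] Wlip[OF y x] by (simp add: norm_minus_commute abs_le_iff)
  qed
  moreover have "uniform_limit K w W (at_right 0)"
  proof (rule uniform_limitI)
    fix e :: real assume e: "0 < e"
    define d where "d = e / (3 * M)"
    have d: "0 < d" "M * d = e / 3" using e M by (auto simp: d_def)
    have "K \<subseteq> (\<Union>x\<in>K. ball x d)" using d by force
    from compactE_image[OF K open_ball this] obtain F where F: "F \<subseteq> K" "finite F" "K \<subseteq> (\<Union>x\<in>F. ball x d)" by metis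
    have "\<forall>\<^sub>F t in at_right 0. \<forall>y\<in>K \<inter> ball x d. dist (w t y) (W y) < e" if x: "x \<in> F" for x
    proof -
      have xK: "x \<in> K" using x F by blast
      obtain t0 where t0: "0 < t0" "w t0 x < W x + e / 3" using approx[OF xK, of "e/3"] e by auto
      have "dist (w t y) (W y) < e" if t: "0 < t" "t < t0" and y: "y \<in> K" "y \<in> ball x d" for t y
      proof -
        have xy: "norm (x - y) < d" using y(2) by (simp add: dist_norm)
        then have "M * norm (x - y) < e / 3" using M d(2) by (metis mult_strict_left_mono)
        moreover have "w t y \<le> w t0 y" using t y by (intro mono') auto
        moreover have "W x \<le> W y + M * norm (x - y)" by (rule Wlip[OF xK y(1)])
        ultimately show ?thesis
          using lp[OF t0(1) xK y(1)] t0(2) lower[OF y(1) t(1)] by (simp add: dist_real_def)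
      qed
      then show ?thesis using t0(1) by (auto simp: eventually_at_right_field)
    qed
    then have "\<forall>\<^sub>F t in at_right 0. \<forall>x\<in>F. \<forall>y\<in>K \<inter> ball x d. dist (w t y) (W y) < e"
      using F(2) by (simp add: eventually_ball_finite_distrib)
    then show "\<forall>\<^sub>F t in at_right 0. \<forall>y\<in>K. dist (w t y) (W y) < e"
      by eventually_elim (use F(3) in blast)
  qed
  ultimately show ?thesis using that by blast
qed

text \<open>Fix the dilation \<open>l\<close>. Once \<open>l * lam < 1\<close>, radial monotonicity
  with the factor \<open>1 / (l * lam)\<close> bounds \<open>H\<close> at dilation \<open>l\<close>
  by \<open>H\<close> at dilation \<open>1 / lam\<close>, which the discounted equation controls.
  The limit gives the inequality for every \<open>l\<close>, hence for the supremum.\<close>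

theorem vanishing_discount_subsolution:
  assumes op: "open \<theta>"
    and UC: "uniformly_continuous_on (UNIV \<times> UNIV \<times> sym_mats) (\<lambda>(x, p, A). H x p A)"
    and sol: "\<And>lam. lam > 0 \<Longrightarrow> constrained_visc_sol \<theta> H lam (V lam)"
    and lip: "\<And>lam. lam > 0 \<Longrightarrow> (\<lambda>x. lam * V lam x) \<in> Lip M (closure \<theta>)"
    and rad: "\<And>l x p A. l \<ge> 1 \<Longrightarrow> x \<in> closure \<theta> \<Longrightarrow> A \<in> sym_mats \<Longrightarrow> H x p A \<le> H x (l *\<^sub>R p) (l *\<^sub>R A)"
    and w: "w \<in> Lip M (closure \<theta>)" and ul: "uniform_limit (closure \<theta>) (\<lambda>lam x. lam * V lam x) w (at_right 0)"
    and M: "0 < M"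
  shows "visc_le_zero \<theta> (Hbar M H) w"
  unfolding visc_le_zero_def
proof (intro conjI ballI allI impI)
  have "continuous_on (closure \<theta>) w" by (rule Lip_continuous_on[OF w])
  then show "usc_on (closure \<theta>) w"
    unfolding usc_on_def continuous_on_def by (auto intro: order_tendstoD)
  fix x \<phi> assume x: "x \<in> \<theta>" and "C2 \<phi> \<and> (\<forall>y\<in>\<theta>. w y - \<phi> y \<le> w x - \<phi> x)"
  then have \<phi>: "C2 \<phi>" and max: "\<And>y. y \<in> \<theta> \<Longrightarrow> w y - \<phi> y \<le> w x - \<phi> x" by auto
  have \<theta>K: "y \<in> \<theta> \<Longrightarrow> y \<in> closure \<theta>" for y using closure_subset by blast
  show "w x + Hbar M H x (grad \<phi> x) (hess \<phi> x) \<le> 0"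
  proof (rule Hbar_leI, rule field_le_epsilon)
    fix l e' :: real assume l: "0 < l" and e': "0 < e'"
    define e where "e = e' / 3"
    have e: "0 < e" using e' by (simp add: e_def)
    txt \<open>The quartic term makes the maximum strict without changing the derivatives at \<open>x\<close>.\<close>
    define \<Phi> where "\<Phi> = (\<lambda>y. \<phi> y + ((y - x) \<bullet> (y - x))\<^sup>2)"
    have \<Phi>: "C2 \<Phi>" "grad \<Phi> x = grad \<phi> x" "hess \<Phi> x = hess \<phi> x"
      unfolding \<Phi>_def using C2_add(2,3)[OF \<phi> C2_quartic(1)[of x], of x] C2_quartic(2,3)[of x]
      by (simp_all add: C2_add(1)[OF \<phi> C2_quartic(1)])
    obtain d0 where d0: "0 < d0" and Hcont: "\<And>x y p q A B. A \<in> sym_mats \<Longrightarrow> B \<in> sym_mats \<Longrightarrow>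
      norm (x - y) + norm (p - q) + norm (A - B) < d0 \<Longrightarrow> \<bar>H x p A - H y q B\<bar> < e"
      using uniformly_continuous_on_triple[OF UC e] by metis
    define N where "N = (\<lambda>y. norm (x - y) + norm (l *\<^sub>R grad \<Phi> x - l *\<^sub>R grad \<Phi> y) + norm (l *\<^sub>R hess \<Phi> x - l *\<^sub>R hess \<Phi> y))"
    have "continuous_on UNIV N" unfolding N_def
      by (intro continuous_intros C2_derivatives(3,4)[OF \<Phi>(1)])
    then have "isCont N x" by (simp add: continuous_on_eq_continuous_at)
    then have "(N \<longlongrightarrow> N x) (at x)" by (simp add: isCont_def)
    moreover have "N x = 0" by (simp add: N_def)
    ultimately have "\<forall>\<^sub>F y in at x. N y < d0" using d0 by (intro order_tendstoD(2)) auto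
    then obtain r1 where r1: "0 < r1" "\<And>y. y \<noteq> x \<Longrightarrow> dist y x < r1 \<Longrightarrow> N y < d0"
      by (auto simp: eventually_at)
    have r1': "N y < d0" if "dist y x < r1" for y using r1(2)[of y] that \<open>N x = 0\<close> d0 by (cases "y = x") auto
    obtain r2 where r2: "0 < r2" "ball x r2 \<subseteq> \<theta>" using op x by (meson openE)
    \<comment> \<open>The three bounds provide continuity of the derivatives of
      \<open>\<Phi>\<close>, a ball inside \<open>\<theta>\<close>, and a variation of
      \<open>w\<close> of at most \<open>e\<close>.\<close>
    define r where "r = min (min (r1 / 2) (r2 / 2)) (e / M)"
    have r: "0 < r" "r < r1" "r < r2" "r \<le> e / M" using r1 r2 e M by (auto simp: r_def)
    \<comment> \<open>On the sphere of radius \<open>r\<close> the quartic costs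
      \<open>r ^ 4\<close>. This exceeds the error \<open>2 * \<eta>\<close> of exchanging
      \<open>w\<close> and \<open>lam * V lam\<close> at two points, so the maximum over the ball is
      interior.\<close>
    define \<eta> where "\<eta> = min (r ^ 4 / 3) e"
    have r4: "0 < r ^ 4" using r(1) by simp
    then have "0 < \<eta>" "\<eta> \<le> r ^ 4 / 3" "\<eta> \<le> e" using e by (simp_all add: \<eta>_def)
    then have \<eta>: "0 < \<eta>" "2 * \<eta> < r ^ 4" "\<eta> \<le> e" using r4 by linarith+
    have "\<forall>\<^sub>F lam in at_right 0. (\<forall>y\<in>closure \<theta>. dist (lam * V lam y) (w y) < \<eta>) \<and> l * lam < 1 \<and> 0 < lam"
      by (intro eventually_conj uniform_limitD[OF ul \<eta>(1)] eventually_linear_small eventually_at_right_less) simp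
    then obtain lam where close: "\<forall>y\<in>closure \<theta>. dist (lam * V lam y) (w y) < \<eta>" and lam: "l * lam < 1" "0 < lam"
      using eventually_happens'[OF trivial_limit_at_right_real] by blast
    have cb: "cball x r \<subseteq> \<theta>" using r r2 by (force simp: subset_iff)
    define g where "g = (\<lambda>y. lam * V lam y - \<Phi> y)"
    have "continuous_on UNIV \<Phi>"
      using has_derivative_continuous[OF C2_derivatives(1)[OF \<Phi>(1)]] by (simp add: continuous_on_eq_continuous_at)
    then have "continuous_on (cball x r) g" unfolding g_def
      using cb \<theta>K by (intro continuous_intros continuous_on_subset[OF Lip_continuous_on[OF lip[OF lam(2)]]])
        (auto intro: continuous_on_subset)
    then obtain y where y: "y \<in> cball x r" and ymax: "\<And>z. z \<in> cball x r \<Longrightarrow> g z \<le> g y"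
      using continuous_attains_sup[of "cball x r" g] r(1) by force
    have y\<theta>: "y \<in> \<theta>" using y cb by blast
    have inner: "dist y x < r"
    proof (rule ccontr)
      assume "\<not> dist y x < r"
      then have "norm (y - x) = r" using y by (simp add: dist_norm norm_minus_commute)
      then have q: "((y - x) \<bullet> (y - x))\<^sup>2 = r ^ 4" by (simp add: dot_square_norm flip: power_mult)
      have "g x \<le> g y" using r(1) by (intro ymax) simp
      then show False
        using max[OF y\<theta>] close[rule_format, OF \<theta>K[OF x]] close[rule_format, OF \<theta>K[OF y\<theta>]] q \<eta>(2)
        by (simp add: g_def \<Phi>_def dist_real_def)
    qed
    have "\<forall>\<^sub>F z in at y within \<theta>. lam * V lam z - \<Phi> z \<le> lam * V lam y - \<Phi> y"
      unfolding eventually_at_topological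
    proof (intro exI[of _ "ball x r"] conjI ballI impI)
      show "y \<in> ball x r" using inner by (simp add: dist_commute)
      fix z assume "z \<in> ball x r"
      then have "g z \<le> g y" by (intro ymax) simp
      then show "lam * V lam z - \<Phi> z \<le> lam * V lam y - \<Phi> y" by (simp add: g_def)
    qed simp
    from constrained_sol_scaled(1)[OF sol[OF lam(2)] lam(2) lip[OF lam(2)] \<Phi>(1) y\<theta> this]
    have sub: "lam * V lam y + H y ((1 / lam) *\<^sub>R grad \<Phi> y) ((1 / lam) *\<^sub>R hess \<Phi> y) \<le> 0" .
    have sym: "l *\<^sub>R hess \<Phi> z \<in> sym_mats" for z by (intro sym_mats_closed hess_symmetric \<Phi>)
    have "1 \<le> 1 / (l * lam)" using l lam by simp
    from rad[OF this \<theta>K[OF y\<theta>] sym, of "l *\<^sub>R grad \<Phi> y"]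
    have "H y (l *\<^sub>R grad \<Phi> y) (l *\<^sub>R hess \<Phi> y) \<le> H y ((1 / lam) *\<^sub>R grad \<Phi> y) ((1 / lam) *\<^sub>R hess \<Phi> y)"
      using l by simp
    moreover have "\<bar>H x (l *\<^sub>R grad \<Phi> x) (l *\<^sub>R hess \<Phi> x) - H y (l *\<^sub>R grad \<Phi> y) (l *\<^sub>R hess \<Phi> y)\<bar> < e"
      using r1'[of y] inner r(2) unfolding N_def by (intro Hcont sym) auto
    moreover have "w x - e \<le> w y"
    proof -
      have "\<bar>w x - w y\<bar> \<le> M * norm (x - y)" using w \<theta>K[OF x] \<theta>K[OF y\<theta>] by (simp add: Lip_def)
      also have "\<dots> \<le> M * (e / M)" using inner r(4) M by (intro mult_left_mono) (auto simp: dist_norm norm_minus_commute)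
      finally show ?thesis using M by simp
    qed
    moreover have "w y - \<eta> < lam * V lam y"
      using close[rule_format, OF \<theta>K[OF y\<theta>]] by (simp add: dist_real_def abs_less_iff)
    ultimately show "w x + H x (l *\<^sub>R grad \<phi> x) (l *\<^sub>R hess \<phi> x) \<le> 0 + e'"
      using sub \<eta>(3) e_def unfolding \<Phi>(2,3) by linarith
  qed
qed

theorem theorem3p4:
  fixes \<theta> :: "(real^'n) set"
    and H :: "real^'n \<Rightarrow> real^'n \<Rightarrow> real^'n^'n \<Rightarrow> real"
    and M0 :: real
    and V :: "real \<Rightarrow> real^'n \<Rightarrow> real"
    and w0 :: "real^'n \<Rightarrow> real"
  assumes "\<theta> \<noteq> {}" and "open \<theta>" and "compact (closure \<theta>)" and "domain_cond \<theta>"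
    and "uniformly_continuous_on (UNIV \<times> UNIV \<times> sym_mats) (\<lambda>(x, p, A). H x p A)"
    and "hamiltonian_cond H"
    and "M0 > 0"
    and "\<And>lam. lam > 0 \<Longrightarrow> constrained_visc_sol \<theta> H lam (V lam)"
    and "\<And>lam. lam > 0 \<Longrightarrow> (\<lambda>x. lam * V lam x) \<in> Lip M0 (closure \<theta>)"
    and "\<And>l x p A. l \<ge> 1 \<Longrightarrow> x \<in> closure \<theta> \<Longrightarrow> A \<in> sym_mats \<Longrightarrow>
           H x (l *\<^sub>R p) (l *\<^sub>R A) \<ge> H x p A"
    and w0_def: "\<And>x. w0 x = Lim (at_right 0) (\<lambda>lam. lam * V lam x)"
  shows "uniform_limit (closure \<theta>) (\<lambda>lam x. lam * V lam x) w0 (at_right 0) \<and>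
    (\<forall>x\<in>closure \<theta>. w0 x = (SUP w\<in>subsols M0 \<theta> H. w x)) \<and>
    w0 \<in> subsols M0 \<theta> H"
proof -
  note op = assms(2) and cpt = assms(3) and dom = assms(4) and UC = assms(5) and HC = assms(6)
    and M = assms(7) and sol = assms(8) and lip = assms(9) and rad = assms(10)
  have \<theta>K: "y \<in> \<theta> \<Longrightarrow> y \<in> closure \<theta>" for y using closure_subset by blast
  \<comment> \<open>Used twice: with \<open>mu * V mu\<close> for monotonicity in the discount, and
    with a subsolution of the limit equation for maximality. In the second case the proviso
    \<open>- M0 < u x\<close> is what \<open>Hbar_leD\<close> needs.\<close>
  have below: "u x \<le> lam * V lam x"
    if lam: "0 < lam" and u: "u \<in> Lip M0 (closure \<theta>)" and x: "x \<in> closure \<theta>"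
      and sub: "\<And>x \<phi>. x \<in> \<theta> \<Longrightarrow> C2 \<phi> \<Longrightarrow> \<forall>y\<in>closure \<theta>. u y - \<phi> y \<le> u x - \<phi> x \<Longrightarrow> - M0 < u x \<Longrightarrow>
        u x + H x ((1 / lam) *\<^sub>R grad \<phi> x) ((1 / lam) *\<^sub>R hess \<phi> x) \<le> 0" for lam u x
  proof (rule comparison[OF cpt dom UC HC M _ u lip[OF lam] _ _ x])
    show "u x + H x ((1 / lam) *\<^sub>R grad \<phi> x) ((1 / lam) *\<^sub>R hess \<phi> x) \<le> 0"
      if "x \<in> \<theta>" "C2 \<phi>" "\<forall>y\<in>closure \<theta>. u y - \<phi> y \<le> u x - \<phi> x" "- M0 < u x" for x \<phi>
      by (rule sub[OF that])
    show "0 < 1 / lam" using lam by simp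
    show "0 \<le> lam * V lam x + H x ((1 / lam) *\<^sub>R grad \<phi> x) ((1 / lam) *\<^sub>R hess \<phi> x)"
      if "x \<in> closure \<theta>" "C2 \<phi>" "\<forall>y\<in>closure \<theta>. lam * V lam x - \<phi> x \<le> lam * V lam y - \<phi> y" for x \<phi>
      by (rule constrained_sol_scaled(2)[OF sol[OF lam] lam lip[OF lam] that(2,1,3)])
  qed
  have mono: "mu * V mu x \<le> lam * V lam x" if mu: "0 < mu" "mu < lam" and x: "x \<in> closure \<theta>" for mu lam x
  proof (rule below[OF _ lip[OF mu(1)] x])
    show lam: "0 < lam" using mu by simp
    fix x \<phi> assume x: "x \<in> \<theta>" and \<phi>: "C2 \<phi>"
      and max: "\<forall>y\<in>closure \<theta>. mu * V mu y - \<phi> y \<le> mu * V mu x - \<phi> x"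
    have "\<forall>\<^sub>F y in at x within \<theta>. mu * V mu y - \<phi> y \<le> mu * V mu x - \<phi> x"
      using max \<theta>K by (auto simp: eventually_at_topological)
    from constrained_sol_scaled(1)[OF sol[OF mu(1)] mu(1) lip[OF mu(1)] \<phi> x this]
    have "mu * V mu x + H x ((1 / mu) *\<^sub>R grad \<phi> x) ((1 / mu) *\<^sub>R hess \<phi> x) \<le> 0" .
    \<comment> \<open>The dilation \<open>1 / mu\<close> is \<open>1 / lam\<close> enlarged by the
      factor \<open>lam / mu\<close>, which exceeds 1; the smaller discount therefore satisfies the
      stronger inequality.\<close>
    moreover have "H x ((1 / lam) *\<^sub>R grad \<phi> x) ((1 / lam) *\<^sub>R hess \<phi> x)
        \<le> H x ((lam / mu) *\<^sub>R (1 / lam) *\<^sub>R grad \<phi> x) ((lam / mu) *\<^sub>R (1 / lam) *\<^sub>R hess \<phi> x)"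
      using mu by (intro rad \<theta>K x sym_mats_closed hess_symmetric \<phi>) simp
    ultimately show "mu * V mu x + H x ((1 / lam) *\<^sub>R grad \<phi> x) ((1 / lam) *\<^sub>R hess \<phi> x) \<le> 0"
      using lam by simp
  qed
  obtain W where W: "W \<in> Lip M0 (closure \<theta>)" "uniform_limit (closure \<theta>) (\<lambda>lam x. lam * V lam x) W (at_right 0)"
  proof (rule monotone_Lip_uniform_limit[OF cpt M])
    show "\<forall>t>0. (\<lambda>x. t * V t x) \<in> Lip M0 (closure \<theta>)" using lip by blast
    show "\<forall>s>0. \<forall>t>s. \<forall>x\<in>closure \<theta>. s * V s x \<le> t * V t x" using mono by blast
  qed
  \<comment> \<open>\<open>Lim\<close> is meaningful where the limit exists, which has been shown on
    the closure; nothing is claimed about \<open>w0\<close> elsewhere.\<close>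
  have w0W: "w0 x = W x" if "x \<in> closure \<theta>" for x
    unfolding w0_def using tendsto_uniform_limitI[OF W(2) that] by (intro tendsto_Lim) auto
  have w0Lip: "w0 \<in> Lip M0 (closure \<theta>)" using W(1) w0W by (simp add: Lip_def)
  have ul: "uniform_limit (closure \<theta>) (\<lambda>lam x. lam * V lam x) w0 (at_right 0)"
    using W(2) w0W unfolding uniform_limit_iff by simp
  have w0sub: "w0 \<in> subsols M0 \<theta> H"
    unfolding subsols_def
    using w0Lip vanishing_discount_subsolution[OF op UC sol lip rad w0Lip ul M] by simp
  have le: "w x \<le> w0 x" if w: "w \<in> subsols M0 \<theta> H" and x: "x \<in> closure \<theta>" for w x
  proof -
    have wl: "w \<in> Lip M0 (closure \<theta>)" and wv: "visc_le_zero \<theta> (Hbar M0 H) w" using w by (auto simp: subsols_def)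
    have "w x \<le> lam * V lam x" if lam: "0 < lam" for lam
    proof (rule below[OF lam wl x])
      fix x \<phi> assume x: "x \<in> \<theta>" and \<phi>: "C2 \<phi>" and max: "\<forall>y\<in>closure \<theta>. w y - \<phi> y \<le> w x - \<phi> x" and wM: "- M0 < w x"
      have "\<forall>y\<in>\<theta>. w y - \<phi> y \<le> w x - \<phi> x" using max \<theta>K by blast
      then have "w x + Hbar M0 H x (grad \<phi> x) (hess \<phi> x) \<le> 0"
        using wv x \<phi> unfolding visc_le_zero_def by blast
      then show "w x + H x ((1 / lam) *\<^sub>R grad \<phi> x) ((1 / lam) *\<^sub>R hess \<phi> x) \<le> 0"
        using wM lam by (intro Hbar_leD) auto
    qed
    then have "\<forall>\<^sub>F lam in at_right 0. w x \<le> lam * V lam x"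
      by (auto simp: eventually_at_right_field intro: exI[of _ 1])
    then show ?thesis
      by (rule tendsto_lowerbound[OF tendsto_uniform_limitI[OF ul x]]) simp
  qed
  \<comment> \<open>The supremum is a maximum, attained by \<open>w0\<close> itself, so its real
    value is well determined.\<close>
  have "w0 x = (SUP w\<in>subsols M0 \<theta> H. w x)" if "x \<in> closure \<theta>" for x
    by (rule sym, rule cSup_eq_maximum) (use w0sub le that in auto)
  then show ?thesis using ul w0sub by blast
qed

end
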